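(* Let $K=\mathbb{F}_q$ be a finite field of characteristic $p$, let $N\ge 1$ with $p\ge N$, let $\mathfrak{g}$ be a Lie subalgebra (over $K$) of $\mathfrak{ut}(N,K)$, and let $G=\exp(\mathfrak{g})$. Let $\Omega,\Omega_1,\Omega_2$ be coadjoint orbits of $G$ in $\mathfrak{g}^*$, with corresponding irreducible complex representations $T^\Omega,T^{\Omega_1},T^{\Omega_2}$ of $G$. Denote by $|M|$ the number of elements of the set $$M=\{(\lambda_1,\lambda_2):\ \lambda_1\in\Omega_1,\ \lambda_2\in\Omega_2,\ \lambda_1+\lambda_2\in\Omega\}.$$ Then the multiplicity of $T^\Omega$ in the tensor product representation $T^{\Omega_1}\otimes T^{\Omega_2}$ of $G$ is $$\mathrm{mult}(T^\Omega,T^{\Omega_1}\otimes T^{\Omega_2})=\frac{|M|}{\sqrt{|\Omega|\cdot|\Omega_1|\cdot|\Omega_2|}}.$$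
   Context: $\mathfrak{ut}(N,K)$ is the Lie algebra of all $N\times N$ upper triangular matrices over $K$ with zeros on the diagonal. Since $p\ge N$, the exponential map $\exp$ is defined on $\mathfrak{ut}(N,K)$ and maps each Lie subalgebra $\mathfrak{g}$ bijectively onto a subgroup $G=\exp(\mathfrak{g})$ of the unitriangular group $\mathrm{UT}(N,K)$. $\mathfrak{g}^*$ is the dual $K$-vector space. The coadjoint action of $G$ on $\mathfrak{g}^*$ is $(\mathrm{Ad}^*_g\lambda)(x)=\lambda(g^{-1}xg)$; its orbits are the coadjoint orbits. $|S|$ denotes the number of elements of a finite set $S$. Fix a nontrivial additive character $K\to\mathbb{C}^*$, written $x\mapsto e^{x}$. For $\lambda\in\mathfrak{g}^*$, a polarization of $\lambda$ is a subalgebra $\mathfrak{p}$ of $\mathfrak{g}$ that is a maximal isotropic subspace for the skew-symmetric form $B_\lambda(x,y)=\lambda([x,y])$ on $\mathfrak{g}$; polarizations always exist. Put $P=\exp(\mathfrak{p})$, let $\xi_\lambda:P\to\mathbb{C}^*$ be the one-dimensional representation $\xi_\lambda(\exp(x))=e^{\lambda(x)}$, and let $T^\lambda=\mathrm{ind}(\xi_\lambda,P,G)$ be the induced complex representation. Up to equivalence, $T^\lambda$ is irreducible, does not depend on the choice of $\mathfrak{p}$, and depends only on the coadjoint orbit $\Omega$ of $\lambda$; its equivalence class is denoted $T^\Omega$. *)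

theory Defs
  imports "Jordan_Normal_Form.VS_Connect"
begin

section \<open>Matrix representations of groups over the complex numbers\<close>

definition GL :: "nat \<Rightarrow> complex mat monoid" where
  "GL n = units_of (ring_mat TYPE(complex) n ())"

definition representation :: "('g, 'b) monoid_scheme \<Rightarrow> ('g \<Rightarrow> complex mat) \<Rightarrow> bool" where
  "representation G \<rho> \<longleftrightarrow> (\<exists>n. \<rho> \<in> hom G (GL n))"

definition rep_degree :: "('g, 'b) monoid_scheme \<Rightarrow> ('g \<Rightarrow> complex mat) \<Rightarrow> nat" where
  "rep_degree G \<rho> = dim_row (\<rho> \<one>\<^bsub>G\<^esub>)"

definition rep_equiv ::
  "('g, 'b) monoid_scheme \<Rightarrow> ('g \<Rightarrow> complex mat) \<Rightarrow> ('g \<Rightarrow> complex mat) \<Rightarrow> bool" where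
  "rep_equiv G \<rho> \<sigma> \<longleftrightarrow> (\<exists>P Q. \<forall>a\<in>carrier G. similar_mat_wit (\<rho> a) (\<sigma> a) P Q)"

definition irreducible_rep :: "('g, 'b) monoid_scheme \<Rightarrow> ('g \<Rightarrow> complex mat) \<Rightarrow> bool" where
  "irreducible_rep G \<rho> \<longleftrightarrow> representation G \<rho> \<and> rep_degree G \<rho> > 0 \<and>
     (\<forall>W. subspace class_ring W (module_vec TYPE(complex) (rep_degree G \<rho>)) \<and>
          (\<forall>a\<in>carrier G. \<forall>w\<in>W. \<rho> a *\<^sub>v w \<in> W) \<longrightarrow>
          W = {0\<^sub>v (rep_degree G \<rho>)} \<or> W = carrier_vec (rep_degree G \<rho>))"

definition direct_sum_rep :: "('g \<Rightarrow> complex mat) list \<Rightarrow> 'g \<Rightarrow> complex mat" where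
  "direct_sum_rep \<sigma>s a = diag_block_mat (map (\<lambda>\<sigma>. \<sigma> a) \<sigma>s)"

definition kronecker :: "complex mat \<Rightarrow> complex mat \<Rightarrow> complex mat" where
  "kronecker A B = mat (dim_row A * dim_row B) (dim_col A * dim_col B)
     (\<lambda>(i, j). A $$ (i div dim_row B, j div dim_col B) * B $$ (i mod dim_row B, j mod dim_col B))"

definition tensor_rep ::
  "('g \<Rightarrow> complex mat) \<Rightarrow> ('g \<Rightarrow> complex mat) \<Rightarrow> 'g \<Rightarrow> complex mat" where
  "tensor_rep \<rho> \<sigma> a = kronecker (\<rho> a) (\<sigma> a)"

text \<open>The number of summands equivalent to \<open>\<tau>\<close> in a decomposition of \<open>\<rho>\<close> into irreducible
  representations; this makes sense when \<open>\<rho>\<close> is completely reducible and \<open>\<tau>\<close> is irreducible.\<close>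

definition multiplicity_rep ::
  "('g, 'b) monoid_scheme \<Rightarrow> ('g \<Rightarrow> complex mat) \<Rightarrow> ('g \<Rightarrow> complex mat) \<Rightarrow> nat" where
  "multiplicity_rep G \<tau> \<rho> = (THE m. \<exists>\<sigma>s. (\<forall>\<sigma>\<in>set \<sigma>s. irreducible_rep G \<sigma>) \<and>
     rep_equiv G \<rho> (direct_sum_rep \<sigma>s) \<and> m = length (filter (rep_equiv G \<tau>) \<sigma>s))"

definition left_transversal :: "('g, 'b) monoid_scheme \<Rightarrow> 'g set \<Rightarrow> 'g list \<Rightarrow> bool" where
  "left_transversal G H ts \<longleftrightarrow> set ts \<subseteq> carrier G \<and>
     (\<forall>a\<in>carrier G. \<exists>!i. i < length ts \<and> a \<in> ts ! i <#\<^bsub>G\<^esub> H)"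

text \<open>The representation of \<open>G\<close> induced from a one-dimensional representation \<open>\<xi>\<close> of a subgroup
  \<open>H\<close>, written in the basis given by representatives \<open>ts\<close> of the left cosets of \<open>H\<close>.\<close>

definition induced_rep ::
  "('g, 'b) monoid_scheme \<Rightarrow> 'g set \<Rightarrow> ('g \<Rightarrow> complex) \<Rightarrow> 'g list \<Rightarrow> 'g \<Rightarrow> complex mat" where
  "induced_rep G H \<xi> ts a = mat (length ts) (length ts)
     (\<lambda>(i, j). let h = inv\<^bsub>G\<^esub> (ts ! i) \<otimes>\<^bsub>G\<^esub> a \<otimes>\<^bsub>G\<^esub> ts ! j in if h \<in> H then \<xi> h else 0)"

section \<open>Nilpotent matrix Lie algebras and their exponential groups\<close>

definition ut :: "nat \<Rightarrow> 'k::field mat set" where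
  "ut N = {A \<in> carrier_mat N N. \<forall>i<N. \<forall>j\<le>i. A $$ (i, j) = 0}"

abbreviation lin_subspace :: "nat \<Rightarrow> 'k::field mat set \<Rightarrow> bool" where
  "lin_subspace N W \<equiv> subspace class_ring W (module_mat TYPE('k) N N)"

definition bracket :: "'k::field mat \<Rightarrow> 'k mat \<Rightarrow> 'k mat" where
  "bracket x y = x * y - y * x"

definition lie_subalgebra :: "nat \<Rightarrow> 'k::field mat set \<Rightarrow> bool" where
  "lie_subalgebra N \<gg> \<longleftrightarrow> lin_subspace N \<gg> \<and> \<gg> \<subseteq> ut N \<and> (\<forall>x\<in>\<gg>. \<forall>y\<in>\<gg>. bracket x y \<in> \<gg>)"

text \<open>The exponential series stops before the \<open>N\<close>-th power, which vanishes on \<open>ut N\<close>; the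
  factorials are invertible when the characteristic is at least \<open>N\<close>.\<close>

definition mat_exp :: "nat \<Rightarrow> 'k::field mat \<Rightarrow> 'k mat" where
  "mat_exp N x = mat N N (\<lambda>(i, j). \<Sum>k<N. (x ^\<^sub>m k) $$ (i, j) / of_nat (fact k))"

definition exp_group :: "nat \<Rightarrow> 'k::field mat set \<Rightarrow> 'k mat monoid" where
  "exp_group N \<gg> = \<lparr>carrier = mat_exp N ` \<gg>, monoid.mult = (*), one = 1\<^sub>m N\<rparr>"

section \<open>Coadjoint orbits and the associated representations\<close>

text \<open>Linear forms are functions on \<open>\<gg>\<close>, represented extensionally so that sets of them can be
  counted.\<close>

definition dual :: "'k::field mat set \<Rightarrow> ('k mat \<Rightarrow> 'k) set" where
  "dual \<gg> = {l \<in> extensional \<gg>. (\<forall>x\<in>\<gg>. \<forall>y\<in>\<gg>. l (x + y) = l x + l y) \<and>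
     (\<forall>c. \<forall>x\<in>\<gg>. l (c \<cdot>\<^sub>m x) = c * l x)}"

definition dual_add :: "'k::field mat set \<Rightarrow> ('k mat \<Rightarrow> 'k) \<Rightarrow> ('k mat \<Rightarrow> 'k) \<Rightarrow> 'k mat \<Rightarrow> 'k" where
  "dual_add \<gg> l m = (\<lambda>x\<in>\<gg>. l x + m x)"

definition coadjoint :: "nat \<Rightarrow> 'k::field mat set \<Rightarrow> 'k mat \<Rightarrow> ('k mat \<Rightarrow> 'k) \<Rightarrow> 'k mat \<Rightarrow> 'k" where
  "coadjoint N \<gg> a l = (\<lambda>x\<in>\<gg>. l (inv\<^bsub>exp_group N \<gg>\<^esub> a * x * a))"

definition coadjoint_orbits :: "nat \<Rightarrow> 'k::field mat set \<Rightarrow> ('k mat \<Rightarrow> 'k) set set" where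
  "coadjoint_orbits N \<gg> =
     {(\<lambda>a. coadjoint N \<gg> a l) ` carrier (exp_group N \<gg>) |l. l \<in> dual \<gg>}"

definition isotropic :: "('k::field mat \<Rightarrow> 'k) \<Rightarrow> 'k mat set \<Rightarrow> bool" where
  "isotropic l W \<longleftrightarrow> (\<forall>x\<in>W. \<forall>y\<in>W. l (bracket x y) = 0)"

definition polarization :: "nat \<Rightarrow> 'k::field mat set \<Rightarrow> ('k mat \<Rightarrow> 'k) \<Rightarrow> 'k mat set \<Rightarrow> bool" where
  "polarization N \<gg> l \<pp> \<longleftrightarrow> lie_subalgebra N \<pp> \<and> \<pp> \<subseteq> \<gg> \<and> isotropic l \<pp> \<and>
     (\<forall>W. lin_subspace N W \<and> W \<subseteq> \<gg> \<and> isotropic l W \<and> \<pp> \<subseteq> W \<longrightarrow> W = \<pp>)"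

definition nontrivial_additive_character :: "('k::field \<Rightarrow> complex) \<Rightarrow> bool" where
  "nontrivial_additive_character \<psi> \<longleftrightarrow>
     (\<forall>x. \<psi> x \<noteq> 0) \<and> (\<forall>x y. \<psi> (x + y) = \<psi> x * \<psi> y) \<and> (\<exists>x. \<psi> x \<noteq> 1)"

text \<open>The value of \<open>\<xi>\<close> at \<open>exp x\<close> is \<open>\<psi> (l x)\<close> for \<open>x \<in> \<pp>\<close>, since \<open>exp\<close> is injective on \<open>ut N\<close>.\<close>

definition xi ::
  "nat \<Rightarrow> ('k::field \<Rightarrow> complex) \<Rightarrow> ('k mat \<Rightarrow> 'k) \<Rightarrow> 'k mat set \<Rightarrow> 'k mat \<Rightarrow> complex" where
  "xi N \<psi> l \<pp> h = \<psi> (l (the_inv_into \<pp> (mat_exp N) h))"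

text \<open>The equivalence class of representations attached to the orbit \<open>\<Omega>\<close>. Up to equivalence the
  induced representation depends on neither \<open>l\<close>, nor the polarization \<open>\<pp>\<close>, nor the coset
  representatives \<open>ts\<close>, so all choices are admitted.\<close>

definition orbit_rep_class ::
  "nat \<Rightarrow> 'k::field mat set \<Rightarrow> ('k \<Rightarrow> complex) \<Rightarrow> ('k mat \<Rightarrow> 'k) set \<Rightarrow> ('k mat \<Rightarrow> complex mat) set" where
  "orbit_rep_class N \<gg> \<psi> \<Omega> = {T. representation (exp_group N \<gg>) T \<and>
     (\<exists>l\<in>\<Omega>. \<exists>\<pp> ts. polarization N \<gg> l \<pp> \<and>
        left_transversal (exp_group N \<gg>) (mat_exp N ` \<pp>) ts \<and>
        rep_equiv (exp_group N \<gg>) T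
          (induced_rep (exp_group N \<gg>) (mat_exp N ` \<pp>) (xi N \<psi> l \<pp>) ts))}"

end

theory Submission
  imports Defs "HOL-Computational_Algebra.Polynomial" "Jordan_Normal_Form.Char_Poly"
    "HOL-Computational_Algebra.Fundamental_Theorem_Algebra"
begin

text \<open>Let \<open>\<chi>\<close> be the character of \<open>T\<^sup>\<Omega>\<close>. Kirillov's formula
  \<open>\<chi> (exp x) = (\<Sum>l\<in>\<Omega>. \<psi> (l x)) / sqrt |\<Omega>|\<close> turns the multiplicity, which is the scalar product of
  characters by Schur orthogonality, into a sum over triples \<open>(l, l1, l2)\<close> of
  \<open>\<Sum>x\<in>\<gg>. \<psi> ((l1 + l2 - l) x)\<close>, and this inner sum is \<open>|\<gg>|\<close> or 0.

  The formula itself follows from Frobenius' formula for the induced character: the indicator function of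
  \<open>\<pp>\<close> is an average of \<open>\<psi> \<circ> m\<close> over the annihilator of \<open>\<pp>\<close>, and the translate of the annihilator
  by \<open>l\<close> is an orbit of \<open>exp \<pp>\<close>. All dimension counts are replaced by evaluating a double sum of
  \<open>\<psi> (B x y)\<close> in both orders.

  That \<open>exp \<gg>\<close> is closed under products needs the Campbell-Hausdorff theorem in characteristic at least
  \<open>N\<close>. If \<open>exp Z = exp x exp (t y)\<close> with \<open>Z\<close> polynomial in \<open>t\<close>, then
  \<open>(\<Sum>k. (- ad Z)^k Z' / (k + 1)!) = y\<close>. This equation determines the coefficients of \<open>Z\<close> recursively
  by commutators; as \<open>Z\<close> has degree less than \<open>N\<close>, integration only divides by integers
  below \<open>N\<close>.\<close>

section \<open>Exponentials in a nilpotent filtered ring\<close>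

text \<open>Two obstacles shape the development. First, a logarithm or an explicit
  Campbell-Hausdorff series would have to be controlled in characteristic p. Instead, bijectivity of
  exp, membership in the Lie algebra and the shape of stabilizers are obtained by induction along
  the filtration by distance from the diagonal: each step gains one diagonal, so N steps suffice.
  The product theorem works with curves of matrices, so the same identities are needed over K and
  over K[t]; hence the abstract filtered ring. The degree bound on Z also comes from the filtration:
  y lies off the diagonal, so every factor t costs at least one diagonal. Second, T^\<Omega> is
  given through arbitrary choices, and its irreducibility has to be established. Both are settled by
  the character formula: its right side sees only the orbit, and the scalar product of T with itself
  comes out as |G|, which by complete reducibility leaves exactly one irreducible constituent. The
  square root is exact because |\<Omega>| is the square of the size of the annihilator of a
  polarization.\<close>

lemma sum_triangle:
  fixes f :: "nat \<Rightarrow> nat \<Rightarrow> 'a::comm_monoid_add"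
  assumes "\<And>a k. a + k \<ge> M \<Longrightarrow> f a k = 0" and "M \<le> A" "M \<le> B"
  shows "(\<Sum>j<M. \<Sum>k\<le>j. f k (j - k)) = (\<Sum>a<A. \<Sum>k<B. f a k)"
proof -
  have "(\<Sum>a<A. \<Sum>k<B. f a k) = (\<Sum>(a, k)\<in>{..<A} \<times> {..<B}. f a k)"
    by (simp add: sum.cartesian_product)
  also have "\<dots> = (\<Sum>(a, k)\<in>{(a, k). a + k < M}. f a k)"
    using assms by (intro sum.mono_neutral_right) (auto, meson not_le)
  also have "\<dots> = (\<Sum>j<M. \<Sum>k\<le>j. f k (j - k))"
    by (rule sum.triangle_reindex)
  finally show ?thesis ..
qed

lemma mult_of_nat_left_commute: "x * (of_nat n * y) = of_nat n * (x * y)"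
  for x y :: "'a::semiring_1"
  by (metis mult.assoc mult_of_nat_commute)

text \<open>The model for \<open>S d\<close> is the set of matrices supported at least d places
  above the diagonal. \<open>s k\<close> is the central element 1/k!, taken as a ring element so
  that no scalar action has to be carried along; its value is pinned down only for k < N.
  \<open>S 0\<close> need not contain 1, which is why powers are placed in the filtration from
  exponent \<open>Suc k\<close> on.\<close>

locale nilpotent_filtration =
  fixes S :: "nat \<Rightarrow> 'a::ring_1 set" and s :: "nat \<Rightarrow> 'a" and N :: nat
  assumes N_pos: "N > 0"
    and S_0: "0 \<in> S d"
    and S_diff: "x \<in> S d \<Longrightarrow> y \<in> S d \<Longrightarrow> x - y \<in> S d"
    and S_antimono: "d \<le> e \<Longrightarrow> x \<in> S e \<Longrightarrow> x \<in> S d"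
    and S_mult: "x \<in> S d \<Longrightarrow> y \<in> S e \<Longrightarrow> x * y \<in> S (d + e)"
    and S_N: "x \<in> S N \<Longrightarrow> x = 0"
    and S_s: "x \<in> S d \<Longrightarrow> s k * x \<in> S d"
    and s_commute: "s k * x = x * s k"
    and fact_s: "k < N \<Longrightarrow> of_nat (fact k) * s k = 1"
begin

definition E :: "'a \<Rightarrow> 'a" where "E x = (\<Sum>k<N. s k * x ^ k)"

text \<open>\<open>nad x\<close> is \<open>- ad x\<close>, the sign for which \<open>exp (- x) y exp x = (\<Sum>k. nad x ^^ k / k!) y\<close>.\<close>

definition nad :: "'a \<Rightarrow> 'a \<Rightarrow> 'a" where "nad x y = y * x - x * y"

text \<open>Closure under the elements \<open>s k\<close> takes the place of closure under scalars:
  it is what the coefficients of the truncated series demand.\<close>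

definition lie_set :: "'a set \<Rightarrow> bool" where
  "lie_set L \<longleftrightarrow> L \<subseteq> S 1 \<and> 0 \<in> L \<and> (\<forall>x\<in>L. \<forall>y\<in>L. x - y \<in> L \<and> nad x y \<in> L) \<and>
     (\<forall>x\<in>L. \<forall>k. s k * x \<in> L)"

lemma S_uminus: "x \<in> S d \<Longrightarrow> - x \<in> S d"
  using S_diff[OF S_0] by force

lemma S_add: "x \<in> S d \<Longrightarrow> y \<in> S d \<Longrightarrow> x + y \<in> S d"
  using S_diff[OF _ S_uminus] by force

lemma S_sum: "(\<And>i. i \<in> I \<Longrightarrow> f i \<in> S d) \<Longrightarrow> sum f I \<in> S d"
  by (induction I rule: infinite_finite_induct) (auto simp: S_0 S_add)

lemma S_eq_0: "x \<in> S d \<Longrightarrow> d \<ge> N \<Longrightarrow> x = 0"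
  using S_N S_antimono by blast

lemma S_power: "x \<in> S 1 \<Longrightarrow> x ^ Suc k \<in> S (Suc k)"
proof (induction k)
  case (Suc k)
  then show ?case using S_mult[of x 1 "x ^ Suc k" "Suc k"] by simp
qed simp

lemma S_power_mult: "x \<in> S 1 \<Longrightarrow> y \<in> S d \<Longrightarrow> x ^ k * y \<in> S (k + d)"
  using S_power[of x "k - 1"] S_mult[of "x ^ k" k y d] by (cases k) auto

lemma nad_S: "x \<in> S 1 \<Longrightarrow> y \<in> S d \<Longrightarrow> nad x y \<in> S (Suc d)"
  unfolding nad_def using S_mult[of x 1 y d] S_mult[of y d x 1] by (auto intro: S_diff)

lemma nad_pow_S: "x \<in> S 1 \<Longrightarrow> y \<in> S d \<Longrightarrow> (nad x ^^ k) y \<in> S (k + d)"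
  by (induction k) (auto simp: nad_S)

lemma nad_diff: "nad x (y - z) = nad x y - nad x z"
  by (simp add: nad_def algebra_simps)

lemma nad_pow_diff: "(nad x ^^ k) (y - z) = (nad x ^^ k) y - (nad x ^^ k) z"
  by (induction k) (auto simp: nad_diff)

lemma s_left_commute: "x * (s k * y) = s k * (x * y)"
  by (metis mult.assoc s_commute)

lemma s_rearrange:
  assumes "s k * s m = of_nat b * s j"
  shows "s j * (of_nat b * (u * w)) = s m * u * (s k * w)"
proof -
  have "s m * u * (s k * w) = s k * s m * (u * w)"
    by (simp only: mult.assoc s_left_commute[of u] s_left_commute[of "s m"])
  also have "\<dots> = s j * (of_nat b * (u * w))"
    by (simp only: assms mult.assoc mult_of_nat_left_commute)
  finally show ?thesis ..
qed

lemma s_0: "s 0 = 1"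
  using fact_s[of 0] N_pos by simp

lemma s_1: "N > 1 \<Longrightarrow> s (Suc 0) = 1"
  using fact_s[of 1] by simp

text \<open>Multiplication by \<open>of_nat (fact j) * s j = 1\<close> replaces the division of
  factorials: j! = k! (j - k)! (j choose k), and the first two factors cancel against
  \<open>s k\<close> and \<open>s (j - k)\<close>.\<close>

lemma s_mult_s:
  assumes "j < N" "k \<le> j"
  shows "s k * s (j - k) = of_nat (j choose k) * s j"
proof -
  have "s k * s (j - k) = s k * s (j - k) * (of_nat (fact j) * s j)"
    using assms by (simp add: fact_s)
  also have "fact j = fact k * fact (j - k) * (j choose k)"
    using binomial_fact_lemma[OF assms(2)] by (simp add: mult.assoc)
  also have "s k * s (j - k) * (of_nat (fact k * fact (j - k) * (j choose k)) * s j)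
    = (of_nat (fact k) * s k) * (of_nat (fact (j - k)) * s (j - k)) * of_nat (j choose k) * s j"
    unfolding of_nat_mult
    by (simp only: mult.assoc mult_of_nat_left_commute[of "s k" "fact k"]
        mult_of_nat_left_commute[of "s (j - k)" "fact k"]
        mult_of_nat_left_commute[of "s (j - k)" "fact (j - k)"])
  also have "\<dots> = of_nat (j choose k) * s j"
    using assms by (simp add: fact_s)
  finally show ?thesis .
qed

lemma E_0: "E 0 = 1"
proof -
  have "E 0 = (\<Sum>k<N. if k = 0 then 1 else 0)"
    unfolding E_def by (intro sum.cong) (auto simp: s_0 power_0_left)
  then show ?thesis using N_pos by simp
qed

lemma E_split: "E x = 1 + (\<Sum>k<N-1. s (Suc k) * x ^ Suc k)"
proof -
  have "E x = (\<Sum>k<Suc (N-1). s k * x ^ k)"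
    using N_pos by (simp add: E_def)
  then show ?thesis by (simp only: sum.lessThan_Suc_shift) (simp add: s_0)
qed

text \<open>Grouped by total degree j, the product has the coefficient (1 - 1)^j / j!, in the form
  of an alternating binomial sum.\<close>

lemma E_minus_mult:
  assumes x: "x \<in> S 1"
  shows "E (- x) * E x = 1"
proof -
  let ?f = "\<lambda>a b. s a * (-x) ^ a * (s b * x ^ b)"
  have pow: "(-x) ^ a * x ^ b = (-1) ^ a * x ^ (a + b)" for a b
    by (subst power_minus) (simp add: mult.assoc power_add)
  have f: "?f a b = s a * s b * ((-1) ^ a * x ^ (a + b))" for a b
    using s_commute by (metis mult.assoc pow)
  have zero: "?f a b = 0" if "a + b \<ge> N" for a b
  proof -
    from that N_pos obtain c where c: "a + b = Suc c" by (cases "a + b") auto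
    have "x ^ (a + b) \<in> S (a + b)" using S_power[OF x, of c] c by simp
    then have "x ^ (a + b) = 0" using S_eq_0 that by blast
    then show ?thesis by (simp add: f)
  qed
  have "E (- x) * E x = (\<Sum>a<N. \<Sum>b<N. ?f a b)"
    by (simp add: E_def sum_product)
  also have "\<dots> = (\<Sum>j<N. \<Sum>k\<le>j. ?f k (j - k))"
    by (rule sum_triangle[symmetric]) (use zero in auto)
  also have "\<dots> = (\<Sum>j<N. \<Sum>k\<le>j. s j * x ^ j * ((-1) ^ k * of_nat (j choose k)))"
  proof (intro sum.cong refl)
    fix j k assume "j \<in> {..<N}" "k \<in> {..j}"
    then have "?f k (j - k) = of_nat (j choose k) * s j * ((-1) ^ k * x ^ j)"
      using s_mult_s[of j k] by (simp add: f)
    also have "\<dots> = s j * x ^ j * ((-1) ^ k * of_nat (j choose k))"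
      by (cases "even k") (auto simp: mult.assoc mult_of_nat_commute)
    finally show "?f k (j - k) = \<dots>" .
  qed
  also have "\<dots> = (\<Sum>j<N. s j * x ^ j * (\<Sum>k\<le>j. (-1) ^ k * of_nat (j choose k)))"
    by (simp add: sum_distrib_left)
  also have "\<dots> = (\<Sum>j<N. if j = 0 then 1 else 0)"
  proof (intro sum.cong refl)
    fix j
    have "(\<Sum>k\<le>j. (-1) ^ k * of_nat (j choose k)) = (if j = 0 then 1 else 0 :: 'a)"
    proof (cases "j = 0")
      case False
      \<comment> \<open>The alternating sum is evaluated over the integers and mapped into the ring,
        which need not be commutative.\<close>
      have "(\<Sum>k\<le>j. (-1) ^ k * int (j choose k)) = 0"
        using choose_alternating_sum[of j, where 'a = int] False by simp
      then have "of_int (\<Sum>k\<le>j. (-1) ^ k * int (j choose k)) = (0 :: 'a)" by simp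
      then show ?thesis using False by simp
    qed simp
    then show "s j * x ^ j * (\<Sum>k\<le>j. (-1) ^ k * of_nat (j choose k)) = (if j = 0 then 1 else 0)"
      by (simp add: s_0)
  qed
  also have "\<dots> = 1" using N_pos by simp
  finally show ?thesis .
qed

lemma E_mult_minus: "x \<in> S 1 \<Longrightarrow> E x * E (- x) = 1"
  using E_minus_mult[of "- x"] S_uminus by simp

section \<open>Conjugation by an exponential as a series in \<open>nad\<close>\<close>

lemma mult_power_nad:
  "y * x ^ j = (\<Sum>k\<le>j. of_nat (j choose k) * (x ^ (j - k) * (nad x ^^ k) y))"
proof (induction j)
  case (Suc j)
  let ?w = "\<lambda>k. (nad x ^^ k) y"
  \<comment> \<open>Right multiplication by x is left multiplication by x plus \<open>nad x\<close>,
    and these two operators commute: the lemma is their binomial theorem, and \<open>mult_E\<close>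
    is its exponentiated form.\<close>
  have step: "?w k * x = x * ?w k + ?w (Suc k)" for k
    by (simp add: nad_def)
  have "y * x ^ Suc j = (\<Sum>k\<le>j. of_nat (j choose k) * (x ^ (j - k) * (?w k * x)))"
    using arg_cong[OF Suc, of "\<lambda>z. z * x"]
    by (simp add: mult.assoc sum_distrib_right power_commutes)
  also have "\<dots> = (\<Sum>k\<le>j. of_nat (j choose k) * (x ^ (Suc j - k) * ?w k))
      + (\<Sum>k\<le>j. of_nat (j choose k) * (x ^ (j - k) * ?w (Suc k)))"
    unfolding sum.distrib[symmetric]
    by (intro sum.cong refl)
      (simp add: step distrib_left Suc_diff_le power_Suc2 mult.assoc del: power_Suc)
  also have "(\<Sum>k\<le>j. of_nat (j choose k) * (x ^ (Suc j - k) * ?w k))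
      = (\<Sum>k\<le>Suc j. of_nat (j choose k) * (x ^ (Suc j - k) * ?w k))"
    by (simp add: binomial_eq_0)
  also have "\<dots> = x ^ Suc j * y + (\<Sum>k\<le>j. of_nat (j choose Suc k) * (x ^ (j - k) * ?w (Suc k)))"
    by (simp only: sum.atMost_Suc_shift) simp
  also have "\<dots> + (\<Sum>k\<le>j. of_nat (j choose k) * (x ^ (j - k) * ?w (Suc k)))
     = x ^ Suc j * y + (\<Sum>k\<le>j. of_nat (Suc j choose Suc k) * (x ^ (j - k) * ?w (Suc k)))"
    unfolding add.assoc sum.distrib[symmetric] by (simp add: distrib_right add.commute)
  also have "\<dots> = (\<Sum>k\<le>Suc j. of_nat (Suc j choose k) * (x ^ (Suc j - k) * ?w k))"
    by (simp only: sum.atMost_Suc_shift) simp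
  finally show ?case .
qed simp

lemma mult_E:
  assumes x: "x \<in> S 1" and y: "y \<in> S 1"
  shows "y * E x = E x * (\<Sum>k<N. s k * (nad x ^^ k) y)"
proof -
  let ?f = "\<lambda>k a. s a * x ^ a * (s k * (nad x ^^ k) y)"
  have zero: "?f k a = 0" if "k + a \<ge> N" for a k
  proof -
    have "x ^ a * (s k * (nad x ^^ k) y) \<in> S (a + (k + 1))"
      using nad_pow_S[OF x y] by (intro S_power_mult x S_s)
    then have "x ^ a * (s k * (nad x ^^ k) y) = 0" by (rule S_eq_0) (use that in simp)
    then show ?thesis by (simp add: mult.assoc)
  qed
  have "y * E x = (\<Sum>j<N. \<Sum>k\<le>j. s j * (of_nat (j choose k) * (x ^ (j - k) * (nad x ^^ k) y)))"
    unfolding E_def sum_distrib_left s_left_commute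
    by (subst mult_power_nad) (simp add: sum_distrib_left)
  also have "\<dots> = (\<Sum>j<N. \<Sum>k\<le>j. ?f k (j - k))"
  proof (intro sum.cong refl)
    fix j k assume "j \<in> {..<N}" "k \<in> {..j}"
    then have "s k * s (j - k) = of_nat (j choose k) * s j"
      using s_mult_s by auto
    then show "s j * (of_nat (j choose k) * (x ^ (j - k) * (nad x ^^ k) y)) = ?f k (j - k)"
      by (rule s_rearrange)
  qed
  also have "\<dots> = (\<Sum>k<N. \<Sum>a<N. ?f k a)"
    by (rule sum_triangle) (use zero in auto)
  also have "\<dots> = E x * (\<Sum>k<N. s k * (nad x ^^ k) y)"
    unfolding E_def sum_product by (subst sum.swap) simp
  finally show ?thesis .
qed

lemma conj_E:
  assumes "x \<in> S 1" "y \<in> S 1"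
  shows "E (- x) * y * E x = (\<Sum>k<N. s k * (nad x ^^ k) y)"
  unfolding mult.assoc mult_E[OF assms] unfolding mult.assoc[symmetric] E_minus_mult[OF assms(1)]
  by simp

section \<open>Bijectivity of the exponential\<close>

lemma power_diff_S:
  assumes "x \<in> S 1" "y \<in> S 1" "x - y \<in> S d"
  shows "x ^ Suc k - y ^ Suc k \<in> S (d + k)"
proof (induction k)
  case (Suc k)
  have "x ^ Suc (Suc k) - y ^ Suc (Suc k) = x * (x ^ Suc k - y ^ Suc k) + (x - y) * y ^ Suc k"
    by (simp add: algebra_simps)
  then show ?case
    using S_mult[OF assms(1) Suc] S_mult[OF assms(3) S_power[OF assms(2)], of k] S_add by simp
qed (use assms in simp)

text \<open>Up to the constant 1, \<open>E\<close> is the identity plus terms of order at least 2,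
  and a difference of depth d gains a level when multiplied by an element of \<open>S 1\<close>.
  This one estimate gives injectivity as well as surjectivity by successive approximation.\<close>

lemma E_diff_S:
  assumes x: "x \<in> S 1" and y: "y \<in> S 1" and xy: "x - y \<in> S d"
  shows "E x - E y - (x - y) \<in> S (Suc d)"
\<comment> \<open>\<open>s 1 = 1\<close> is only known for N > 1; for N = 1 the level
  \<open>S 1\<close> is zero.\<close>
proof (cases "N = 1")
  case True
  then have "x = 0" "y = 0" using x y S_N by auto
  then show ?thesis by (simp add: S_0)
next
  case False
  then have N: "N > 1" using N_pos by simp
  have E: "E z = 1 + z + (\<Sum>k<N-2. s (Suc (Suc k)) * z ^ Suc (Suc k))" for z
  proof -
    have "(\<Sum>k<N-1. s (Suc k) * z ^ Suc k) = (\<Sum>k<Suc (N-2). s (Suc k) * z ^ Suc k)"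
      using N by (simp add: numeral_2_eq_2 Suc_diff_Suc)
    then show ?thesis unfolding E_split by (simp only: sum.lessThan_Suc_shift) (use N in \<open>simp add: s_1\<close>)
  qed
  have "E x - E y - (x - y)
    = (\<Sum>k<N-2. s (Suc (Suc k)) * (x ^ Suc (Suc k) - y ^ Suc (Suc k)))"
    by (simp add: E right_diff_distrib sum_subtractf del: power_Suc)
  also have "\<dots> \<in> S (Suc d)"
    by (intro S_sum S_s S_antimono[OF _ power_diff_S[OF assms]]) simp
  finally show ?thesis .
qed

lemma E_inj:
  assumes x: "x \<in> S 1" and y: "y \<in> S 1" and eq: "E x = E y"
  shows "x = y"
proof -
  have "x - y \<in> S (Suc d)" for d
  proof (induction d)
    case 0
    show ?case using S_diff[OF x y] by simp
  next
    case (Suc d)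
    show ?case using S_uminus[OF E_diff_S[OF x y Suc]] eq by simp
  qed
  from this[of N] have "x - y = 0" using S_eq_0 by (meson le_SucI order_refl)
  then show ?thesis by simp
qed

lemma E_minus_1_S: "x \<in> S 1 \<Longrightarrow> E x - 1 \<in> S 1"
  unfolding E_split add_diff_cancel_left'
  by (intro S_sum S_s S_antimono[OF _ S_power]) auto

lemma E_surj:
  assumes u: "u - 1 \<in> S 1"
  obtains z where "z \<in> S 1" "E z = u"
proof -
  have "\<exists>z\<in>S 1. u - E z \<in> S (Suc d)" for d
  proof (induction d)
    case 0
    show ?case using u S_0 by (intro bexI[of _ 0]) (auto simp: E_0)
  next
    case (Suc d)
    then obtain z where z: "z \<in> S 1" "u - E z \<in> S (Suc d)" by blast
    \<comment> \<open>Adding the error to z cancels it up to the next level, because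
      \<open>E\<close> changes by the same amount as its argument to first order.\<close>
    let ?z = "z + (u - E z)"
    have "?z \<in> S 1" using z S_antimono[of 1 "Suc d"] by (auto intro: S_add)
    moreover from this have "E ?z - E z - (?z - z) \<in> S (Suc (Suc d))"
      using z by (intro E_diff_S) auto
    then have "u - E ?z \<in> S (Suc (Suc d))"
      using S_uminus by force
    ultimately show ?case by blast
  qed
  from this[of N] obtain z where "z \<in> S 1" "u - E z \<in> S (Suc N)" by blast
  moreover from this have "u - E z = 0" using S_eq_0 by (meson le_SucI order_refl)
  ultimately show ?thesis using that by simp
qed

lemma lie_set_S: "lie_set L \<Longrightarrow> x \<in> L \<Longrightarrow> x \<in> S 1"
  and lie_set_0: "lie_set L \<Longrightarrow> 0 \<in> L"
  and lie_set_diff: "lie_set L \<Longrightarrow> x \<in> L \<Longrightarrow> y \<in> L \<Longrightarrow> x - y \<in> L"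
  and lie_set_nad: "lie_set L \<Longrightarrow> x \<in> L \<Longrightarrow> y \<in> L \<Longrightarrow> nad x y \<in> L"
  and lie_set_s: "lie_set L \<Longrightarrow> x \<in> L \<Longrightarrow> s k * x \<in> L"
  unfolding lie_set_def by auto

lemma lie_set_add:
  assumes "lie_set L" "x \<in> L" "y \<in> L"
  shows "x + y \<in> L"
proof -
  have "x - (0 - y) \<in> L" using assms lie_set_0 lie_set_diff by meson
  then show ?thesis by simp
qed

lemma lie_set_sum: "lie_set L \<Longrightarrow> (\<And>i. i \<in> I \<Longrightarrow> f i \<in> L) \<Longrightarrow> sum f I \<in> L"
  by (induction I rule: infinite_finite_induct) (auto simp: lie_set_0 lie_set_add)

lemma lie_set_nad_pow: "lie_set L \<Longrightarrow> x \<in> L \<Longrightarrow> y \<in> L \<Longrightarrow> (nad x ^^ k) y \<in> L"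
  by (induction k) (auto simp: lie_set_nad)

section \<open>The derivative of the exponential\<close>

text \<open>The series \<open>(1 - exp (- ad z)) / ad z\<close>, which occurs in the derivative of the exponential.\<close>

definition Phi :: "'a \<Rightarrow> 'a \<Rightarrow> 'a" where
  "Phi z w = (\<Sum>k<N. s (Suc k) * (nad z ^^ k) w)"

lemma deriv_power:
  assumes "\<And>x y. D (x * y) = x * D y + D x * y" "D 1 = 0"
  shows "D (z ^ n) = (\<Sum>k<n. of_nat (n choose Suc k) * (z ^ (n - Suc k) * (nad z ^^ k) (D z)))"
proof (induction n)
  case 0
  then show ?case using assms by simp
next
  case (Suc n)
  let ?w = "\<lambda>k. (nad z ^^ k) (D z)"
  have "D (z ^ Suc n) = z * D (z ^ n) + D z * z ^ n"
    using assms by simp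
  also have "z * D (z ^ n) = (\<Sum>k<n. of_nat (n choose Suc k) * (z ^ (n - k) * ?w k))"
    unfolding Suc sum_distrib_left
  proof (intro sum.cong refl)
    fix k assume "k \<in> {..<n}"
    then have "z ^ (n - k) = z * z ^ (n - Suc k)"
      by (simp add: Suc_diff_Suc flip: power_Suc)
    then show "z * (of_nat (n choose Suc k) * (z ^ (n - Suc k) * ?w k)) =
        of_nat (n choose Suc k) * (z ^ (n - k) * ?w k)"
      by (simp add: mult_of_nat_left_commute mult.assoc)
  qed
  also have "\<dots> = (\<Sum>k\<le>n. of_nat (n choose Suc k) * (z ^ (n - k) * ?w k))"
    unfolding lessThan_Suc_atMost[symmetric] by (simp add: binomial_eq_0)
  \<comment> \<open>\<open>mult_power_nad\<close> moves D z, which need not commute with z, to the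
    right of the powers of z; Pascal's rule then merges the two sums.\<close>
  also have "D z * z ^ n = (\<Sum>k\<le>n. of_nat (n choose k) * (z ^ (n - k) * ?w k))"
    by (rule mult_power_nad)
  also have "(\<Sum>k\<le>n. of_nat (n choose Suc k) * (z ^ (n - k) * ?w k)) + \<dots> =
     (\<Sum>k<Suc n. of_nat (Suc n choose Suc k) * (z ^ (Suc n - Suc k) * ?w k))"
    unfolding lessThan_Suc_atMost sum.distrib[symmetric] by (simp add: distrib_right add.commute)
  finally show ?case .
qed

lemma deriv_E:
  assumes D: "\<And>x y. D (x * y) = x * D y + D x * y" "\<And>x y. D (x + y) = D x + D y"
    "\<And>k. D (s k) = 0" and z: "z \<in> S 1" "D z \<in> S 1"
  shows "D (E z) = E z * Phi z (D z)"
proof -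
  let ?w = "\<lambda>k. (nad z ^^ k) (D z)"
  let ?f = "\<lambda>k a. s a * z ^ a * (s (Suc k) * ?w k)"
  have D1: "D 1 = 0" by (metis D(1) add_cancel_right_right mult_1 mult_1_right)
  have D0: "D 0 = 0" by (metis D(2) add_cancel_right_right)
  have Dsum: "D (sum f I) = (\<Sum>i\<in>I. D (f i))" for f :: "nat \<Rightarrow> 'a" and I
    by (induction I rule: infinite_finite_induct) (auto simp: D0 D(2))
  have zero: "?f k a = 0" if "k + a \<ge> N - 1" for a k
  proof -
    have "z ^ a * (s (Suc k) * ?w k) \<in> S (a + (k + 1))"
      using nad_pow_S[OF z] by (intro S_power_mult z S_s)
    then have "z ^ a * (s (Suc k) * ?w k) = 0" by (rule S_eq_0) (use that in simp)
    then show ?thesis by (simp add: mult.assoc)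
  qed
  have "D (E z) = (\<Sum>n<N. s n * D (z ^ n))"
    by (simp add: E_def Dsum D)
  also have "\<dots> = (\<Sum>n<Suc (N-1). s n * D (z ^ n))"
    using N_pos by simp
  also have "\<dots> = (\<Sum>n<N-1. s (Suc n) * D (z ^ Suc n))"
    by (subst sum.lessThan_Suc_shift) (simp add: D1)
  also have "\<dots> = (\<Sum>n<N-1. \<Sum>k\<le>n. ?f k (n - k))"
  proof (intro sum.cong refl)
    fix n assume "n \<in> {..<N-1}"
    then have n: "Suc n < N" by auto
    have "s (Suc n) * D (z ^ Suc n) =
      (\<Sum>k\<le>n. s (Suc n) * (of_nat (Suc n choose Suc k) * (z ^ (n - k) * ?w k)))"
      by (subst deriv_power[of D, OF D(1) D1])
         (simp add: sum_distrib_left lessThan_Suc_atMost del: binomial_Suc_Suc)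
    also have "\<dots> = (\<Sum>k\<le>n. ?f k (n - k))"
    proof (intro sum.cong refl)
      fix k assume "k \<in> {..n}"
      then have "s (Suc k) * s (n - k) = of_nat (Suc n choose Suc k) * s (Suc n)"
        using s_mult_s[of "Suc n" "Suc k"] n by simp
      then show "s (Suc n) * (of_nat (Suc n choose Suc k) * (z ^ (n - k) * ?w k)) = ?f k (n - k)"
        by (rule s_rearrange)
    qed
    finally show "s (Suc n) * D (z ^ Suc n) = (\<Sum>k\<le>n. ?f k (n - k))" .
  qed
  \<comment> \<open>As D z has depth 1 already, the terms vanish from total degree N - 1 on, so the
    triangle of side N - 1 may be extended to the square of side N. The added terms contain
    \<open>s N\<close>, which need not be an inverse factorial, but they are zero.\<close>
  also have "\<dots> = (\<Sum>k<N. \<Sum>a<N. ?f k a)"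
    by (rule sum_triangle) (use zero in auto)
  also have "\<dots> = E z * Phi z (D z)"
    unfolding E_def Phi_def sum_product by (subst sum.swap) simp
  finally show ?thesis .
qed

text \<open>The equation reads w = Phi z w - R w, where every term of R contains at least one
  \<open>nad z\<close>. Putting an approximation v from L in place of w on the right stays in L and
  deepens the error by one level, so after N rounds w itself is reached. As w is only assumed to lie
  in \<open>S 1\<close>, this turns an equation between commutators into membership in L.\<close>

lemma Phi_solution_in_lie_set:
  assumes L: "lie_set L" and z: "z \<in> L" and w: "w \<in> S 1" and Phi: "Phi z w \<in> L"
  shows "w \<in> L"
proof -
  have z1: "z \<in> S 1" using L z lie_set_S by blast
  define R where "R v = (\<Sum>k<N-1. s (Suc (Suc k)) * (nad z ^^ Suc k) v)" for v
  have Phi_eq: "Phi z v = v + R v" if v: "v \<in> S 1" for v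
  proof (cases "N = 1")
    case True
    then have "v = 0" using v S_N by simp
    moreover have "(nad z ^^ k) 0 = 0" for k
      by (induction k) (auto simp: nad_def)
    ultimately show ?thesis by (simp add: Phi_def R_def del: funpow.simps)
  next
    case False
    then have N: "N > 1" using N_pos by simp
    have "Phi z v = (\<Sum>k<Suc (N-1). s (Suc k) * (nad z ^^ k) v)"
      using N_pos by (simp add: Phi_def)
    then show ?thesis
      by (simp only: sum.lessThan_Suc_shift) (use N in \<open>simp add: s_1 R_def\<close>)
  qed
  have "\<exists>v\<in>L. w - v \<in> S (Suc d)" for d
  proof (induction d)
    case 0
    show ?case using w lie_set_0[OF L] by (intro bexI[of _ 0]) auto
  next
    case (Suc d)
    then obtain v where v: "v \<in> L" "w - v \<in> S (Suc d)" by blast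
    have "Phi z w - R v \<in> L"
      unfolding R_def using v z Phi lie_set_nad_pow[OF L]
      by (intro lie_set_diff[OF L] lie_set_sum[OF L] lie_set_s[OF L]) blast+
    moreover have "R w - R v = (\<Sum>k<N-1. s (Suc (Suc k)) * (nad z ^^ Suc k) (w - v))"
      unfolding R_def nad_pow_diff right_diff_distrib sum_subtractf by (rule refl)
    then have "R w - R v \<in> S (Suc (Suc d))"
      by (simp only:) (intro S_sum S_s S_antimono[OF _ nad_pow_S[OF z1 v(2)]], simp)
    then have "w - (Phi z w - R v) \<in> S (Suc (Suc d))"
      using Phi_eq[OF w] S_uminus by force
    ultimately show ?case by blast
  qed
  from this[of N] obtain v where v: "v \<in> L" "w - v \<in> S (Suc N)" by blast
  then have "w - v = 0" using S_eq_0 by (meson le_SucI order_refl)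
  then show ?thesis using v by simp
qed

text \<open>All brackets in the series vanish. This is for the two factors exp x and exp (t y),
  whose exponents have the derivatives 0 and y; the latter commutes with t y.\<close>

lemma Phi_commuting:
  assumes w: "w \<in> S 1" and comm: "nad z w = 0"
  shows "Phi z w = w"
proof (cases "N = 1")
  case True
  then have "w = 0" using w S_N by simp
  moreover have "(nad z ^^ k) 0 = 0" for k
    by (induction k) (auto simp: nad_def)
  ultimately show ?thesis by (simp add: Phi_def)
next
  case False
  then have N: "N > 1" using N_pos by simp
  have zero: "(nad z ^^ Suc k) w = 0" for k
    by (induction k) (use comm in \<open>auto simp: nad_def\<close>)
  have "Phi z w = (\<Sum>k<Suc (N-1). s (Suc k) * (nad z ^^ k) w)"
    using N_pos by (simp add: Phi_def)
  then show ?thesis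
    unfolding sum.lessThan_Suc_shift zero using s_1[OF N] by simp
qed

section \<open>Conjugation modulo a subspace\<close>

definition add_set :: "'a set \<Rightarrow> bool" where
  "add_set V \<longleftrightarrow> 0 \<in> V \<and> (\<forall>x\<in>V. \<forall>y\<in>V. x - y \<in> V) \<and> (\<forall>x\<in>V. \<forall>k. s k * x \<in> V)"

lemma add_set_sum:
  assumes V: "add_set V" and f: "\<And>i. i \<in> I \<Longrightarrow> f i \<in> V"
  shows "sum f I \<in> V"
  using f
proof (induction I rule: infinite_finite_induct)
  case (insert i I)
  then have "f i - (0 - sum f I) \<in> V" using V by (auto simp: add_set_def simp del: diff_0)
  then show ?case using insert by simp
qed (use V in \<open>auto simp: add_set_def\<close>)

lemma E_conj_eq:
  assumes "x \<in> S 1" "y \<in> S 1"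
  shows "E (- x) * y * E x - y = (\<Sum>k<N-1. s (Suc k) * (nad x ^^ Suc k) y)"
proof -
  have "E (- x) * y * E x = (\<Sum>k<Suc (N-1). s k * (nad x ^^ k) y)"
    using conj_E[OF assms] N_pos by simp
  then show ?thesis by (simp only: sum.lessThan_Suc_shift) (simp add: s_0)
qed

text \<open>Every term of the conjugation series beyond y is an iterated bracket and lies in V. The
  typical V is the kernel of a linear form, possibly inside a polarization, or a subspace stable
  under brackets with x.\<close>

lemma E_conj_diff:
  assumes V: "add_set V" and x: "x \<in> S 1" "y \<in> S 1"
    and "nad x y \<in> V" "\<And>v. v \<in> V \<Longrightarrow> nad x v \<in> V"
  shows "E (- x) * y * E x - y \<in> V"
proof -
  have "(nad x ^^ Suc k) y \<in> V" for k
    by (induction k) (use assms in auto)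
  then show ?thesis
    unfolding E_conj_eq[OF x] using V
    by (intro add_set_sum[OF V]) (auto simp: add_set_def simp del: funpow.simps)
qed

text \<open>The first-order term of the conjugation has to be separated from the higher ones,
  although V is not assumed stable under \<open>nad x\<close>. The induction descends from depth N,
  where y = 0: the iterated brackets of y with x lie deeper than y, so \<open>nad x\<close> of them
  is already in V, and removing them from the whole difference leaves
  \<open>nad x y\<close>.\<close>

lemma E_conj_stabilizer:
  assumes L: "lie_set L" and V: "add_set V" and x: "x \<in> L"
    and stab: "\<And>y. y \<in> L \<Longrightarrow> E (- x) * y * E x - y \<in> V" and y: "y \<in> L"
  shows "nad x y \<in> V"
proof -
  have x1: "x \<in> S 1" using L x lie_set_S by blast
  have V0: "0 \<in> V" and Vdiff: "\<And>v w. v \<in> V \<Longrightarrow> w \<in> V \<Longrightarrow> v - w \<in> V"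
    and Vs: "\<And>v k. v \<in> V \<Longrightarrow> s k * v \<in> V" using V by (auto simp: add_set_def)
  have "\<forall>y\<in>L. y \<in> S (N - m) \<longrightarrow> nad x y \<in> V" if "m \<le> N" for m
    using that
  proof (induction m)
    case 0
    have "nad x 0 = 0" by (simp add: nad_def)
    then show ?case using S_N V0 by force
  next
    case (Suc m)
    then have IH: "nad x y \<in> V" if "y \<in> L" "y \<in> S (N - m)" for y using that by simp
    show ?case
    proof (intro ballI impI)
      fix y assume y: "y \<in> L" "y \<in> S (N - Suc m)"
      have y1: "y \<in> S 1" using L y lie_set_S by blast
      show "nad x y \<in> V"
      proof (cases "N = 1")
        case True
        then have "y = 0" using S_N y1 by simp
        then show ?thesis using V0 by (simp add: nad_def)
      next
        case False
        then have N: "N > 1" using N_pos by simp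
        have high: "nad x ((nad x ^^ Suc k) y) \<in> V" for k
        proof (rule IH)
          show "(nad x ^^ Suc k) y \<in> L" using lie_set_nad_pow[OF L x y(1)] .
          have "(nad x ^^ Suc k) y \<in> S (Suc k + (N - Suc m))"
            by (rule nad_pow_S[OF x1 y(2)])
          then show "(nad x ^^ Suc k) y \<in> S (N - m)"
            by (rule S_antimono[rotated]) (use Suc in simp)
        qed
        have "(\<Sum>k<N-1. s (Suc k) * (nad x ^^ Suc k) y) =
            (\<Sum>k<Suc (N-2). s (Suc k) * (nad x ^^ Suc k) y)"
          using N by (simp add: numeral_2_eq_2 Suc_diff_Suc)
        also have "\<dots> = nad x y + (\<Sum>k<N-2. s (Suc (Suc k)) * nad x ((nad x ^^ Suc k) y))"
          by (simp only: sum.lessThan_Suc_shift) (use N in \<open>simp add: s_1\<close>)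
        finally have "nad x y = (E (- x) * y * E x - y) -
            (\<Sum>k<N-2. s (Suc (Suc k)) * nad x ((nad x ^^ Suc k) y))"
          using E_conj_eq[OF x1 y1] by (simp del: funpow.simps)
        also have "\<dots> \<in> V"
          by (intro Vdiff[OF stab[OF y(1)]] add_set_sum[OF V] Vs high)
        finally show ?thesis .
      qed
    qed
  qed
  from this[of N] show ?thesis
    using y S_antimono[of 0 1] lie_set_S[OF L] by simp
qed

lemma E_conj_E:
  assumes x: "x \<in> S 1"
  shows "E (- x) * E y * E x = E (E (- x) * y * E x)"
proof -
  let ?c = "\<lambda>z. E (- x) * z * E x"
  have mult: "?c z * ?c w = ?c (z * w)" for z w
  proof -
    have "?c z * ?c w = E (- x) * z * (E x * E (- x)) * w * E x" by (simp add: mult.assoc)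
    then show ?thesis by (simp add: E_mult_minus[OF x] mult.assoc)
  qed
  have pow: "?c (y ^ k) = ?c y ^ k" for k
  proof (induction k)
    case (Suc k)
    then show ?case using mult[of y "y ^ k"] by simp
  qed (simp add: E_minus_mult[OF x])
  have "?c (E y) = (\<Sum>k<N. ?c (s k * y ^ k))"
    unfolding E_def[of y] by (simp add: sum_distrib_left sum_distrib_right)
  also have "\<dots> = (\<Sum>k<N. s k * ?c (y ^ k))"
    by (simp only: s_left_commute mult.assoc)
  finally show ?thesis by (simp add: pow E_def[of "?c y"])
qed

end

section \<open>Infinite upper triangular matrices and the product of exponentials\<close>

text \<open>Infinite upper triangular matrices form a ring type for all \<open>N\<close> at once; cutting out the upper left
  \<open>N\<close> by \<open>N\<close> corner is a ring homomorphism.\<close>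

typedef (overloaded) 'a utm = "{f :: nat \<Rightarrow> nat \<Rightarrow> 'a::zero. \<forall>i j. j < i \<longrightarrow> f i j = 0}"
  morphisms entry Utm
  by (rule exI[of _ "\<lambda>_ _. 0"]) simp

setup_lifting type_definition_utm

lemma utm_eqI: "(\<And>i j. entry x i j = entry y i j) \<Longrightarrow> x = y"
  by transfer auto

lemma entry_lower: "j < i \<Longrightarrow> entry x i j = 0"
  by transfer auto

instantiation utm :: (comm_ring_1) ring_1
begin

lift_definition zero_utm :: "'a utm" is "\<lambda>_ _. 0" by simp
lift_definition one_utm :: "'a utm" is "\<lambda>i j. if i = j then 1 else 0" by simp
lift_definition plus_utm :: "'a utm \<Rightarrow> 'a utm \<Rightarrow> 'a utm" is "\<lambda>f g i j. f i j + g i j" by simp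
lift_definition minus_utm :: "'a utm \<Rightarrow> 'a utm \<Rightarrow> 'a utm" is "\<lambda>f g i j. f i j - g i j" by simp
lift_definition uminus_utm :: "'a utm \<Rightarrow> 'a utm" is "\<lambda>f i j. - f i j" by simp
text \<open>Triangularity makes the product of infinite matrices a finite sum, since
  \<open>g l j\<close> vanishes for l > j.\<close>

lift_definition times_utm :: "'a utm \<Rightarrow> 'a utm \<Rightarrow> 'a utm"
  is "\<lambda>f g i j. \<Sum>l\<le>j. f i l * g l j"
  by (auto intro!: sum.neutral)

instance
proof
  fix a b c :: "'a utm"
  show "a * b * c = a * (b * c)"
  proof (transfer, intro ext)
    fix f g h :: "nat \<Rightarrow> nat \<Rightarrow> 'a" and i j :: nat
    assume g: "\<forall>i j. j < i \<longrightarrow> g i j = 0"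
    have "(\<Sum>l\<le>j. (\<Sum>m\<le>l. f i m * g m l) * h l j) = (\<Sum>l\<le>j. (\<Sum>m\<le>j. f i m * g m l) * h l j)"
      using g by (intro sum.cong refl arg_cong2[where f = "(*)"] sum.mono_neutral_left) auto
    also have "\<dots> = (\<Sum>m\<le>j. f i m * (\<Sum>l\<le>j. g m l * h l j))"
      unfolding sum_distrib_left sum_distrib_right by (subst sum.swap) (simp add: mult.assoc)
    finally show "(\<Sum>l\<le>j. (\<Sum>m\<le>l. f i m * g m l) * h l j) = \<dots>" .
  qed
  show "1 * a = a"
  proof (transfer, intro ext)
    fix f :: "nat \<Rightarrow> nat \<Rightarrow> 'a" and i j
    assume f: "\<forall>i j. j < i \<longrightarrow> f i j = 0"
    have "(\<Sum>l\<le>j. (if i = l then 1 else 0) * f l j) = (\<Sum>l\<le>j. if i = l then f l j else 0)"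
      by (intro sum.cong) auto
    then show "(\<Sum>l\<le>j. (if i = l then 1 else 0) * f l j) = f i j"
      using f by (auto simp: not_le)
  qed
  show "a * 1 = a"
  proof (transfer, intro ext)
    fix f :: "nat \<Rightarrow> nat \<Rightarrow> 'a" and i j :: nat
    have "(\<Sum>l\<le>j. f i l * (if l = j then 1 else 0)) = (\<Sum>l\<le>j. if l = j then f i l else 0)"
      by (intro sum.cong) auto
    then show "(\<Sum>l\<le>j. f i l * (if l = j then 1 else 0)) = f i j"
      by simp
  qed
  show "(0::'a utm) \<noteq> 1"
    by transfer (auto simp: fun_eq_iff)
qed (transfer; force simp: fun_eq_iff algebra_simps sum.distrib)+

end

lemma entry_simps [simp]:
  "entry 0 i j = 0" "entry (x + y) i j = entry x i j + entry y i j"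
  "entry (x - y) i j = entry x i j - entry y i j" "entry (- x) i j = - entry x i j"
  by (transfer; simp)+

lemma entry_1: "entry 1 i j = (if i = j then 1 else 0)"
  by transfer simp

lemma entry_mult: "entry (x * y) i j = (\<Sum>l\<le>j. entry x i l * entry y l j)"
  by transfer simp

lemma entry_sum: "entry (sum f I) i j = (\<Sum>k\<in>I. entry (f k) i j)"
  by (induction I rule: infinite_finite_induct) auto

section \<open>Matrices with polynomial entries as curves\<close>

lift_definition diag_utm :: "'a::comm_ring_1 \<Rightarrow> 'a utm" is "\<lambda>c i j. if i = j then c else 0" by simp
lift_definition eval_utm :: "'a::comm_ring_1 \<Rightarrow> 'a poly utm \<Rightarrow> 'a utm" is "\<lambda>c f i j. poly (f i j) c"
  by simp
lift_definition coeff_utm :: "nat \<Rightarrow> 'a::comm_ring_1 poly utm \<Rightarrow> 'a utm" is "\<lambda>k f i j. coeff (f i j) k"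
  by simp
text \<open>\<open>const_utm x\<close> and \<open>linear_utm x\<close> are the curves t -> x and t
  -> t x; the product exp x exp (t y) is formed from their exponentials.\<close>

lift_definition const_utm :: "'a::comm_ring_1 utm \<Rightarrow> 'a poly utm" is "\<lambda>f i j. [:f i j:]" by simp
lift_definition linear_utm :: "'a::comm_ring_1 utm \<Rightarrow> 'a poly utm" is "\<lambda>f i j. [:0, f i j:]" by simp
lift_definition pderiv_utm :: "'a::field poly utm \<Rightarrow> 'a poly utm" is "\<lambda>f i j. pderiv (f i j)" by simp

lemma entry_diag_utm: "entry (diag_utm c) i j = (if i = j then c else 0)"
  and entry_eval_utm: "entry (eval_utm c z) i j = poly (entry z i j) c"
  and entry_coeff_utm: "entry (coeff_utm k z) i j = coeff (entry z i j) k"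
  and entry_const_utm: "entry (const_utm x) i j = [:entry x i j:]"
  and entry_linear_utm: "entry (linear_utm x) i j = [:0, entry x i j:]"
  by (transfer; simp)+

lemma entry_pderiv_utm: "entry (pderiv_utm z) i j = pderiv (entry z i j)"
  by transfer simp

lemma entry_diag_mult: "entry (diag_utm c * x) i j = c * entry x i j"
proof -
  have "entry (diag_utm c * x) i j = (\<Sum>l\<le>j. if i = l then c * entry x l j else 0)"
    unfolding entry_mult entry_diag_utm by (intro sum.cong) auto
  then show ?thesis using entry_lower[of j i x] by (cases "i \<le> j") auto
qed

lemma entry_mult_diag: "entry (x * diag_utm c) i j = entry x i j * c"
proof -
  have "entry (x * diag_utm c) i j = (\<Sum>l\<le>j. if l = j then entry x i l * c else 0)"
    unfolding entry_mult entry_diag_utm by (intro sum.cong) auto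
  then show ?thesis by simp
qed

lemma diag_utm_commute: "diag_utm c * x = x * diag_utm c"
  by (rule utm_eqI) (simp add: entry_diag_mult entry_mult_diag mult.commute)

lemma of_nat_utm: "of_nat n = diag_utm (of_nat n)"
proof (induction n)
  case (Suc n)
  then show ?case by (intro utm_eqI) (auto simp: entry_diag_utm entry_1)
qed (auto intro!: utm_eqI simp: entry_diag_utm)

lemma diag_utm_mult_diag: "diag_utm a * diag_utm b = diag_utm (a * b)"
  by (rule utm_eqI) (simp add: entry_diag_mult entry_diag_utm)

lemma diag_utm_1: "diag_utm 1 = 1"
  by (rule utm_eqI) (simp add: entry_diag_utm entry_1)

lemma eval_utm_simps:
  "eval_utm c (x * y) = eval_utm c x * eval_utm c y"
  "eval_utm c (x + y) = eval_utm c x + eval_utm c y"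
  "eval_utm c 0 = 0" "eval_utm c 1 = 1"
  "eval_utm c (diag_utm p) = diag_utm (poly p c)"
  "eval_utm c (const_utm z) = z"
  "eval_utm c (linear_utm z) = diag_utm c * z"
  by (rule utm_eqI; simp add: entry_eval_utm entry_diag_mult entry_const_utm entry_linear_utm;
      simp add: entry_mult poly_sum entry_1 entry_diag_utm entry_eval_utm)+

lemma eval_utm_sum: "eval_utm c (sum f I) = (\<Sum>k\<in>I. eval_utm c (f k))"
  by (induction I rule: infinite_finite_induct) (auto simp: eval_utm_simps)

lemma eval_utm_power: "eval_utm c (x ^ n) = eval_utm c x ^ n"
  by (induction n) (auto simp: eval_utm_simps)

lemma coeff_utm_diff: "coeff_utm k (x - y) = coeff_utm k x - coeff_utm k y"
  by (rule utm_eqI) (simp add: entry_coeff_utm)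

lemma coeff_utm_mult: "coeff_utm k (x * y) = (\<Sum>a\<le>k. coeff_utm a x * coeff_utm (k - a) y)"
  by (rule utm_eqI)
    (simp add: entry_coeff_utm entry_mult entry_sum coeff_sum coeff_mult, rule sum.swap)

lemma coeff_utm_diag_mult: "coeff_utm k (diag_utm [:c:] * x) = diag_utm c * coeff_utm k x"
  by (rule utm_eqI) (simp add: entry_coeff_utm entry_diag_mult)

lemma pderiv_sum: "pderiv (sum f I) = (\<Sum>k\<in>I. pderiv (f k))"
  by (induction I rule: infinite_finite_induct) (auto simp: pderiv_add)

lemma pderiv_utm_simps:
  "pderiv_utm (x * y) = x * pderiv_utm y + pderiv_utm x * y"
  "pderiv_utm (x + y) = pderiv_utm x + pderiv_utm y"
  "pderiv_utm (const_utm z) = 0"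
  "pderiv_utm (linear_utm z) = const_utm z"
  by (rule utm_eqI; simp add: entry_pderiv_utm entry_mult pderiv_sum pderiv_mult pderiv_add
      entry_const_utm entry_linear_utm pderiv_pCons sum.distrib algebra_simps)+

lemma pderiv_utm_diag: "pderiv_utm (diag_utm [:c:]) = 0"
  by (rule utm_eqI) (simp add: entry_pderiv_utm entry_diag_utm pderiv_pCons)

lemma coeff_utm_pderiv: "coeff_utm k (pderiv_utm z) = diag_utm (of_nat (Suc k)) * coeff_utm (Suc k) z"
  by (rule utm_eqI) (simp add: entry_coeff_utm entry_pderiv_utm entry_diag_mult coeff_pderiv)

section \<open>The filtration by distance from the diagonal\<close>

definition strip :: "nat \<Rightarrow> nat \<Rightarrow> 'a::comm_ring_1 utm set" where
  "strip N d = {x. \<forall>i j. entry x i j \<noteq> 0 \<longrightarrow> i + d \<le> j \<and> j < N}"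

text \<open>The degree bound makes the coefficients vanish from degree \<open>N\<close> on.\<close>

definition poly_strip :: "nat \<Rightarrow> nat \<Rightarrow> 'a::comm_ring_1 poly utm set" where
  "poly_strip N d = {x \<in> strip N d. \<forall>i j. degree (entry x i j) \<le> j - i}"

lemma strip_0: "0 \<in> strip N d" and poly_strip_0: "0 \<in> poly_strip N d"
  by (auto simp: strip_def poly_strip_def)

lemma strip_antimono: "d \<le> e \<Longrightarrow> x \<in> strip N e \<Longrightarrow> x \<in> strip N d"
  unfolding strip_def by (auto intro: order_trans[OF add_left_mono])

lemma poly_strip_antimono: "d \<le> e \<Longrightarrow> x \<in> poly_strip N e \<Longrightarrow> x \<in> poly_strip N d"
  by (auto simp: poly_strip_def strip_antimono)

lemma strip_mult: "x \<in> strip N d \<Longrightarrow> y \<in> strip N e \<Longrightarrow> x * y \<in> strip N (d + e)"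
  unfolding strip_def mem_Collect_eq entry_mult
proof (intro allI impI)
  fix i j
  assume x: "\<forall>i j. entry x i j \<noteq> 0 \<longrightarrow> i + d \<le> j \<and> j < N"
    and y: "\<forall>i j. entry y i j \<noteq> 0 \<longrightarrow> i + e \<le> j \<and> j < N"
    and "(\<Sum>l\<le>j. entry x i l * entry y l j) \<noteq> 0"
  then obtain l where "l \<le> j" "entry x i l * entry y l j \<noteq> 0"
    by (meson sum.not_neutral_contains_not_neutral atMost_iff)
  then have "entry x i l \<noteq> 0" "entry y l j \<noteq> 0" by auto
  then show "i + (d + e) \<le> j \<and> j < N" using x y by fastforce
qed

text \<open>The degree bound survives products because (l - i) + (j - l) = j - i; for l < i the
  first factor is zero by triangularity.\<close>

lemma poly_strip_mult:
  assumes "x \<in> poly_strip N d" "y \<in> poly_strip N e"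
  shows "x * y \<in> poly_strip N (d + e)"
proof -
  have "degree (entry (x * y) i j) \<le> j - i" for i j
    unfolding entry_mult
  proof (intro degree_sum_le)
    fix l assume l: "l \<in> {..j}"
    show "degree (entry x i l * entry y l j) \<le> j - i"
    proof (cases "l < i")
      case True
      then show ?thesis by (simp add: entry_lower)
    next
      case False
      have "degree (entry x i l * entry y l j) \<le> degree (entry x i l) + degree (entry y l j)"
        by (rule degree_mult_le)
      also have "\<dots> \<le> (l - i) + (j - l)"
        using assms by (intro add_mono) (auto simp: poly_strip_def)
      finally show ?thesis using False l by simp
    qed
  qed simp
  then show ?thesis using assms strip_mult by (auto simp: poly_strip_def)
qed

text \<open>The assumption on factorials is what characteristic at least N provides. Two filtered
  rings arise from it: \<open>K\<close> for matrices over the field and \<open>P\<close> for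
  polynomial curves of matrices.\<close>

locale strict_upper =
  fixes N :: nat and ty :: "'k::field itself"
  assumes N_pos: "N > 0" and fact_nonzero: "k < N \<Longrightarrow> of_nat (fact k) \<noteq> (0 :: 'k)"
begin

definition inv_fact :: "nat \<Rightarrow> 'k" where "inv_fact k = 1 / of_nat (fact k)"

sublocale K: nilpotent_filtration "strip N" "\<lambda>k. diag_utm (inv_fact k)" N
proof
  fix k assume "k < N"
  then show "of_nat (fact k) * diag_utm (inv_fact k) = 1"
    using fact_nonzero by (simp add: of_nat_utm diag_utm_mult_diag inv_fact_def diag_utm_1 del: of_nat_fact)
next
  fix x :: "'k utm" and d k
  assume "x \<in> strip N d"
  then show "diag_utm (inv_fact k) * x \<in> strip N d"
    by (auto simp: strip_def entry_diag_mult)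
next
  fix x :: "'k utm"
  assume "x \<in> strip N N"
  \<comment> \<open>Depth N pushes every nonzero entry into a column j >= N, which the definition of
    \<open>strip\<close> excludes.\<close>
  then show "x = 0" by (intro utm_eqI) (fastforce simp: strip_def)
next
  fix x y :: "'k utm" and d
  assume "x \<in> strip N d" "y \<in> strip N d"
  then show "x - y \<in> strip N d" unfolding strip_def by (auto, (metis diff_zero)+)
next
  show "diag_utm (inv_fact k) * x = x * diag_utm (inv_fact k)" for k and x :: "'k utm"
    by (rule diag_utm_commute)
qed (use N_pos in \<open>simp_all add: strip_mult strip_0 strip_antimono\<close>)

sublocale P: nilpotent_filtration "poly_strip N" "\<lambda>k. diag_utm [:inv_fact k:]" N
proof
  fix k assume "k < N"
  then show "of_nat (fact k) * diag_utm [:inv_fact k:] = 1"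
    using fact_nonzero
    by (simp add: of_nat_utm diag_utm_mult_diag inv_fact_def of_nat_poly del: of_nat_fact)
      (simp add: diag_utm_1 flip: one_pCons)
next
  fix x :: "'k poly utm" and d k
  assume "x \<in> poly_strip N d"
  then show "diag_utm [:inv_fact k:] * x \<in> poly_strip N d"
    by (auto simp: poly_strip_def strip_def entry_diag_mult intro: order_trans[OF degree_smult_le])
next
  fix x :: "'k poly utm"
  assume "x \<in> poly_strip N N"
  then show "x = 0" by (intro utm_eqI) (fastforce simp: poly_strip_def strip_def)
next
  fix x y :: "'k poly utm" and d
  assume "x \<in> poly_strip N d" "y \<in> poly_strip N d"
  then show "x - y \<in> poly_strip N d"
    unfolding poly_strip_def strip_def by (auto intro: degree_diff_le, (metis diff_zero)+)
next
  show "diag_utm [:inv_fact k:] * x = x * diag_utm [:inv_fact k:]" for k and x :: "'k poly utm"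
    by (rule diag_utm_commute)
qed (use N_pos in \<open>simp_all add: poly_strip_mult poly_strip_0 poly_strip_antimono\<close>)

lemma eval_E: "eval_utm c (P.E z) = K.E (eval_utm c z)"
  by (simp add: P.E_def K.E_def eval_utm_simps eval_utm_sum eval_utm_power)

lemma eval_poly_strip: "z \<in> poly_strip N d \<Longrightarrow> eval_utm c z \<in> strip N d"
  unfolding poly_strip_def strip_def by (auto simp: entry_eval_utm) (metis poly_0)+

lemma const_poly_strip: "x \<in> strip N d \<Longrightarrow> const_utm x \<in> poly_strip N d"
  by (auto simp: poly_strip_def strip_def entry_const_utm)

text \<open>Depth at least 1 pays for the degree of t.\<close>

lemma linear_poly_strip: "x \<in> strip N (Suc d) \<Longrightarrow> linear_utm x \<in> poly_strip N (Suc d)"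
proof -
  assume x: "x \<in> strip N (Suc d)"
  have "degree (entry (linear_utm x) i j) \<le> j - i" for i j
  proof (cases "entry x i j = 0")
    case False
    then have "i + Suc d \<le> j" using x by (auto simp: strip_def)
    then have "Suc 0 \<le> j - i" by linarith
    then show ?thesis by (simp add: entry_linear_utm)
  qed (simp add: entry_linear_utm)
  then show ?thesis using x by (auto simp: poly_strip_def strip_def entry_linear_utm)
qed

lemma pderiv_poly_strip: "z \<in> poly_strip N d \<Longrightarrow> pderiv_utm z \<in> poly_strip N d"
  for z :: "'k poly utm"
proof -
  assume z: "z \<in> poly_strip N d"
  have le: "degree (pderiv p) \<le> degree p" for p :: "'k poly"
    by (rule degree_le) (simp add: coeff_pderiv coeff_eq_0)
  have deg: "degree (entry z i j) \<le> j - i" for i j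
    using z by (simp add: poly_strip_def)
  have "degree (entry (pderiv_utm z) i j) \<le> j - i" for i j
    unfolding entry_pderiv_utm by (rule order_trans[OF le deg])
  moreover have "entry (pderiv_utm z) i j \<noteq> 0 \<Longrightarrow> entry z i j \<noteq> 0" for i j
    by (auto simp: entry_pderiv_utm)
  then have "pderiv_utm z \<in> strip N d"
    using z by (auto simp: poly_strip_def strip_def)
  ultimately show ?thesis by (simp add: poly_strip_def)
qed

lemma poly_strip_degree: "z \<in> poly_strip N d \<Longrightarrow> entry z i j \<noteq> 0 \<Longrightarrow> degree (entry z i j) < N"
proof -
  assume z: "z \<in> poly_strip N d" "entry z i j \<noteq> 0"
  then have "degree (entry z i j) \<le> j - i" "j < N" by (auto simp: poly_strip_def strip_def)
  then show ?thesis by linarith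
qed

lemma coeff_utm_eq_0: "z \<in> poly_strip N d \<Longrightarrow> k \<ge> N \<Longrightarrow> coeff_utm k z = 0"
proof (rule utm_eqI)
  fix i j
  assume z: "z \<in> poly_strip N d" and k: "k \<ge> N"
  show "entry (coeff_utm k z) i j = entry 0 i j"
  proof (cases "entry z i j = 0")
    case False
    then have "degree (entry z i j) < k"
      using z k poly_strip_degree by fastforce
    then show ?thesis by (simp add: entry_coeff_utm coeff_eq_0)
  qed (simp add: entry_coeff_utm)
qed

lemma eval_utm_1_eq_sum: "z \<in> poly_strip N d \<Longrightarrow> eval_utm 1 z = (\<Sum>k<N. coeff_utm k z)"
proof (rule utm_eqI)
  fix i j
  assume z: "z \<in> poly_strip N d"
  show "entry (eval_utm 1 z) i j = entry (\<Sum>k<N. coeff_utm k z) i j"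
  proof (cases "entry z i j = 0")
    case False
    then have "degree (entry z i j) < N"
      using z poly_strip_degree by blast
    then have "(\<Sum>k\<le>degree (entry z i j). coeff (entry z i j) k) = (\<Sum>k<N. coeff (entry z i j) k)"
      by (intro sum.mono_neutral_left) (auto intro: le_degree)
    then show ?thesis by (simp add: entry_eval_utm entry_sum entry_coeff_utm poly_altdef)
  qed (simp add: entry_eval_utm entry_sum entry_coeff_utm)
qed

text \<open>Coefficient i of a commutator involves only coefficients up to i of the factors. So
  curves that lie in L up to order m form a Lie set of their own, and
  \<open>Phi_solution_in_lie_set\<close> can be applied one order at a time.\<close>

lemma lie_set_coeffs:
  assumes L: "K.lie_set L"
  shows "P.lie_set {z \<in> poly_strip N 1. \<forall>i\<le>m. coeff_utm i z \<in> L}" (is "P.lie_set ?LP")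
  unfolding P.lie_set_def
proof (intro conjI ballI allI)
  show "?LP \<subseteq> poly_strip N 1" by auto
  have "coeff_utm i (0 :: 'k poly utm) = 0" for i by (rule utm_eqI) (simp add: entry_coeff_utm)
  then show "0 \<in> ?LP" using P.S_0 K.lie_set_0[OF L] by auto
next
  fix x y assume x: "x \<in> ?LP" and y: "y \<in> ?LP"
  show "x - y \<in> ?LP"
    using x y P.S_diff K.lie_set_diff[OF L] by (simp add: coeff_utm_diff)
  have "coeff_utm i (P.nad x y) \<in> L" if i: "i \<le> m" for i
  proof -
    \<comment> \<open>Reversing the sum gives the factors the same indices as in x y, so that the
      difference becomes a sum of brackets of coefficients.\<close>
    have "coeff_utm i (y * x) = (\<Sum>a\<le>i. coeff_utm (i - a) y * coeff_utm a x)"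
      unfolding coeff_utm_mult
      by (rule sum.reindex_bij_witness[of _ "\<lambda>a. i - a" "\<lambda>a. i - a"]) auto
    then have "coeff_utm i (P.nad x y) = (\<Sum>a\<le>i. K.nad (coeff_utm a x) (coeff_utm (i - a) y))"
      by (simp add: P.nad_def K.nad_def coeff_utm_diff coeff_utm_mult[of _ x y] sum_subtractf)
    also have "\<dots> \<in> L"
      using x y i by (intro K.lie_set_sum[OF L] K.lie_set_nad[OF L]) auto
    finally show ?thesis .
  qed
  moreover have "P.nad x y \<in> poly_strip N 1"
    using x y P.nad_S[of x y 1] P.S_antimono[of 1 "Suc 1"] by auto
  ultimately show "P.nad x y \<in> ?LP" by simp
next
  fix x k assume "x \<in> ?LP"
  then show "diag_utm [:inv_fact k:] * x \<in> ?LP"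
    using P.S_s K.lie_set_s[OF L] by (simp add: coeff_utm_diag_mult)
qed

text \<open>Surjectivity of exp over K[t] supplies Z, at first only as a strictly triangular curve.
  Its coefficients are placed in L by induction: once Z lies in L up to order m, so does its
  derivative, as the solution of the equation for \<open>P.Phi\<close>, and dividing by m + 1 gives
  order m + 1 of Z. The product is the value at t = 1.\<close>

theorem E_mult_closed:
  assumes L: "K.lie_set L" and scale: "\<And>c v. v \<in> L \<Longrightarrow> diag_utm c * v \<in> L"
    and x: "x \<in> L" and y: "y \<in> L"
  obtains z where "z \<in> L" "K.E z = K.E x * K.E y"
proof -
  let ?S = "poly_strip N 1"
  let ?X = "const_utm x" and ?Y = "linear_utm y"
  define u where "u = P.E ?X * P.E ?Y"
  have xS: "x \<in> strip N 1" and yS: "y \<in> strip N 1" using L x y K.lie_set_S by auto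
  have X: "?X \<in> ?S" and y': "const_utm y \<in> ?S" using xS yS const_poly_strip by auto
  have Y: "?Y \<in> ?S" using yS linear_poly_strip by simp
  \<comment> \<open>The differences of the two exponentials from 1 lie in the filtration, whereas 1
    does not, so u - 1 is expressed through them.\<close>
  have "u - 1 = (P.E ?X - 1) * (P.E ?Y - 1) + ((P.E ?X - 1) + (P.E ?Y - 1))"
    by (simp add: u_def algebra_simps)
  also have "\<dots> \<in> ?S"
    using P.S_mult[OF P.E_minus_1_S[OF X] P.E_minus_1_S[OF Y]] P.E_minus_1_S[OF X] P.E_minus_1_S[OF Y]
    by (auto intro!: P.S_add intro: P.S_antimono[of "Suc 0" "Suc (Suc 0)"])
  finally obtain Z where Z: "Z \<in> ?S" and EZ: "P.E Z = u" using P.E_surj by blast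
  note deriv = P.deriv_E[of pderiv_utm, OF pderiv_utm_simps(1,2) pderiv_utm_diag]
  have "pderiv_utm (P.E ?X) = 0"
    using deriv[OF X] P.S_0 P.Phi_commuting[of 0 ?X] by (simp add: pderiv_utm_simps P.nad_def)
  moreover have "P.nad ?Y (const_utm y) = 0"
    by (rule utm_eqI) (simp add: P.nad_def entry_mult entry_const_utm entry_linear_utm mult.commute)
  then have "pderiv_utm (P.E ?Y) = P.E ?Y * const_utm y"
    using deriv[OF Y] y' P.Phi_commuting by (simp add: pderiv_utm_simps)
  ultimately have Du: "pderiv_utm u = u * const_utm y"
    by (simp add: u_def pderiv_utm_simps mult.assoc)
  have DZ: "pderiv_utm Z \<in> ?S" using Z pderiv_poly_strip by blast
  have "u * const_utm y = u * P.Phi Z (pderiv_utm Z)"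
    using deriv[OF Z DZ] Du EZ by simp
  then have "P.E (- Z) * (u * const_utm y) = P.E (- Z) * (u * P.Phi Z (pderiv_utm Z))"
    by simp
  then have Phi: "P.Phi Z (pderiv_utm Z) = const_utm y"
    using P.E_minus_mult[OF Z] EZ by (simp flip: mult.assoc)
  \<comment> \<open>At t = 0 the second factor is 1, so injectivity of exp yields the initial value
    Z(0) = x of the recursion.\<close>
  have "K.E (eval_utm 0 Z) = K.E x"
  proof -
    have "diag_utm 0 * y = 0" by (rule utm_eqI) (simp add: entry_diag_mult)
    then show ?thesis
      by (simp flip: eval_E add: EZ) (simp add: u_def eval_utm_simps eval_E K.E_0)
  qed
  then have Z0: "eval_utm 0 Z = x"
    using K.E_inj[OF eval_poly_strip[OF Z] xS] by blast
  have coeff_const: "coeff_utm i (const_utm y) \<in> L" for i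
  proof -
    have "coeff_utm i (const_utm y) = (if i = 0 then y else 0)"
      by (rule utm_eqI) (auto simp: entry_coeff_utm entry_const_utm coeff_pCons split: nat.splits)
    then show ?thesis using y K.lie_set_0[OF L] by simp
  qed
  have coeffs: "\<forall>i\<le>m. coeff_utm i Z \<in> L" for m
  proof (induction m)
    case 0
    have "coeff_utm 0 Z = eval_utm 0 Z"
      by (rule utm_eqI) (simp add: entry_coeff_utm entry_eval_utm poly_0_coeff_0)
    then show ?case using Z0 x by simp
  next
    case (Suc m)
    let ?LP = "{z \<in> ?S. \<forall>i\<le>m. coeff_utm i z \<in> L}"
    have ZL: "Z \<in> ?LP" using Suc Z by simp
    have "P.Phi Z (pderiv_utm Z) \<in> ?LP" unfolding Phi using y' coeff_const by simp
    from P.Phi_solution_in_lie_set[OF lie_set_coeffs[OF L] ZL DZ this]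
    have "pderiv_utm Z \<in> ?LP" .
    then have "diag_utm (of_nat (Suc m)) * coeff_utm (Suc m) Z \<in> L"
      by (simp only: coeff_utm_pderiv mem_Collect_eq order_refl)
    then have mem: "diag_utm (1 / of_nat (Suc m)) * (diag_utm (of_nat (Suc m)) * coeff_utm (Suc m) Z) \<in> L"
      by (rule scale)
    have "coeff_utm (Suc m) Z \<in> L"
    proof (cases "Suc m < N")
      case True
      then have "of_nat (Suc m) \<noteq> (0::'k)"
        using fact_nonzero[OF True] by (metis fact_Suc mult_zero_left of_nat_id of_nat_mult)
      then have "diag_utm (1 / of_nat (Suc m)) * diag_utm (of_nat (Suc m)) = (1 :: 'k utm)"
        by (simp add: diag_utm_mult_diag diag_utm_1 del: of_nat_Suc)
      then show ?thesis using mem by (simp only: mult.assoc[symmetric] mult_1_left)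
    next
      \<comment> \<open>Here \<open>Suc m\<close> may be zero in K and cannot be divided by, but Z
        has no coefficients from degree N on.\<close>
      case False
      then show ?thesis using coeff_utm_eq_0[OF Z] K.lie_set_0[OF L] by simp
    qed
    then show ?case using Suc by (auto simp: le_Suc_eq)
  qed
  have "eval_utm 1 Z \<in> L"
    unfolding eval_utm_1_eq_sum[OF Z] using coeffs by (intro K.lie_set_sum[OF L]) blast
  moreover have "K.E (eval_utm 1 Z) = K.E x * K.E y"
    by (simp flip: eval_E add: EZ u_def eval_utm_simps) (simp add: eval_E eval_utm_simps diag_utm_1)
  ultimately show ?thesis using that by blast
qed

end

section \<open>Transfer to strictly upper triangular matrices\<close>

text \<open>Inverse to \<open>corner_mat\<close> between \<open>ut N\<close> and
  \<open>strip N 1\<close>. It respects products of strictly triangular matrices but turns the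
  identity into a truncated one; identities involving 1 are therefore carried over by
  \<open>corner_mat\<close>, which is a unital ring homomorphism.\<close>

definition lift_mat :: "nat \<Rightarrow> 'a::zero mat \<Rightarrow> 'a utm" where
  "lift_mat N A = Utm (\<lambda>i j. if i \<le> j \<and> j < N then A $$ (i, j) else 0)"

definition corner_mat :: "nat \<Rightarrow> 'a::zero utm \<Rightarrow> 'a mat" where
  "corner_mat N x = mat N N (\<lambda>(i, j). entry x i j)"

lemma entry_lift_mat: "entry (lift_mat N A) i j = (if i \<le> j \<and> j < N then A $$ (i, j) else 0)"
  unfolding lift_mat_def by (subst Utm_inverse) auto

lemma corner_mat_carrier [simp]: "corner_mat N x \<in> carrier_mat N N"
  by (simp add: corner_mat_def)

lemma corner_mat_index [simp]: "i < N \<Longrightarrow> j < N \<Longrightarrow> corner_mat N x $$ (i, j) = entry x i j"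
  by (simp add: corner_mat_def)

lemma dim_corner_mat [simp]: "dim_row (corner_mat N x) = N" "dim_col (corner_mat N x) = N"
  by (simp_all add: corner_mat_def)

lemma utD: "A \<in> ut N \<Longrightarrow> A \<in> carrier_mat N N" "A \<in> ut N \<Longrightarrow> i < N \<Longrightarrow> j \<le> i \<Longrightarrow> A $$ (i, j) = 0"
  by (auto simp: ut_def)

lemma corner_lift: "A \<in> ut N \<Longrightarrow> corner_mat N (lift_mat N A) = A"
  by (intro eq_matI) (auto simp: entry_lift_mat ut_def)

lemma lift_corner: "x \<in> strip N d \<Longrightarrow> lift_mat N (corner_mat N x) = x"
proof (rule utm_eqI)
  fix i j assume "x \<in> strip N d"
  then show "entry (lift_mat N (corner_mat N x)) i j = entry x i j"
    unfolding entry_lift_mat strip_def using entry_lower[of j i x] by (auto simp: not_le)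
qed

lemma lift_strip: "A \<in> ut N \<Longrightarrow> lift_mat N A \<in> strip N 1"
  unfolding strip_def ut_def by (auto simp: entry_lift_mat split: if_splits) (metis le_antisym not_less_eq_eq order_refl le_less_trans)

lemma corner_ut: "x \<in> strip N 1 \<Longrightarrow> corner_mat N x \<in> ut N"
  unfolding ut_def strip_def by force

lemma corner_add: "corner_mat N (x + y) = corner_mat N x + corner_mat N (y :: 'a::comm_ring_1 utm)"
  by (intro eq_matI) auto

lemma corner_mult: "corner_mat N (x * y) = corner_mat N x * corner_mat N (y :: 'a::comm_ring_1 utm)"
proof (rule eq_matI)
  fix i j assume "i < dim_row (corner_mat N x * corner_mat N y)" "j < dim_col (corner_mat N x * corner_mat N y)"
  then have ij: "i < N" "j < N" by auto
  have "(\<Sum>l\<le>j. entry x i l * entry y l j) = (\<Sum>l<N. entry x i l * entry y l j)"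
    using ij by (intro sum.mono_neutral_left) (auto simp: entry_lower not_le)
  then show "corner_mat N (x * y) $$ (i, j) = (corner_mat N x * corner_mat N y) $$ (i, j)"
    using ij by (simp add: entry_mult scalar_prod_def atLeast0LessThan)
qed auto

lemma corner_1: "corner_mat N (1 :: 'a::comm_ring_1 utm) = 1\<^sub>m N"
  by (intro eq_matI) (auto simp: entry_1)

lemma corner_power: "corner_mat N (x ^ k) = corner_mat N (x :: 'a::comm_ring_1 utm) ^\<^sub>m k"
  by (induction k) (auto simp: corner_1 corner_mult power_Suc2 simp del: power_Suc)

lemma lift_linear:
  fixes x y :: "'a::comm_ring_1 mat"
  assumes "x \<in> carrier_mat N N" "y \<in> carrier_mat N N"
  shows "lift_mat N (x + y) = lift_mat N x + lift_mat N y"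
    "lift_mat N (x - y) = lift_mat N x - lift_mat N y"
    "lift_mat N (- x) = - lift_mat N x"
    "lift_mat N (c \<cdot>\<^sub>m x) = diag_utm c * lift_mat N x"
    "lift_mat N (0\<^sub>m N N :: 'a mat) = 0"
  using assms by (auto intro!: utm_eqI simp: entry_lift_mat entry_diag_mult)

lemma lift_mult:
  fixes x y :: "'a::field mat"
  assumes "x \<in> ut N" "y \<in> ut N"
  shows "lift_mat N (x * y) = lift_mat N x * lift_mat N y"
proof -
  have "lift_mat N x * lift_mat N y \<in> strip N (1 + 1)"
    using assms by (intro strip_mult lift_strip)
  then show ?thesis
    using lift_corner corner_mult corner_lift assms by metis
qed

lemma ut_closed:
  fixes x y :: "'a::field mat"
  assumes "x \<in> ut N" "y \<in> ut N"
  shows "x + y \<in> ut N" "x - y \<in> ut N" "- x \<in> ut N" "c \<cdot>\<^sub>m x \<in> ut N" "x * y \<in> ut N"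
    "0\<^sub>m N N \<in> (ut N :: 'a mat set)"
proof -
  show "x * y \<in> ut N"
    using strip_mult[OF lift_strip lift_strip] assms strip_antimono[of 1 "1 + 1"]
    by (metis corner_lift corner_mult corner_ut le_add1)
qed (use assms in \<open>auto simp: ut_def\<close>)

lemma lift_bracket:
  fixes x y :: "'a::field mat"
  assumes "x \<in> ut N" "y \<in> ut N"
  shows "lift_mat N (bracket x y) = lift_mat N x * lift_mat N y - lift_mat N y * lift_mat N x"
  unfolding bracket_def using assms ut_closed(5)[of x N y] ut_closed(5)[of y N x]
  by (subst lift_linear(2)) (auto simp: lift_mult utD(1))

lemma lin_subspace_iff:
  fixes W :: "'a::field mat set"
  shows "lin_subspace N W \<longleftrightarrow> W \<subseteq> carrier_mat N N \<and> 0\<^sub>m N N \<in> W \<and>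
    (\<forall>x\<in>W. \<forall>y\<in>W. x + y \<in> W) \<and> (\<forall>c. \<forall>x\<in>W. c \<cdot>\<^sub>m x \<in> W)"
proof -
  interpret vectorspace "class_ring :: 'a ring" "module_mat TYPE('a) N N"
    by (rule matrix_vs)
  show ?thesis
    unfolding VectorSpace.subspace_def submodule_def
    using vectorspace_axioms module_axioms
    by (auto simp: module_mat_simps class_ring_simps)
qed

lemma lin_subspaceD:
  fixes W :: "'a::field mat set"
  assumes "lin_subspace N W"
  shows "x \<in> W \<Longrightarrow> x \<in> carrier_mat N N" "0\<^sub>m N N \<in> W" "x \<in> W \<Longrightarrow> y \<in> W \<Longrightarrow> x + y \<in> W"
    "x \<in> W \<Longrightarrow> c \<cdot>\<^sub>m x \<in> W" "x \<in> W \<Longrightarrow> - x \<in> W" "x \<in> W \<Longrightarrow> y \<in> W \<Longrightarrow> x - y \<in> W"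
proof -
  have W: "W \<subseteq> carrier_mat N N" "\<And>x y. x \<in> W \<Longrightarrow> y \<in> W \<Longrightarrow> x + y \<in> W"
    "\<And>c x. x \<in> W \<Longrightarrow> c \<cdot>\<^sub>m x \<in> W" "0\<^sub>m N N \<in> W"
    using assms by (auto simp: lin_subspace_iff)
  show minus: "- x \<in> W" if "x \<in> W" for x
  proof -
    have "- x = (-1) \<cdot>\<^sub>m x" by (intro eq_matI) auto
    then show ?thesis using W that by simp
  qed
  show "x - y \<in> W" if "x \<in> W" "y \<in> W"
  proof -
    have "x - y = x + (- y)" using that W by (intro eq_matI) auto
    then show ?thesis using W minus that by simp
  qed
qed (use assms in \<open>auto simp: lin_subspace_iff\<close>)

section \<open>The exponential of finite matrices\<close>

context strict_upper
begin

lemma corner_E: "corner_mat N (K.E x) = mat_exp N (corner_mat N x)"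
proof (rule eq_matI)
  fix i j assume "i < dim_row (mat_exp N (corner_mat N x))" "j < dim_col (mat_exp N (corner_mat N x))"
  then have ij: "i < N" "j < N" by (auto simp: mat_exp_def)
  then show "corner_mat N (K.E x) $$ (i, j) = mat_exp N (corner_mat N x) $$ (i, j)"
    by (simp add: mat_exp_def K.E_def entry_sum entry_diag_mult flip: corner_power)
      (simp add: inv_fact_def)
qed (auto simp: mat_exp_def)

lemma mat_exp_eq: "x \<in> ut N \<Longrightarrow> mat_exp N x = corner_mat N (K.E (lift_mat N x))"
  by (simp add: corner_E corner_lift)

text \<open>An exponential has ones on the diagonal outside the corner and is not recovered from the
  corner by \<open>lift_mat\<close>; its difference from 1 is.\<close>

lemma corner_E_inj:
  assumes "x \<in> strip N 1" "y \<in> strip N 1" "corner_mat N (K.E x) = corner_mat N (K.E y)"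
  shows "x = y"
proof (rule K.E_inj[OF assms(1,2)])
  have "lift_mat N (corner_mat N (K.E z)) = lift_mat N (corner_mat N (K.E z - 1)) + lift_mat N (1\<^sub>m N)"
    for z :: "'k utm"
    by (subst lift_linear(1)[symmetric]) (simp_all add: corner_add[symmetric] flip: corner_1)
  then have "lift_mat N (corner_mat N (K.E x - 1)) = lift_mat N (corner_mat N (K.E y - 1))"
    using assms(3) by (metis add_right_cancel)
  then have "K.E x - 1 = K.E y - 1"
    using lift_corner[OF K.E_minus_1_S[OF assms(1)]] lift_corner[OF K.E_minus_1_S[OF assms(2)]] by simp
  then show "K.E x = K.E y" by simp
qed

lemma mat_exp_inj: "inj_on (mat_exp N) (ut N :: 'k mat set)"
proof (rule inj_onI)
  fix x y :: "'k mat" assume xy: "x \<in> ut N" "y \<in> ut N" "mat_exp N x = mat_exp N y"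
  then have "lift_mat N x = lift_mat N y"
    by (intro corner_E_inj lift_strip) (auto simp: mat_exp_eq)
  then show "x = y" using corner_lift xy by metis
qed

lemma mat_exp_minus_mult:
  assumes x: "(x :: 'k mat) \<in> ut N"
  shows "mat_exp N (- x) * mat_exp N x = 1\<^sub>m N"
  using K.E_minus_mult[OF lift_strip[OF x]] ut_closed(3)[OF x x] x
  by (simp add: mat_exp_eq lift_linear(3)[OF utD(1) utD(1)] corner_1 flip: corner_mult)

lemma lift_mat_exp_conj:
  assumes x: "(x :: 'k mat) \<in> ut N" and y: "y \<in> ut N"
  shows "lift_mat N (mat_exp N (- x) * y * mat_exp N x) =
      K.E (- lift_mat N x) * lift_mat N y * K.E (lift_mat N x)" (is "_ = ?c")
    and "mat_exp N (- x) * y * mat_exp N x \<in> ut N"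
    and "mat_exp N (- x) * mat_exp N y * mat_exp N x = mat_exp N (mat_exp N (- x) * y * mat_exp N x)"
proof -
  note lift = lift_strip[OF x] lift_strip[OF y]
  have minus: "lift_mat N (- x) = - lift_mat N x" using x by (intro lift_linear(3)) (auto simp: utD)
  have eq: "mat_exp N (- x) * y * mat_exp N x = corner_mat N ?c"
    using x y ut_closed(3)[OF x x] minus by (simp add: mat_exp_eq corner_mult corner_lift)
  have "?c \<in> strip N 1"
    unfolding K.conj_E[OF lift] using K.nad_pow_S[OF lift]
    by (intro K.S_sum K.S_s) (auto intro: K.S_antimono[rotated])
  then show 1: "lift_mat N (mat_exp N (- x) * y * mat_exp N x) = ?c"
    and 2: "mat_exp N (- x) * y * mat_exp N x \<in> ut N"
    unfolding eq using lift_corner corner_ut by auto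
  show "mat_exp N (- x) * mat_exp N y * mat_exp N x = mat_exp N (mat_exp N (- x) * y * mat_exp N x)"
    unfolding mat_exp_eq[OF 2] 1
    using K.E_conj_E[OF lift(1), of "lift_mat N y"] x y ut_closed(3)[OF x x] minus
    by (simp add: mat_exp_eq flip: corner_mult)
qed

lemma lift_add_set:
  assumes W: "lin_subspace N (W :: 'k mat set)"
  shows "K.add_set (lift_mat N ` W)"
  unfolding K.add_set_def
proof (intro conjI ballI allI)
  note D = lin_subspaceD[OF W]
  show "0 \<in> lift_mat N ` W"
    using D(2) lift_linear(5)[OF D(1)[OF D(2)] D(1)[OF D(2)]] by (metis imageI)
  show "x - y \<in> lift_mat N ` W" if "x \<in> lift_mat N ` W" "y \<in> lift_mat N ` W" for x y
    using that D by (auto simp flip: lift_linear(2))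
  show "diag_utm (inv_fact k) * x \<in> lift_mat N ` W" if "x \<in> lift_mat N ` W" for x k
  proof -
    from that obtain w where w: "w \<in> W" "x = lift_mat N w" by blast
    then have "diag_utm (inv_fact k) * x = lift_mat N (inv_fact k \<cdot>\<^sub>m w)"
      using lift_linear(4)[OF D(1) D(1)] by metis
    then show ?thesis using D(4) w by blast
  qed
qed

lemma lift_lie_set:
  assumes g: "lie_subalgebra N (\<gg> :: 'k mat set)"
  shows "K.lie_set (lift_mat N ` \<gg>)"
proof -
  have W: "lin_subspace N \<gg>" and ut: "\<gg> \<subseteq> ut N" and br: "\<And>x y. x \<in> \<gg> \<Longrightarrow> y \<in> \<gg> \<Longrightarrow> bracket x y \<in> \<gg>"
    using g by (auto simp: lie_subalgebra_def)
  have "K.nad (lift_mat N x) (lift_mat N y) \<in> lift_mat N ` \<gg>" if "x \<in> \<gg>" "y \<in> \<gg>" for x y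
    using that br ut by (auto simp: K.nad_def subset_iff simp flip: lift_bracket)
  then show ?thesis
    using lift_add_set[OF W] ut lift_strip[of _ N] unfolding K.lie_set_def K.add_set_def by blast
qed

lemma mat_exp_mult_closed:
  assumes g: "lie_subalgebra N (\<gg> :: 'k mat set)" and x: "x \<in> \<gg>" and y: "y \<in> \<gg>"
  obtains z where "z \<in> \<gg>" "mat_exp N x * mat_exp N y = mat_exp N z"
proof -
  have W: "lin_subspace N \<gg>" and ut: "\<gg> \<subseteq> ut N" using g by (auto simp: lie_subalgebra_def)
  have "diag_utm c * v \<in> lift_mat N ` \<gg>" if "v \<in> lift_mat N ` \<gg>" for c v
  proof -
    from that obtain w where w: "w \<in> \<gg>" "v = lift_mat N w" by blast
    then have "diag_utm c * v = lift_mat N (c \<cdot>\<^sub>m w)"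
      using lift_linear(4)[OF lin_subspaceD(1)[OF W] lin_subspaceD(1)[OF W]] by metis
    then show ?thesis using lin_subspaceD(4)[OF W] w by blast
  qed
  then obtain z where "z \<in> lift_mat N ` \<gg>" "K.E z = K.E (lift_mat N x) * K.E (lift_mat N y)"
    using E_mult_closed[OF lift_lie_set[OF g], of "lift_mat N x" "lift_mat N y"] x y by blast
  then obtain z where z: "z \<in> \<gg>" "K.E (lift_mat N z) = K.E (lift_mat N x) * K.E (lift_mat N y)"
    by blast
  then have "mat_exp N x * mat_exp N y = mat_exp N z"
    using x y ut by (simp add: mat_exp_eq subset_iff corner_mult)
  then show ?thesis using z that by blast
qed

text \<open>The brackets have x as their second argument because \<open>nad x\<close> is -ad
  x.\<close>

lemma mat_exp_conj_diff:
  assumes V: "lin_subspace N (V :: 'k mat set)" "V \<subseteq> ut N" and x: "x \<in> ut N" and y: "y \<in> ut N"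
    and "bracket y x \<in> V" "\<And>v. v \<in> V \<Longrightarrow> bracket v x \<in> V"
  shows "mat_exp N (- x) * y * mat_exp N x - y \<in> V"
proof -
  let ?c = "mat_exp N (- x) * y * mat_exp N x"
  have nad: "K.nad (lift_mat N x) (lift_mat N v) = lift_mat N (bracket v x)" if "v \<in> ut N" for v
    using x that by (simp add: lift_bracket K.nad_def)
  have c: "?c \<in> ut N" using lift_mat_exp_conj(2)[OF x y] .
  have "lift_mat N ?c - lift_mat N y \<in> lift_mat N ` V"
    unfolding lift_mat_exp_conj(1)[OF x y]
    using assms by (intro K.E_conj_diff[OF lift_add_set[OF V(1)]] lift_strip) (auto simp: nad)
  then obtain v where v: "v \<in> V" "lift_mat N (?c - y) = lift_mat N v"
    using c y by (auto simp: lift_linear(2)[OF utD(1) utD(1)])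
  then have "?c - y = v"
    using corner_lift ut_closed(2)[OF c y] V by (metis subset_iff)
  then show ?thesis using v by simp
qed

lemma mat_exp_conj_stabilizer:
  assumes g: "lie_subalgebra N (\<gg> :: 'k mat set)" and V: "lin_subspace N V" "V \<subseteq> ut N"
    and x: "x \<in> \<gg>" and stab: "\<And>y. y \<in> \<gg> \<Longrightarrow> mat_exp N (- x) * y * mat_exp N x - y \<in> V"
    and y: "y \<in> \<gg>"
  shows "bracket y x \<in> V"
proof -
  have ut: "\<gg> \<subseteq> ut N" and br: "\<And>x y. x \<in> \<gg> \<Longrightarrow> y \<in> \<gg> \<Longrightarrow> bracket x y \<in> \<gg>"
    using g by (auto simp: lie_subalgebra_def)
  have "K.nad (lift_mat N x) (lift_mat N y) \<in> lift_mat N ` V"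
  proof (rule K.E_conj_stabilizer[OF lift_lie_set[OF g] lift_add_set[OF V(1)]])
    fix z assume "z \<in> lift_mat N ` \<gg>"
    then obtain w where w: "w \<in> \<gg>" "z = lift_mat N w" by blast
    then have xw: "x \<in> ut N" "w \<in> ut N" using x ut by auto
    have "lift_mat N (mat_exp N (- x) * w * mat_exp N x - w) \<in> lift_mat N ` V"
      using stab w by blast
    then show "K.E (- lift_mat N x) * z * K.E (lift_mat N x) - z \<in> lift_mat N ` V"
      using lift_mat_exp_conj[OF xw] w xw
      by (simp add: lift_linear(2)[OF utD(1) utD(1)])
  qed (use x y in auto)
  moreover have "K.nad (lift_mat N x) (lift_mat N y) = lift_mat N (bracket y x)"
    using x y ut by (simp add: lift_bracket K.nad_def subset_iff)
  ultimately obtain v where v: "v \<in> V" "lift_mat N (bracket y x) = lift_mat N v" by auto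
  then show ?thesis
    using corner_lift br[OF y x] ut V by (metis subset_iff)
qed

end

section \<open>Matrices over a field\<close>

lemma mult_mat_index:
  assumes "A \<in> carrier_mat n m" "B \<in> carrier_mat m k" "i < n" "j < k"
  shows "(A * B) $$ (i, j) = (\<Sum>l<m. A $$ (i, l) * B $$ (l, j))"
  using assms by (simp add: scalar_prod_def atLeast0LessThan)

lemma mult_mat_vec_index:
  assumes "A \<in> carrier_mat n m" "v \<in> carrier_vec m" "i < n"
  shows "(A *\<^sub>v v) $ i = (\<Sum>l<m. A $$ (i, l) * v $ l)"
  using assms by (simp add: scalar_prod_def atLeast0LessThan)

text \<open>Matrices of all sizes share one type, which has no common zero; the dimensions are
  passed along so that the empty sum has the right size.\<close>

definition mat_sum :: "nat \<Rightarrow> nat \<Rightarrow> ('b \<Rightarrow> 'a::comm_ring_1 mat) \<Rightarrow> 'b set \<Rightarrow> 'a mat" where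
  "mat_sum n m f S = mat n m (\<lambda>ij. \<Sum>b\<in>S. f b $$ ij)"

lemma mat_sum_carrier [simp]: "mat_sum n m f S \<in> carrier_mat n m"
  by (simp add: mat_sum_def)

lemma mat_sum_index: "i < n \<Longrightarrow> j < m \<Longrightarrow> mat_sum n m f S $$ (i, j) = (\<Sum>b\<in>S. f b $$ (i, j))"
  by (simp add: mat_sum_def)

lemma mult_mat_sum:
  assumes "A \<in> carrier_mat n m" "\<And>b. b \<in> S \<Longrightarrow> f b \<in> carrier_mat m k"
  shows "A * mat_sum m k f S = mat_sum n k (\<lambda>b. A * f b) S"
proof (rule eq_matI)
  fix i j assume "i < dim_row (mat_sum n k (\<lambda>b. A * f b) S)" "j < dim_col (mat_sum n k (\<lambda>b. A * f b) S)"
  then have ij: "i < n" "j < k" by (auto simp: mat_sum_def)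
  have "(A * mat_sum m k f S) $$ (i, j) = (\<Sum>l<m. \<Sum>b\<in>S. A $$ (i, l) * f b $$ (l, j))"
    using ij assms(1) by (simp add: mult_mat_index[of A n m _ k] mat_sum_index sum_distrib_left)
  also have "\<dots> = (\<Sum>b\<in>S. (A * f b) $$ (i, j))"
    using ij assms by (subst sum.swap) (simp add: mult_mat_index[of A n m _ k])
  finally show "(A * mat_sum m k f S) $$ (i, j) = mat_sum n k (\<lambda>b. A * f b) S $$ (i, j)"
    using ij by (simp add: mat_sum_index)
qed (use assms in \<open>auto simp: mat_sum_def\<close>)

lemma mat_sum_mult:
  assumes "A \<in> carrier_mat m k" "\<And>b. b \<in> S \<Longrightarrow> f b \<in> carrier_mat n m"
  shows "mat_sum n m f S * A = mat_sum n k (\<lambda>b. f b * A) S"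
proof (rule eq_matI)
  fix i j assume "i < dim_row (mat_sum n k (\<lambda>b. f b * A) S)" "j < dim_col (mat_sum n k (\<lambda>b. f b * A) S)"
  then have ij: "i < n" "j < k" by (auto simp: mat_sum_def)
  have "(mat_sum n m f S * A) $$ (i, j) = (\<Sum>l<m. \<Sum>b\<in>S. f b $$ (i, l) * A $$ (l, j))"
    using ij assms(1) by (simp add: mult_mat_index[of _ n m A k] mat_sum_index sum_distrib_right)
  also have "\<dots> = (\<Sum>b\<in>S. (f b * A) $$ (i, j))"
    using ij assms by (subst sum.swap) (simp add: mult_mat_index[of _ n m A k])
  finally show "(mat_sum n m f S * A) $$ (i, j) = mat_sum n k (\<lambda>b. f b * A) S $$ (i, j)"
    using ij by (simp add: mat_sum_index)
qed (use assms in \<open>auto simp: mat_sum_def\<close>)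

lemma mat_sum_reindex:
  assumes "bij_betw h S T"
  shows "mat_sum n m f T = mat_sum n m (\<lambda>b. f (h b)) S"
  unfolding mat_sum_def by (intro cong_mat refl sum.reindex_bij_betw[OF assms, symmetric])

lemma mat_sum_cong: "(\<And>b. b \<in> S \<Longrightarrow> f b = g b) \<Longrightarrow> mat_sum n m f S = mat_sum n m g S"
  unfolding mat_sum_def by (intro cong_mat refl sum.cong) auto

section \<open>Traces\<close>

definition mat_trace :: "'a::comm_ring_1 mat \<Rightarrow> 'a" where
  "mat_trace A = (\<Sum>i<dim_row A. A $$ (i, i))"

lemma mat_trace_mult_commute:
  assumes A: "A \<in> carrier_mat n m" and B: "B \<in> carrier_mat m n"
  shows "mat_trace (A * B) = mat_trace (B * A)"
proof -
  have "mat_trace (A * B) = (\<Sum>i<n. \<Sum>l<m. A $$ (i, l) * B $$ (l, i))"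
    using A B by (simp add: mat_trace_def mult_mat_index[OF A B] del: index_mult_mat(1))
  also have "\<dots> = (\<Sum>l<m. \<Sum>i<n. B $$ (l, i) * A $$ (i, l))"
    by (subst sum.swap) (simp add: mult.commute)
  also have "\<dots> = mat_trace (B * A)"
    using A B by (simp add: mat_trace_def mult_mat_index[OF B A] del: index_mult_mat(1))
  finally show ?thesis .
qed

lemma mat_trace_similar:
  assumes "similar_mat_wit A B P Q"
  shows "mat_trace A = mat_trace B"
proof -
  note D = similar_mat_witD[OF refl assms]
  let ?n = "dim_row A"
  have "mat_trace A = mat_trace (P * B * Q)" using D(3) by (rule arg_cong)
  also have "\<dots> = mat_trace (P * (B * Q))" by (subst assoc_mult_mat[OF D(6,5,7)]) (rule refl)
  also have "\<dots> = mat_trace (B * Q * P)"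
    by (rule mat_trace_mult_commute[OF D(6) mult_carrier_mat[OF D(5,7)]])
  also have "B * Q * P = B" unfolding assoc_mult_mat[OF D(5,7,6)] D(2) using D(5) by simp
  finally show ?thesis .
qed

lemma mat_trace_four_block:
  assumes "A \<in> carrier_mat n n" "D \<in> carrier_mat m m"
  shows "mat_trace (four_block_mat A B C D) = mat_trace A + mat_trace D"
proof -
  have "mat_trace (four_block_mat A B C D) =
     (\<Sum>i<n + m. if i < n then A $$ (i, i) else D $$ (i - n, i - n))"
    using assms by (auto simp: mat_trace_def intro!: sum.cong)
  also have "\<dots> = (\<Sum>i<n. A $$ (i, i)) + (\<Sum>i\<in>{n..<n+m}. D $$ (i - n, i - n))"
  proof -
    have "{..<n + m} = {..<n} \<union> {n..<n + m}" by auto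
    then show ?thesis by (simp add: sum.union_disjoint ivl_disj_int)
  qed
  also have "(\<Sum>i\<in>{n..<n+m}. D $$ (i - n, i - n)) = (\<Sum>i<m. D $$ (i, i))"
    by (rule sum.reindex_bij_witness[of _ "\<lambda>i. i + n" "\<lambda>i. i - n"]) auto
  finally show ?thesis using assms by (simp add: mat_trace_def)
qed

lemma mat_trace_diag_block:
  assumes "\<And>A. A \<in> set As \<Longrightarrow> square_mat A"
  shows "mat_trace (diag_block_mat As) = sum_list (map mat_trace As)"
  using assms
proof (induction As)
  case (Cons A As)
  have "square_mat (diag_block_mat As)" using Cons by (intro diag_block_mat_square) auto
  then have D: "diag_block_mat As \<in> carrier_mat (dim_row (diag_block_mat As)) (dim_row (diag_block_mat As))"
    by auto
  have A: "A \<in> carrier_mat (dim_row A) (dim_row A)" using Cons(2)[of A] by auto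
  show ?case using Cons by (simp add: Let_def mat_trace_four_block[OF A D])
qed (simp add: mat_trace_def)

section \<open>Injective matrices and bases\<close>

definition inj_mat :: "'a::field mat \<Rightarrow> bool" where
  "inj_mat A \<longleftrightarrow> (\<forall>v\<in>carrier_vec (dim_col A). A *\<^sub>v v = 0\<^sub>v (dim_row A) \<longrightarrow> v = 0\<^sub>v (dim_col A))"

lemma inj_matD:
  "inj_mat A \<Longrightarrow> A \<in> carrier_mat n m \<Longrightarrow> v \<in> carrier_vec m \<Longrightarrow> A *\<^sub>v v = 0\<^sub>v n \<Longrightarrow> v = 0\<^sub>v m"
  by (auto simp: inj_mat_def)

text \<open>If m > n, padding A by zero rows gives a square matrix whose transpose kills a unit
  vector. Its determinant is therefore zero, and a kernel vector of the padded matrix is one of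
  A.\<close>

lemma inj_mat_le:
  assumes A: "A \<in> carrier_mat n m" and inj: "inj_mat (A :: 'a::field mat)"
  shows "m \<le> n"
proof (rule ccontr)
  assume "\<not> m \<le> n"
  then have nm: "n < m" by simp
  define B where "B = mat m m (\<lambda>(i, j). if i < n then A $$ (i, j) else 0)"
  have B: "B \<in> carrier_mat m m" by (simp add: B_def)
  have "B\<^sup>T *\<^sub>v unit_vec m n = 0\<^sub>v m"
    using nm by (intro eq_vecI) (auto simp: mult_mat_vec_index[of _ m m] B_def)
  moreover have "unit_vec m n \<noteq> (0\<^sub>v m :: 'a vec)"
    using nm by (metis index_unit_vec(1) index_zero_vec(1) one_neq_zero)
  ultimately have "det B\<^sup>T = 0"
    using B by (subst det_0_iff_vec_prod_zero_field[of _ m]) (auto intro!: exI[of _ "unit_vec m n"])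
  then have "det B = 0" using B det_transpose by metis
  then obtain v where v: "v \<in> carrier_vec m" "v \<noteq> 0\<^sub>v m" "B *\<^sub>v v = 0\<^sub>v m"
    using det_0_iff_vec_prod_zero_field[OF B] by blast
  have "A *\<^sub>v v = 0\<^sub>v n"
  proof (rule eq_vecI)
    fix i assume "i < dim_vec (0\<^sub>v n :: 'a vec)"
    then have i: "i < n" by simp
    then have "(A *\<^sub>v v) $ i = (B *\<^sub>v v) $ i"
      using nm by (simp add: mult_mat_vec_index[OF A v(1) i] mult_mat_vec_index[OF B v(1)]
          del: index_mult_mat_vec) (simp add: B_def)
    then show "(A *\<^sub>v v) $ i = 0\<^sub>v n $ i" using v i nm by simp
  qed (use A in auto)
  then show False using inj_matD[OF inj A v(1)] v(2) by blast
qed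

text \<open>Preimages of the unit vectors form a right inverse C. A right inverse is injective,
  which supplies the missing inequality between n and m.\<close>

lemma inj_surj_mat_inverse:
  assumes A: "(A :: 'a::field mat) \<in> carrier_mat n m" and inj: "inj_mat A"
    and surj: "\<And>w. w \<in> carrier_vec n \<Longrightarrow> \<exists>v\<in>carrier_vec m. A *\<^sub>v v = w"
  obtains C where "n = m" "C \<in> carrier_mat m n" "A * C = 1\<^sub>m n" "C * A = 1\<^sub>m n"
proof -
  have "\<exists>v. v \<in> carrier_vec m \<and> A *\<^sub>v v = unit_vec n j" for j
    using surj[of "unit_vec n j"] by auto
  then obtain c where c: "\<And>j. c j \<in> carrier_vec m" "\<And>j. A *\<^sub>v c j = unit_vec n j" by metis
  define C where "C = mat m n (\<lambda>(i, j). c j $ i)"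
  have C: "C \<in> carrier_mat m n" by (simp add: C_def)
  have AC: "A * C = 1\<^sub>m n"
  proof (rule eq_matI)
    fix i j assume ij: "i < dim_row (1\<^sub>m n :: 'a mat)" "j < dim_col (1\<^sub>m n :: 'a mat)"
    then have "(A * C) $$ (i, j) = (A *\<^sub>v c j) $ i"
      by (simp add: mult_mat_index[OF A C] mult_mat_vec_index[OF A c(1)]) (simp add: C_def)
    then show "(A * C) $$ (i, j) = 1\<^sub>m n $$ (i, j)" using c ij by (auto simp: unit_vec_def)
  qed (use A C in auto)
  have "inj_mat C"
    unfolding inj_mat_def
  proof (intro ballI impI)
    fix v assume v: "v \<in> carrier_vec (dim_col C)" and 0: "C *\<^sub>v v = 0\<^sub>v (dim_row C)"
    then have vn: "v \<in> carrier_vec n" using C by auto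
    have "v = A *\<^sub>v (C *\<^sub>v v)" using AC A C vn by (metis assoc_mult_mat_vec one_mult_mat_vec)
    also have "\<dots> = 0\<^sub>v n" using 0 A C by (auto simp: mult_mat_vec_index intro!: eq_vecI)
    finally show "v = 0\<^sub>v (dim_col C)" using C by simp
  qed
  then have "n = m" using inj_mat_le[OF C] inj_mat_le[OF A inj] by simp
  then show ?thesis using that[OF _ C AC] mat_mult_left_right_inverse[of A n C] A C AC by auto
qed

definition vec_subspace :: "nat \<Rightarrow> 'a::field vec set \<Rightarrow> bool" where
  "vec_subspace n W \<longleftrightarrow> W \<subseteq> carrier_vec n \<and> 0\<^sub>v n \<in> W \<and> (\<forall>v\<in>W. \<forall>w\<in>W. v + w \<in> W) \<and>
     (\<forall>c. \<forall>v\<in>W. c \<cdot>\<^sub>v v \<in> W)"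

lemma vec_subspace_iff: "VectorSpace.subspace class_ring W (module_vec TYPE('a::field) n) \<longleftrightarrow> vec_subspace n W"
proof -
  interpret vectorspace "class_ring :: 'a ring" "module_vec TYPE('a) n"
    by (rule vec_vs)
  show ?thesis
    unfolding VectorSpace.subspace_def submodule_def vec_subspace_def
    using vectorspace_axioms module_axioms
    by (auto simp: module_vec_simps class_ring_simps)
qed

text \<open>Basis extension in matrix form: as long as the range is smaller than W, a vector of W
  outside it is appended as a new column, and \<open>inj_mat_le\<close> bounds the number of columns
  by n. Starting from no columns gives a basis of a subspace, a second application completes it to a
  basis of the whole space.\<close>

lemma inj_mat_extend:
  assumes A: "(A :: 'a::field mat) \<in> carrier_mat n m" and inj: "inj_mat A" and W: "vec_subspace n W"
    and range: "\<And>v. v \<in> carrier_vec m \<Longrightarrow> A *\<^sub>v v \<in> W"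
  shows "\<exists>k\<ge>m. \<exists>B\<in>carrier_mat n k. inj_mat B \<and> (\<forall>i<n. \<forall>j<m. B $$ (i, j) = A $$ (i, j)) \<and>
     (\<lambda>v. B *\<^sub>v v) ` carrier_vec k = W"
  using A inj range
proof (induction "n - m" arbitrary: m A rule: less_induct)
  case less
  show ?case
  proof (cases "(\<lambda>v. A *\<^sub>v v) ` carrier_vec m = W")
    case True
    then show ?thesis using less.prems by (intro exI[of _ m] bexI[of _ A]) auto
  next
    case False
    then obtain w where w: "w \<in> W" "w \<notin> (\<lambda>v. A *\<^sub>v v) ` carrier_vec m" using less.prems by blast
    have wn: "w \<in> carrier_vec n" using W w by (auto simp: vec_subspace_def)
    define B where "B = mat n (Suc m) (\<lambda>(i, j). if j < m then A $$ (i, j) else w $ i)"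
    have B: "B \<in> carrier_mat n (Suc m)" by (simp add: B_def)
    have Bv: "B *\<^sub>v v = A *\<^sub>v vec m (\<lambda>i. v $ i) + v $ m \<cdot>\<^sub>v w" if v: "v \<in> carrier_vec (Suc m)" for v
    proof (rule eq_vecI)
      fix i assume "i < dim_vec (A *\<^sub>v vec m (\<lambda>i. v $ i) + v $ m \<cdot>\<^sub>v w)"
      then have i: "i < n" using wn by simp
      have "(B *\<^sub>v v) $ i = (\<Sum>l<Suc m. B $$ (i, l) * v $ l)"
        using mult_mat_vec_index[OF B v i] .
      also have "\<dots> = (\<Sum>l<m. A $$ (i, l) * v $ l) + w $ i * v $ m"
        using i by (simp add: B_def)
      also have "(\<Sum>l<m. A $$ (i, l) * v $ l) = (A *\<^sub>v vec m (\<lambda>i. v $ i)) $ i"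
        using i by (subst mult_mat_vec_index[OF less.prems(1)]) auto
      finally show "(B *\<^sub>v v) $ i = (A *\<^sub>v vec m (\<lambda>i. v $ i) + v $ m \<cdot>\<^sub>v w) $ i"
        using i wn less.prems(1) by (simp add: mult.commute)
    qed (use B wn in auto)
    have injB: "inj_mat B"
      unfolding inj_mat_def
    proof (intro ballI impI)
      fix v assume "v \<in> carrier_vec (dim_col B)" and "B *\<^sub>v v = 0\<^sub>v (dim_row B)"
      then have v: "v \<in> carrier_vec (Suc m)" and 0: "B *\<^sub>v v = 0\<^sub>v n" using B by auto
      let ?v = "vec m (\<lambda>i. v $ i)"
      have eq: "A *\<^sub>v ?v + v $ m \<cdot>\<^sub>v w = 0\<^sub>v n" using Bv[OF v] 0 by simp
      \<comment> \<open>Otherwise w would be a multiple of a vector in the range of A.\<close>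
      have vm: "v $ m = 0"
      proof (rule ccontr)
        assume nz: "v $ m \<noteq> 0"
        have "A *\<^sub>v ((- 1 / v $ m) \<cdot>\<^sub>v ?v) = (- 1 / v $ m) \<cdot>\<^sub>v (A *\<^sub>v ?v)"
          by (rule mult_mat_vec[OF less.prems(1)]) auto
        also have "\<dots> = w"
        proof (rule eq_vecI)
          fix i assume "i < dim_vec w"
          then have i: "i < n" using wn by simp
          have "(A *\<^sub>v ?v + v $ m \<cdot>\<^sub>v w) $ i = 0" using eq i by simp
          then have "(A *\<^sub>v ?v) $ i = - (v $ m * w $ i)"
            using i wn less.prems(1) by (simp add: eq_neg_iff_add_eq_0 del: index_mult_mat_vec)
          then show "((- 1 / v $ m) \<cdot>\<^sub>v (A *\<^sub>v ?v)) $ i = w $ i"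
            using i nz less.prems(1) by (simp del: index_mult_mat_vec)
        qed (use wn less.prems(1) in auto)
        finally show False using w(2) by (metis imageI smult_carrier_vec vec_carrier)
      qed
      then have "A *\<^sub>v ?v = 0\<^sub>v n" using eq wn less.prems(1) by (auto simp: vec_eq_iff)
      then have "?v = 0\<^sub>v m" using inj_matD[OF less.prems(2,1)] by auto
      then have "v $ i = 0" if "i < m" for i using that by (metis index_vec index_zero_vec(1))
      then show "v = 0\<^sub>v (dim_col B)"
        using v vm B by (intro eq_vecI) (auto simp: less_Suc_eq)
    qed
    have rangeB: "B *\<^sub>v v \<in> W" if "v \<in> carrier_vec (Suc m)" for v
      using Bv[OF that] less.prems(3)[of "vec m (\<lambda>i. v $ i)"] W w by (auto simp: vec_subspace_def)
    have "n - Suc m < n - m" using inj_mat_le[OF B injB] by simp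
    from less.hyps[OF this B injB rangeB] obtain k C where C: "k \<ge> Suc m" "C \<in> carrier_mat n k"
      "inj_mat C" "\<forall>i<n. \<forall>j<Suc m. C $$ (i, j) = B $$ (i, j)" "(\<lambda>v. C *\<^sub>v v) ` carrier_vec k = W"
      by blast
    then show ?thesis by (intro exI[of _ k] conjI bexI[of _ C]) (auto simp: B_def)
  qed
qed

section \<open>Schur orthogonality\<close>

text \<open>Makes the degree a parameter. Over a group, the homomorphism property together with the
  value at one forces the matrices to be invertible.\<close>

definition rep_on :: "('g, 'b) monoid_scheme \<Rightarrow> nat \<Rightarrow> ('g \<Rightarrow> complex mat) \<Rightarrow> bool" where
  "rep_on G n \<rho> \<longleftrightarrow> (\<forall>a\<in>carrier G. \<rho> a \<in> carrier_mat n n) \<and>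
     (\<forall>a\<in>carrier G. \<forall>b\<in>carrier G. \<rho> (a \<otimes>\<^bsub>G\<^esub> b) = \<rho> a * \<rho> b) \<and> \<rho> \<one>\<^bsub>G\<^esub> = 1\<^sub>m n"

lemma (in group) rep_on_representation:
  assumes \<rho>: "rep_on G n \<rho>"
  shows "representation G \<rho>" "rep_degree G \<rho> = n"
proof -
  show "rep_degree G \<rho> = n" using \<rho> by (simp add: rep_degree_def rep_on_def)
  have "\<rho> a \<in> carrier (GL n)" if a: "a \<in> carrier G" for a
  proof -
    have "\<rho> (inv a \<otimes> a) = \<rho> (inv a) * \<rho> a" "\<rho> (a \<otimes> inv a) = \<rho> a * \<rho> (inv a)"
      using \<rho> a by (simp_all only: rep_on_def inv_closed)
    then have "\<rho> (inv a) * \<rho> a = 1\<^sub>m n" "\<rho> a * \<rho> (inv a) = 1\<^sub>m n"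
      using \<rho> a by (auto simp: rep_on_def)
    then show ?thesis
      using \<rho> a by (auto simp: GL_def units_of_def Units_def ring_mat_simps rep_on_def intro!: bexI[of _ "\<rho> (inv a)"])
  qed
  then have "\<rho> \<in> hom G (GL n)"
    using \<rho> by (auto simp: hom_def GL_def units_of_def ring_mat_simps rep_on_def)
  then show "representation G \<rho>" by (auto simp: representation_def)
qed

lemma (in group) representation_rep_on:
  assumes \<rho>: "representation G \<rho>"
  shows "rep_on G (rep_degree G \<rho>) \<rho>"
proof -
  obtain n where hom: "\<rho> \<in> hom G (GL n)" using \<rho> by (auto simp: representation_def)
  interpret R: ring "ring_mat TYPE(complex) n ()" by (rule ring_mat)
  have GL: "group (GL n)" unfolding GL_def by (rule R.units_group)
  have one: "\<rho> \<one>\<^bsub>G\<^esub> = 1\<^sub>m n"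
    using group_hom.hom_one[of G "GL n" \<rho>] GL hom is_group
    by (simp add: group_hom_def group_hom_axioms_def) (simp add: GL_def units_of_def ring_mat_simps)
  have "rep_on G n \<rho>"
    using hom one by (auto simp: rep_on_def hom_def GL_def units_of_def Units_def ring_mat_simps Pi_iff)
  then show ?thesis using one by (simp add: rep_degree_def)
qed

lemma rep_equiv_sym: "rep_equiv G \<rho> \<sigma> \<Longrightarrow> rep_equiv G \<sigma> \<rho>"
  unfolding rep_equiv_def using similar_mat_wit_sym by blast

lemma rep_equiv_trans: "rep_equiv G \<rho> \<sigma> \<Longrightarrow> rep_equiv G \<sigma> \<tau> \<Longrightarrow> rep_equiv G \<rho> \<tau>"
  unfolding rep_equiv_def using similar_mat_wit_trans by meson

lemma rep_on_equiv_refl: "rep_on G n \<rho> \<Longrightarrow> rep_equiv G \<rho> \<rho>"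
  unfolding rep_equiv_def rep_on_def using similar_mat_wit_refl by blast

lemma rep_equiv_trace: "rep_equiv G \<rho> \<sigma> \<Longrightarrow> a \<in> carrier G \<Longrightarrow> mat_trace (\<rho> a) = mat_trace (\<sigma> a)"
  unfolding rep_equiv_def using mat_trace_similar by blast

locale finite_group = group G for G (structure) +
  assumes finite_carrier: "finite (carrier G)"
begin

abbreviation "ord_G \<equiv> of_nat (card (carrier G)) :: complex"

lemma ord_G_nonzero: "ord_G \<noteq> 0"
  using finite_carrier one_closed by (auto simp: card_eq_0_iff)

lemma rep_onD:
  assumes "rep_on G n \<rho>"
  shows "a \<in> carrier G \<Longrightarrow> \<rho> a \<in> carrier_mat n n"
    "a \<in> carrier G \<Longrightarrow> b \<in> carrier G \<Longrightarrow> \<rho> (a \<otimes> b) = \<rho> a * \<rho> b" "\<rho> \<one> = 1\<^sub>m n"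
    "a \<in> carrier G \<Longrightarrow> \<rho> a * \<rho> (inv a) = 1\<^sub>m n" "a \<in> carrier G \<Longrightarrow> \<rho> (inv a) * \<rho> a = 1\<^sub>m n"
proof -
  show 1: "a \<in> carrier G \<Longrightarrow> b \<in> carrier G \<Longrightarrow> \<rho> (a \<otimes> b) = \<rho> a * \<rho> b" for a b
    using assms by (simp add: rep_on_def)
  show 2: "\<rho> \<one> = 1\<^sub>m n" using assms by (simp add: rep_on_def)
  show "a \<in> carrier G \<Longrightarrow> \<rho> a * \<rho> (inv a) = 1\<^sub>m n" "a \<in> carrier G \<Longrightarrow> \<rho> (inv a) * \<rho> a = 1\<^sub>m n"
    using 1[of a "inv a"] 1[of "inv a" a] 2 by auto
qed (use assms in \<open>simp add: rep_on_def\<close>)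

lemma bij_betw_mult_left: "b \<in> carrier G \<Longrightarrow> bij_betw (\<lambda>a. b \<otimes> a) (carrier G) (carrier G)"
  by (rule bij_betw_byWitness[of _ "\<lambda>a. inv b \<otimes> a"]) (auto simp: m_assoc[symmetric])

definition intertwiner :: "('a \<Rightarrow> complex mat) \<Rightarrow> ('a \<Rightarrow> complex mat) \<Rightarrow> complex mat \<Rightarrow> bool" where
  "intertwiner \<sigma> \<tau> T \<longleftrightarrow> (\<forall>a\<in>carrier G. \<sigma> a * T = T * \<tau> a)"

definition average :: "nat \<Rightarrow> nat \<Rightarrow> ('a \<Rightarrow> complex mat) \<Rightarrow> ('a \<Rightarrow> complex mat) \<Rightarrow> complex mat \<Rightarrow> complex mat" where
  "average m n \<sigma> \<tau> X = mat_sum m n (\<lambda>a. \<sigma> a * X * \<tau> (inv a)) (carrier G)"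

text \<open>Replacing the summation variable a by b a moves \<open>\<sigma> b\<close> on the left to
  \<open>\<tau> b\<close> on the right.\<close>

lemma average_intertwiner:
  assumes \<sigma>: "rep_on G m \<sigma>" and \<tau>: "rep_on G n \<tau>" and X: "X \<in> carrier_mat m n"
  shows "intertwiner \<sigma> \<tau> (average m n \<sigma> \<tau> X)"
  unfolding intertwiner_def
proof
  fix b assume b: "b \<in> carrier G"
  note [simp] = rep_onD(1)[OF \<sigma>] rep_onD(1)[OF \<tau>]
  have summand: "\<sigma> a * X * \<tau> (inv a) \<in> carrier_mat m n" if "a \<in> carrier G" for a
    by (rule mult_carrier_mat[OF mult_carrier_mat[OF rep_onD(1)[OF \<sigma>] X] rep_onD(1)[OF \<tau>]])
      (use that in auto)
  have "\<sigma> b * average m n \<sigma> \<tau> X = mat_sum m n (\<lambda>a. \<sigma> b * (\<sigma> a * X * \<tau> (inv a))) (carrier G)"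
    unfolding average_def using b summand by (intro mult_mat_sum[of _ m m]) auto
  also have "\<dots> = mat_sum m n (\<lambda>a. \<sigma> (b \<otimes> a) * X * \<tau> (inv (b \<otimes> a)) * \<tau> b) (carrier G)"
  proof (rule mat_sum_cong)
    fix a assume a: "a \<in> carrier G"
    have "\<tau> (inv (b \<otimes> a)) * \<tau> b = \<tau> (inv a)"
      using a b by (subst rep_onD(2)[OF \<tau>, symmetric]) (auto simp: inv_mult_group m_assoc)
    then have "\<sigma> (b \<otimes> a) * X * \<tau> (inv (b \<otimes> a)) * \<tau> b = \<sigma> (b \<otimes> a) * X * \<tau> (inv a)"
    proof -
      have c: "\<sigma> (b \<otimes> a) \<in> carrier_mat m m" "\<tau> (inv (b \<otimes> a)) \<in> carrier_mat n n" "\<tau> b \<in> carrier_mat n n"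
        using a b by auto
      assume "\<tau> (inv (b \<otimes> a)) * \<tau> b = \<tau> (inv a)"
      then show ?thesis
        unfolding assoc_mult_mat[OF mult_carrier_mat[OF c(1) X] c(2,3)] by simp
    qed
    also have "\<dots> = \<sigma> b * (\<sigma> a * X * \<tau> (inv a))"
    proof -
      have c: "\<sigma> b \<in> carrier_mat m m" "\<sigma> a \<in> carrier_mat m m" "\<tau> (inv a) \<in> carrier_mat n n"
        using a b by auto
      show ?thesis
        unfolding rep_onD(2)[OF \<sigma> b a] assoc_mult_mat[OF c(1,2) X]
          assoc_mult_mat[OF c(1) mult_carrier_mat[OF c(2) X] c(3)] by (rule refl)
    qed
    finally show "\<sigma> b * (\<sigma> a * X * \<tau> (inv a)) = \<sigma> (b \<otimes> a) * X * \<tau> (inv (b \<otimes> a)) * \<tau> b" ..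
  qed
  also have "\<dots> = mat_sum m n (\<lambda>a. \<sigma> a * X * \<tau> (inv a) * \<tau> b) (carrier G)"
    by (rule mat_sum_reindex[OF bij_betw_mult_left[OF b], symmetric])
  also have "\<dots> = average m n \<sigma> \<tau> X * \<tau> b"
    unfolding average_def using b summand by (intro mat_sum_mult[symmetric]) auto
  finally show "\<sigma> b * average m n \<sigma> \<tau> X = average m n \<sigma> \<tau> X * \<tau> b" .
qed

section \<open>Schur's lemma\<close>

lemma irreducible_repD:
  assumes "irreducible_rep G \<rho>" "rep_on G n \<rho>" "vec_subspace n W"
    "\<And>a w. a \<in> carrier G \<Longrightarrow> w \<in> W \<Longrightarrow> \<rho> a *\<^sub>v w \<in> W"
  shows "W = {0\<^sub>v n} \<or> W = carrier_vec n"
proof -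
  have "rep_degree G \<rho> = n" using rep_on_representation(2)[OF assms(2)] .
  then show ?thesis
    using assms unfolding irreducible_rep_def by (auto simp: vec_subspace_iff)
qed

text \<open>Kernel and range of T are invariant subspaces. Injectivity is part of the second
  alternative because equivalence alone says nothing when the two representations coincide, which is
  the case needed for \<open>Schur_scalar\<close>.\<close>

lemma Schur_dichotomy:
  assumes \<sigma>: "rep_on G m \<sigma>" "irreducible_rep G \<sigma>" and \<tau>: "rep_on G n \<tau>" "irreducible_rep G \<tau>"
    and T: "T \<in> carrier_mat m n" "intertwiner \<sigma> \<tau> T"
  shows "T = 0\<^sub>m m n \<or> rep_equiv G \<sigma> \<tau> \<and> inj_mat T"
proof (rule disjCI)
  assume "\<not> (rep_equiv G \<sigma> \<tau> \<and> inj_mat T)"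
  have comm: "\<sigma> a * T = T * \<tau> a" if "a \<in> carrier G" for a
    using T(2) that by (simp add: intertwiner_def)
  have Tv: "\<sigma> a *\<^sub>v (T *\<^sub>v v) = T *\<^sub>v (\<tau> a *\<^sub>v v)" if "a \<in> carrier G" "v \<in> carrier_vec n" for a v
    using that comm T(1) rep_onD(1)[OF \<sigma>(1)] rep_onD(1)[OF \<tau>(1)] by (metis assoc_mult_mat_vec)
  have zero: "T = 0\<^sub>m m n" if "\<And>v. v \<in> carrier_vec n \<Longrightarrow> T *\<^sub>v v = 0\<^sub>v m"
  proof (rule eq_matI)
    fix i j assume "i < dim_row (0\<^sub>m m n :: complex mat)" "j < dim_col (0\<^sub>m m n :: complex mat)"
    then have ij: "i < m" "j < n" by auto
    then have "T $$ (i, j) = (T *\<^sub>v unit_vec n j) $ i" using T(1) by simp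
    then show "T $$ (i, j) = 0\<^sub>m m n $$ (i, j)" using that[of "unit_vec n j"] ij by simp
  qed (use T in auto)
  let ?K = "{v \<in> carrier_vec n. T *\<^sub>v v = 0\<^sub>v m}"
  have "vec_subspace n ?K"
    using T(1) by (auto simp: vec_subspace_def mult_add_distrib_mat_vec mult_mat_vec)
  moreover have "\<tau> a *\<^sub>v w \<in> ?K" if "a \<in> carrier G" "w \<in> ?K" for a w
    using that Tv[of a w, symmetric] rep_onD(1)[OF \<sigma>(1), of a] rep_onD(1)[OF \<tau>(1), of a] by auto
  ultimately have "?K = {0\<^sub>v n} \<or> ?K = carrier_vec n"
    using irreducible_repD[OF \<tau>(2,1)] by blast
  then show "T = 0\<^sub>m m n"
  proof
    assume "?K = carrier_vec n"
    then show ?thesis by (intro zero) blast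
  next
    assume K: "?K = {0\<^sub>v n}"
    then have inj: "inj_mat T" using T(1) unfolding inj_mat_def by blast
    let ?R = "(\<lambda>v. T *\<^sub>v v) ` carrier_vec n"
    have "vec_subspace m ?R"
      unfolding vec_subspace_def
    proof (intro conjI ballI allI)
      show "0\<^sub>v m \<in> ?R" using T(1) by (intro image_eqI[of _ _ "0\<^sub>v n"]) auto
    next
      fix v w assume "v \<in> ?R" "w \<in> ?R"
      then obtain x y where "x \<in> carrier_vec n" "y \<in> carrier_vec n" "v = T *\<^sub>v x" "w = T *\<^sub>v y" by blast
      then show "v + w \<in> ?R"
        using T(1) by (intro image_eqI[of _ _ "x + y"]) (auto simp: mult_add_distrib_mat_vec)
    next
      fix c v assume "v \<in> ?R"
      then obtain x where "x \<in> carrier_vec n" "v = T *\<^sub>v x" by blast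
      then show "c \<cdot>\<^sub>v v \<in> ?R"
        using T(1) by (intro image_eqI[of _ _ "c \<cdot>\<^sub>v x"]) (auto simp: mult_mat_vec)
    qed (use T(1) in auto)
    moreover have "\<sigma> a *\<^sub>v w \<in> ?R" if "a \<in> carrier G" "w \<in> ?R" for a w
    proof -
      from that(2) obtain v where "v \<in> carrier_vec n" "w = T *\<^sub>v v" by blast
      then show ?thesis
        using Tv[OF that(1)] rep_onD(1)[OF \<tau>(1) that(1)] by (intro image_eqI[of _ _ "\<tau> a *\<^sub>v v"]) auto
    qed
    ultimately have "?R = {0\<^sub>v m} \<or> ?R = carrier_vec m"
      using irreducible_repD[OF \<sigma>(2,1)] by blast
    then show ?thesis
    proof
      assume "?R = {0\<^sub>v m}"
      then show ?thesis by (intro zero) blast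
    next
      assume "?R = carrier_vec m"
      then have "\<And>w. w \<in> carrier_vec m \<Longrightarrow> \<exists>v\<in>carrier_vec n. T *\<^sub>v v = w" by (metis imageE)
      then obtain C where mn: "m = n" and C: "C \<in> carrier_mat n m" "T * C = 1\<^sub>m m" "C * T = 1\<^sub>m n"
        using inj_surj_mat_inverse[OF T(1) inj] by metis
      have "similar_mat_wit (\<sigma> a) (\<tau> a) T C" if a: "a \<in> carrier G" for a
      proof (rule similar_mat_witI[of _ _ n])
        have "\<sigma> a = \<sigma> a * T * C"
          using C T(1) rep_onD(1)[OF \<sigma>(1) a] mn by (simp add: assoc_mult_mat[of _ m m _ n _ m])
        then show "\<sigma> a = T * \<tau> a * C" using comm a by simp
      qed (use C T mn rep_onD(1)[OF \<sigma>(1) a] rep_onD(1)[OF \<tau>(1) a] in auto)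
      then have "rep_equiv G \<sigma> \<tau>" unfolding rep_equiv_def by blast
      then show ?thesis using inj \<open>\<not> (rep_equiv G \<sigma> \<tau> \<and> inj_mat T)\<close> by blast
    qed
  qed
qed

text \<open>The characteristic polynomial has a complex root c; T - c commutes with the
  representation and kills an eigenvector, so the dichotomy leaves only zero.\<close>

lemma Schur_scalar:
  assumes \<sigma>: "rep_on G n \<sigma>" "irreducible_rep G \<sigma>"
    and T: "T \<in> carrier_mat n n" "intertwiner \<sigma> \<sigma> T"
  obtains c where "T = c \<cdot>\<^sub>m 1\<^sub>m n"
proof -
  have n: "n > 0"
    using \<sigma> rep_on_representation(2)[OF \<sigma>(1)] by (simp add: irreducible_rep_def)
  have "\<not> constant (poly (char_poly T))"
    using degree_monic_char_poly[OF T(1)] n by (simp add: constant_degree)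
  then obtain c where "poly (char_poly T) c = 0"
    using fundamental_theorem_of_algebra by blast
  then obtain v where v: "v \<in> carrier_vec n" "v \<noteq> 0\<^sub>v n" "T *\<^sub>v v = c \<cdot>\<^sub>v v"
    using eigenvalue_root_char_poly[OF T(1)] T(1) by (auto simp: eigenvalue_def eigenvector_def)
  let ?S = "T - c \<cdot>\<^sub>m 1\<^sub>m n"
  have S: "?S \<in> carrier_mat n n" using T by auto
  have "intertwiner \<sigma> \<sigma> ?S"
    unfolding intertwiner_def
  proof
    fix a assume a: "a \<in> carrier G"
    note A = rep_onD(1)[OF \<sigma>(1) a]
    have "\<sigma> a * ?S = \<sigma> a * T - \<sigma> a * (c \<cdot>\<^sub>m 1\<^sub>m n)"
      using A T by (intro mult_minus_distrib_mat) auto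
    also have "\<dots> = T * \<sigma> a - (c \<cdot>\<^sub>m 1\<^sub>m n) * \<sigma> a"
      using A T a by (simp add: intertwiner_def mult_smult_distrib[of _ n n _ n] mult_smult_assoc_mat[of _ n n _ n])
    also have "\<dots> = ?S * \<sigma> a"
      using A T by (intro minus_mult_distrib_mat[symmetric]) auto
    finally show "\<sigma> a * ?S = ?S * \<sigma> a" .
  qed
  moreover have "\<not> inj_mat ?S"
  proof
    assume "inj_mat ?S"
    moreover have "?S *\<^sub>v v = 0\<^sub>v n"
      using v T by (subst minus_mult_distrib_mat_vec[of _ n n]) auto
    ultimately show False using inj_matD[OF _ S v(1)] v(2) by blast
  qed
  ultimately have "?S = 0\<^sub>m n n" using Schur_dichotomy[OF \<sigma> \<sigma> S] by blast
  then have "T = c \<cdot>\<^sub>m 1\<^sub>m n"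
    using T(1) by (intro eq_matI) (auto simp: mat_eq_iff)
  then show ?thesis by (rule that)
qed

section \<open>Orthogonality of irreducible characters\<close>

definition char_prod :: "('a \<Rightarrow> complex mat) \<Rightarrow> ('a \<Rightarrow> complex mat) \<Rightarrow> complex" where
  "char_prod \<sigma> \<tau> = (\<Sum>a\<in>carrier G. mat_trace (\<sigma> (inv a)) * mat_trace (\<tau> a))"

definition unit_mat :: "nat \<Rightarrow> nat \<Rightarrow> nat \<Rightarrow> nat \<Rightarrow> complex mat" where
  "unit_mat m n k l = mat m n (\<lambda>(i, j). if i = k \<and> j = l then 1 else 0)"

text \<open>In the triple product the unit matrix fixes both inner indices, so that only diagonal
  entries of the two representations remain.\<close>

lemma average_unit_mat_index:
  assumes \<sigma>: "rep_on G m \<sigma>" and \<tau>: "rep_on G n \<tau>" and k: "k < m" "l < n"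
  shows "average m n \<sigma> \<tau> (unit_mat m n k l) $$ (k, l) =
      (\<Sum>a\<in>carrier G. \<sigma> a $$ (k, k) * \<tau> (inv a) $$ (l, l))"
  unfolding average_def mat_sum_index[OF k]
proof (intro sum.cong refl)
  fix a assume a: "a \<in> carrier G"
  have A: "\<sigma> a \<in> carrier_mat m m" "\<tau> (inv a) \<in> carrier_mat n n" "unit_mat m n k l \<in> carrier_mat m n"
    using rep_onD(1)[OF \<sigma>] rep_onD(1)[OF \<tau>] a by (auto simp: unit_mat_def)
  have 1: "(\<sigma> a * unit_mat m n k l) $$ (k, j) = (if j = l then \<sigma> a $$ (k, k) else 0)" if "j < n" for j
  proof -
    have "(\<sigma> a * unit_mat m n k l) $$ (k, j) = (\<Sum>i<m. \<sigma> a $$ (k, i) * unit_mat m n k l $$ (i, j))"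
      by (rule mult_mat_index[OF A(1,3) k(1) that])
    also have "\<dots> = (\<Sum>i<m. if i = k then (if j = l then \<sigma> a $$ (k, k) else 0) else 0)"
      using that by (intro sum.cong) (auto simp: unit_mat_def)
    finally show ?thesis using k by simp
  qed
  have "(\<sigma> a * unit_mat m n k l * \<tau> (inv a)) $$ (k, l) =
     (\<Sum>j<n. (\<sigma> a * unit_mat m n k l) $$ (k, j) * \<tau> (inv a) $$ (j, l))"
    by (rule mult_mat_index[OF mult_carrier_mat[OF A(1,3)] A(2) k])
  also have "\<dots> = (\<Sum>j<n. if j = l then \<sigma> a $$ (k, k) * \<tau> (inv a) $$ (l, l) else 0)"
    using 1 by (intro sum.cong) auto
  finally show "(\<sigma> a * unit_mat m n k l * \<tau> (inv a)) $$ (k, l) = \<sigma> a $$ (k, k) * \<tau> (inv a) $$ (l, l)"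
    using k by simp
qed

text \<open>In \<open>char_prod\<close> the inverse group element takes the place of complex
  conjugation, and there is no division by |G|. Each product of traces is thereby a sum of entries
  of averaged unit matrices, which are intertwiners and hence governed by Schur's lemma.\<close>

lemma char_prod_average:
  assumes \<sigma>: "rep_on G m \<sigma>" and \<tau>: "rep_on G n \<tau>"
  shows "char_prod \<tau> \<sigma> = (\<Sum>k<m. \<Sum>l<n. average m n \<sigma> \<tau> (unit_mat m n k l) $$ (k, l))"
proof -
  have "char_prod \<tau> \<sigma> = (\<Sum>a\<in>carrier G. \<Sum>k<m. \<Sum>l<n. \<sigma> a $$ (k, k) * \<tau> (inv a) $$ (l, l))"
    unfolding char_prod_def
  proof (intro sum.cong refl)
    fix a assume a: "a \<in> carrier G"
    then have "dim_row (\<sigma> a) = m" "dim_row (\<tau> (inv a)) = n"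
      using rep_onD(1)[OF \<sigma>] rep_onD(1)[OF \<tau>] by auto
    then show "mat_trace (\<tau> (inv a)) * mat_trace (\<sigma> a) =
        (\<Sum>k<m. \<Sum>l<n. \<sigma> a $$ (k, k) * \<tau> (inv a) $$ (l, l))"
      by (simp add: mat_trace_def sum_product) (subst sum.swap, simp add: mult.commute)
  qed
  also have "\<dots> = (\<Sum>k<m. \<Sum>l<n. \<Sum>a\<in>carrier G. \<sigma> a $$ (k, k) * \<tau> (inv a) $$ (l, l))"
    by (subst sum.swap) (simp add: sum.swap[of _ "carrier G"])
  finally show ?thesis using average_unit_mat_index[OF assms] by simp
qed

lemma char_prod_irreducible:
  assumes \<sigma>: "rep_on G m \<sigma>" "irreducible_rep G \<sigma>" and \<tau>: "rep_on G n \<tau>" "irreducible_rep G \<tau>"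
  shows "char_prod \<tau> \<sigma> = (if rep_equiv G \<tau> \<sigma> then ord_G else 0)"
proof (cases "rep_equiv G \<tau> \<sigma>")
  case False
  then have "\<not> rep_equiv G \<sigma> \<tau>" using rep_equiv_sym by blast
  moreover have "intertwiner \<sigma> \<tau> (average m n \<sigma> \<tau> (unit_mat m n k l))" for k l
    by (rule average_intertwiner[OF \<sigma>(1) \<tau>(1)]) (simp add: unit_mat_def)
  moreover have "average m n \<sigma> \<tau> (unit_mat m n k l) \<in> carrier_mat m n" for k l
    by (simp add: average_def)
  ultimately have "average m n \<sigma> \<tau> (unit_mat m n k l) = 0\<^sub>m m n" for k l
    using Schur_dichotomy[OF \<sigma> \<tau>] by blast
  then show ?thesis using False by (simp add: char_prod_average[OF \<sigma>(1) \<tau>(1)])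
next
  case True
  have m: "m > 0"
    using \<sigma> rep_on_representation(2)[OF \<sigma>(1)] by (simp add: irreducible_rep_def)
  \<comment> \<open>The average is a scalar matrix c, and c is found from the trace: conjugation
    preserves the trace of the unit matrix, so m c is |G| for k = l and 0 otherwise.\<close>
  have diag: "average m m \<sigma> \<sigma> (unit_mat m m k l) $$ (k, l) = (if k = l then ord_G / of_nat m else 0)"
    if kl: "k < m" "l < m" for k l
  proof -
    let ?E = "unit_mat m m k l"
    let ?T = "average m m \<sigma> \<sigma> ?E"
    have E: "?E \<in> carrier_mat m m" by (simp add: unit_mat_def)
    obtain c where c: "?T = c \<cdot>\<^sub>m 1\<^sub>m m"
      using Schur_scalar[OF \<sigma> _ average_intertwiner[OF \<sigma>(1) \<sigma>(1) E]] by (auto simp: average_def)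
    have "mat_trace ?T = (\<Sum>a\<in>carrier G. mat_trace (\<sigma> a * ?E * \<sigma> (inv a)))"
    proof -
      have "mat_trace ?T = (\<Sum>i<m. \<Sum>a\<in>carrier G. (\<sigma> a * ?E * \<sigma> (inv a)) $$ (i, i))"
        by (simp add: mat_trace_def average_def mat_sum_def)
      also have "\<dots> = (\<Sum>a\<in>carrier G. \<Sum>i<m. (\<sigma> a * ?E * \<sigma> (inv a)) $$ (i, i))"
        by (rule sum.swap)
      also have "\<dots> = (\<Sum>a\<in>carrier G. mat_trace (\<sigma> a * ?E * \<sigma> (inv a)))"
        unfolding mat_trace_def using rep_onD(1)[OF \<sigma>(1)] by (intro sum.cong) auto
      finally show ?thesis .
    qed
    also have "\<dots> = (\<Sum>a\<in>carrier G. mat_trace ?E)"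
    proof (intro sum.cong refl)
      fix a assume a: "a \<in> carrier G"
      have A: "\<sigma> a \<in> carrier_mat m m" "\<sigma> (inv a) \<in> carrier_mat m m" using rep_onD(1)[OF \<sigma>(1)] a by auto
      show "mat_trace (\<sigma> a * ?E * \<sigma> (inv a)) = mat_trace ?E"
        by (rule mat_trace_similar, rule similar_mat_witI[of "\<sigma> a" "\<sigma> (inv a)" m])
          (use A E rep_onD(4,5)[OF \<sigma>(1) a] in auto)
    qed
    also have "mat_trace ?E = (\<Sum>i<m. if i = k then (if k = l then 1 else 0) else 0)"
      unfolding mat_trace_def by (intro sum.cong) (auto simp: unit_mat_def)
    also have "\<dots> = (if k = l then 1 else 0)" using kl by simp
    finally have "mat_trace ?T = (if k = l then ord_G else 0)" by simp
    moreover have "mat_trace ?T = of_nat m * c"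
      unfolding c by (simp add: mat_trace_def)
    ultimately have "c = (if k = l then ord_G / of_nat m else 0)"
      using m by (auto simp: field_simps)
    then show ?thesis unfolding c using kl by simp
  qed
  have "char_prod \<tau> \<sigma> = char_prod \<sigma> \<sigma>"
    unfolding char_prod_def using rep_equiv_trace[OF True] by (intro sum.cong) auto
  also have "\<dots> = (\<Sum>k<m. \<Sum>l<m. if k = l then ord_G / of_nat m else 0)"
    unfolding char_prod_average[OF \<sigma>(1) \<sigma>(1)] using diag by simp
  also have "\<dots> = ord_G" using m by simp
  finally show ?thesis using True by simp
qed

end

section \<open>Complete reducibility and multiplicities\<close>

lemma four_block_mat_inject:
  assumes "four_block_mat A B C D = four_block_mat A' B' C' D'"
    and "A \<in> carrier_mat r c" "B \<in> carrier_mat r d" "C \<in> carrier_mat s c" "D \<in> carrier_mat s d"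
    and "A' \<in> carrier_mat r c" "B' \<in> carrier_mat r d" "C' \<in> carrier_mat s c" "D' \<in> carrier_mat s d"
  shows "A = A'" "B = B'" "D = D'"
proof -
  have eq: "four_block_mat A B C D $$ (i, j) = four_block_mat A' B' C' D' $$ (i, j)" for i j
    using assms(1) by simp
  show "A = A'"
  proof (rule eq_matI)
    fix i j assume "i < dim_row A'" "j < dim_col A'"
    then show "A $$ (i, j) = A' $$ (i, j)" using eq[of i j] assms(2-) by auto
  qed (use assms in auto)
  show "B = B'"
  proof (rule eq_matI)
    fix i j assume "i < dim_row B'" "j < dim_col B'"
    then show "B $$ (i, j) = B' $$ (i, j)" using eq[of i "j + c"] assms(2-) by auto
  qed (use assms in auto)
  show "D = D'"
  proof (rule eq_matI)
    fix i j assume "i < dim_row D'" "j < dim_col D'"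
    then show "D $$ (i, j) = D' $$ (i, j)" using eq[of "i + r" "j + c"] assms(2-) by auto
  qed (use assms in auto)
qed

lemma one_mat_four_block: "1\<^sub>m (r + s) = four_block_mat (1\<^sub>m r) (0\<^sub>m r s) (0\<^sub>m s r) (1\<^sub>m s)"
  by (intro eq_matI) auto

context finite_group
begin

text \<open>The columns of P are a basis of W followed by an extension to the whole space.
  Invariance of W means that images of the first r basis vectors have no coordinates beyond
  r.\<close>

lemma invariant_subspace_block:
  assumes \<rho>: "rep_on G n \<rho>" and W: "vec_subspace n W"
    and inv: "\<And>a w. a \<in> carrier G \<Longrightarrow> w \<in> W \<Longrightarrow> \<rho> a *\<^sub>v w \<in> W"
    and proper: "W \<noteq> {0\<^sub>v n}" "W \<noteq> carrier_vec n"
  obtains r s P Q where "n = r + s" "r > 0" "s > 0" "P \<in> carrier_mat n n" "Q \<in> carrier_mat n n"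
    "P * Q = 1\<^sub>m n" "Q * P = 1\<^sub>m n"
    "\<And>a i j. a \<in> carrier G \<Longrightarrow> r \<le> i \<Longrightarrow> i < n \<Longrightarrow> j < r \<Longrightarrow> (Q * \<rho> a * P) $$ (i, j) = 0"
proof -
  have empty: "(0\<^sub>m n 0 :: complex mat) \<in> carrier_mat n 0" "inj_mat (0\<^sub>m n 0 :: complex mat)"
    by (auto simp: inj_mat_def)
  have "\<exists>k\<ge>0. \<exists>B\<in>carrier_mat n k. inj_mat B \<and> (\<forall>i<n. \<forall>j<0. B $$ (i, j) = 0\<^sub>m n 0 $$ (i, j)) \<and>
     (\<lambda>v. B *\<^sub>v v) ` carrier_vec k = W"
  proof (rule inj_mat_extend[OF empty W])
    fix v :: "complex vec" assume "v \<in> carrier_vec 0"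
    then have "0\<^sub>m n 0 *\<^sub>v v = 0\<^sub>v n" by (intro eq_vecI) (auto simp: scalar_prod_def)
    then show "0\<^sub>m n 0 *\<^sub>v v \<in> W" using W by (simp add: vec_subspace_def)
  qed
  then obtain r A where A: "A \<in> carrier_mat n r" "inj_mat A" "(\<lambda>v. A *\<^sub>v v) ` carrier_vec r = W"
    by blast
  have full: "vec_subspace n (carrier_vec n :: complex vec set)"
    by (auto simp: vec_subspace_def)
  have "\<exists>k\<ge>r. \<exists>B\<in>carrier_mat n k. inj_mat B \<and> (\<forall>i<n. \<forall>j<r. B $$ (i, j) = A $$ (i, j)) \<and>
     (\<lambda>v. B *\<^sub>v v) ` carrier_vec k = carrier_vec n"
    using A by (intro inj_mat_extend[OF A(1,2) full]) auto
  then obtain k P where P: "k \<ge> r" "P \<in> carrier_mat n k" "inj_mat P"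
    "\<And>i j. i < n \<Longrightarrow> j < r \<Longrightarrow> P $$ (i, j) = A $$ (i, j)" "(\<lambda>v. P *\<^sub>v v) ` carrier_vec k = carrier_vec n"
    by blast
  have "\<And>w. w \<in> carrier_vec n \<Longrightarrow> \<exists>v\<in>carrier_vec k. P *\<^sub>v v = w" using P(5) by (metis imageE)
  then obtain Q where nk: "n = k" and Q: "Q \<in> carrier_mat k n" "P * Q = 1\<^sub>m n" "Q * P = 1\<^sub>m k"
    using inj_surj_mat_inverse[OF P(2,3)] by metis
  note P = P[folded nk] and Q = Q[folded nk]
  have r0: "r > 0"
  proof (rule ccontr)
    assume "\<not> r > 0"
    then have "carrier_vec r = {0\<^sub>v r :: complex vec}" by auto
    moreover have "A *\<^sub>v 0\<^sub>v r = 0\<^sub>v n" using A(1) by auto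
    ultimately show False using A(3) proper(1) by simp
  qed
  have rn: "r < n"
  proof (rule ccontr)
    assume "\<not> r < n"
    then have "r = n" using P(1) by simp
    then have "A = P" using A(1) P by (intro eq_matI) auto
    then show False using A(3) P(5) proper(2) \<open>r = n\<close> by simp
  qed
  have "(Q * \<rho> a * P) $$ (i, j) = 0" if a: "a \<in> carrier G" and ij: "r \<le> i" "i < n" "j < r" for a i j
  proof -
    note R = rep_onD(1)[OF \<rho> a]
    have j: "j < n" using ij rn by simp
    have "col P j = A *\<^sub>v unit_vec r j"
      using A(1) P ij by (intro eq_vecI) (auto simp: col_def)
    then have "col P j \<in> W" using A(3) by auto
    then have "\<rho> a *\<^sub>v col P j \<in> W" using inv a by blast
    then obtain u where u: "u \<in> carrier_vec r" "\<rho> a *\<^sub>v col P j = A *\<^sub>v u" using A(3) by (metis imageE)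
    \<comment> \<open>Coordinates of the image vector in the full basis, zero beyond W.\<close>
    define u' where "u' = vec n (\<lambda>l. if l < r then u $ l else 0)"
    have u': "u' \<in> carrier_vec n" by (simp add: u'_def)
    have "A *\<^sub>v u = P *\<^sub>v u'"
    proof (rule eq_vecI)
      fix i assume "i < dim_vec (P *\<^sub>v u')"
      then have i: "i < n" using P by simp
      have "(A *\<^sub>v u) $ i = (\<Sum>l<r. P $$ (i, l) * u' $ l)"
        using rn P(4)[OF i] by (simp add: mult_mat_vec_index[OF A(1) u(1) i] u'_def del: index_mult_mat_vec)
      also have "\<dots> = (\<Sum>l<n. P $$ (i, l) * u' $ l)"
        using rn by (intro sum.mono_neutral_left) (auto simp: u'_def)
      finally show "(A *\<^sub>v u) $ i = (P *\<^sub>v u') $ i"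
        by (simp add: mult_mat_vec_index[OF P(2) u' i] del: index_mult_mat_vec)
    qed (use A P in auto)
    then have "Q *\<^sub>v (\<rho> a *\<^sub>v col P j) = u'"
      using u(2) Q P(2) u' by (simp flip: assoc_mult_mat_vec[of _ n n _ n])
    moreover have "(Q * \<rho> a * P) $$ (i, j) = (Q *\<^sub>v (\<rho> a *\<^sub>v col P j)) $ i"
    proof -
      have "(Q * \<rho> a * P) $$ (i, j) = row (Q * \<rho> a) i \<bullet> col P j"
        by (rule index_mult_mat(1)) (use Q R P ij j in auto)
      also have "\<dots> = ((Q * \<rho> a) *\<^sub>v col P j) $ i"
        by (rule index_mult_mat_vec[symmetric]) (use Q R P ij j in auto)
      also have "(Q * \<rho> a) *\<^sub>v col P j = Q *\<^sub>v (\<rho> a *\<^sub>v col P j)"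
        using Q R P by (intro assoc_mult_mat_vec[of _ n n _ n]) auto
      finally show ?thesis .
    qed
    ultimately show ?thesis using ij by (simp add: u'_def)
  qed
  then show ?thesis
    using that[of r "n - r" P Q] r0 rn P Q by auto
qed

text \<open>Conjugating the block diagonal matrix by the unipotent matrix with corner X produces the
  corner X D - A X. So B can be removed as soon as one X solves X D - A X = B for all group elements
  at once.\<close>

lemma block_triangular_complement:
  assumes M: "rep_on G (r + s) M"
    and blocks: "\<And>a. a \<in> carrier G \<Longrightarrow> M a = four_block_mat (A a) (B a) (0\<^sub>m s r) (D a)"
    and dims: "\<And>a. a \<in> carrier G \<Longrightarrow> A a \<in> carrier_mat r r" "\<And>a. a \<in> carrier G \<Longrightarrow> B a \<in> carrier_mat r s"
      "\<And>a. a \<in> carrier G \<Longrightarrow> D a \<in> carrier_mat s s"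
  shows "rep_on G r A" "rep_on G s D"
    "rep_equiv G M (\<lambda>a. four_block_mat (A a) (0\<^sub>m r s) (0\<^sub>m s r) (D a))"
proof -
  have mult: "A (a \<otimes> b) = A a * A b" "B (a \<otimes> b) = A a * B b + B a * D b" "D (a \<otimes> b) = D a * D b"
    if a: "a \<in> carrier G" and b: "b \<in> carrier G" for a b
  proof -
    have "four_block_mat (A (a \<otimes> b)) (B (a \<otimes> b)) (0\<^sub>m s r) (D (a \<otimes> b)) = M a * M b"
      using rep_onD(2)[OF M a b] blocks[of "a \<otimes> b"] a b by simp
    also have "\<dots> = four_block_mat (A a * A b + B a * 0\<^sub>m s r) (A a * B b + B a * D b)
        (0\<^sub>m s r * A b + D a * 0\<^sub>m s r) (0\<^sub>m s r * B b + D a * D b)"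
      unfolding blocks[OF a] blocks[OF b] using dims a b
      by (intro mult_four_block_mat[of _ r r _ s _ s _ _ r _ s]) auto
    finally have eq: "four_block_mat (A (a \<otimes> b)) (B (a \<otimes> b)) (0\<^sub>m s r) (D (a \<otimes> b)) = \<dots>" .
    note inj = four_block_mat_inject[OF eq, of r r s s]
    have c: "A a * A b \<in> carrier_mat r r" "A a * B b \<in> carrier_mat r s" "B a * D b \<in> carrier_mat r s"
      "D a * D b \<in> carrier_mat s s" "B a * 0\<^sub>m s r = 0\<^sub>m r r" "0\<^sub>m s r * A b = 0\<^sub>m s r"
      "D a * 0\<^sub>m s r = 0\<^sub>m s r" "0\<^sub>m s r * B b = 0\<^sub>m s s"
      using dims[OF a] dims[OF b] by auto
    show "A (a \<otimes> b) = A a * A b" "B (a \<otimes> b) = A a * B b + B a * D b" "D (a \<otimes> b) = D a * D b"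
      using inj dims[OF a] dims[OF b] dims[OF m_closed[OF a b]] c by auto
  qed
  have one: "A \<one> = 1\<^sub>m r" "D \<one> = 1\<^sub>m s"
  proof -
    have eq: "four_block_mat (A \<one>) (B \<one>) (0\<^sub>m s r) (D \<one>) = four_block_mat (1\<^sub>m r) (0\<^sub>m r s) (0\<^sub>m s r) (1\<^sub>m s)"
      using blocks[OF one_closed] unfolding rep_onD(3)[OF M] one_mat_four_block by (rule sym)
    show "A \<one> = 1\<^sub>m r" "D \<one> = 1\<^sub>m s"
      using four_block_mat_inject[OF eq, of r r s s] dims[OF one_closed] by auto
  qed
  show A: "rep_on G r A" and D: "rep_on G s D"
    using mult one dims by (auto simp: rep_on_def)
  txt \<open>\<open>B\<close> is a cocycle, and the average \<open>X\<close> exhibits it as a coboundary.\<close>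
  define X where "X = (1 / ord_G) \<cdot>\<^sub>m mat_sum r s (\<lambda>b. B b * D (inv b)) (carrier G)"
  have X: "X \<in> carrier_mat r s" by (simp add: X_def)
  have BD: "B b * D (inv b) \<in> carrier_mat r s" if "b \<in> carrier G" for b
    by (rule mult_carrier_mat[OF dims(2) dims(3)]) (use that in auto)
  \<comment> \<open>The cocycle rule B(ab) = A(a) B(b) + B(a) D(b), multiplied on the right by the
    inverse of D(b) and summed over b. The term B(a) appears once per group element, which explains
    the factor 1/|G| in X.\<close>
  have AX: "A a * X = X * D a - B a" if a: "a \<in> carrier G" for a
  proof -
    let ?S = "mat_sum r s (\<lambda>b. B b * D (inv b)) (carrier G)"
    let ?F = "\<lambda>b. B (a \<otimes> b) * D (inv (a \<otimes> b)) * D a"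
    have "A a * ?S = mat_sum r s (\<lambda>b. A a * (B b * D (inv b))) (carrier G)"
      using dims a BD by (intro mult_mat_sum[of _ r r]) auto
    also have "\<dots> = mat_sum r s (\<lambda>b. ?F b - B a) (carrier G)"
    proof (rule mat_sum_cong)
      fix b assume b: "b \<in> carrier G"
      have c: "A a \<in> carrier_mat r r" "B b \<in> carrier_mat r s" "D (inv b) \<in> carrier_mat s s"
        "B a \<in> carrier_mat r s" "D b \<in> carrier_mat s s" "B (a \<otimes> b) \<in> carrier_mat r s"
        "D (inv (a \<otimes> b)) \<in> carrier_mat s s" "D a \<in> carrier_mat s s"
        using dims a b by auto
      have "D (inv (a \<otimes> b)) * D a = D (inv b)"
        using a b by (subst mult(3)[symmetric]) (auto simp: inv_mult_group m_assoc)
      then have "?F b = B (a \<otimes> b) * D (inv b)"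
        unfolding assoc_mult_mat[OF c(6,7,8)] by simp
      also have "\<dots> = (A a * B b) * D (inv b) + (B a * D b) * D (inv b)"
        unfolding mult(2)[OF a b] using c by (intro add_mult_distrib_mat) auto
      also have "(B a * D b) * D (inv b) = B a"
        unfolding assoc_mult_mat[OF c(4,5,3)] rep_onD(4)[OF D b] using c by simp
      also have "(A a * B b) * D (inv b) = A a * (B b * D (inv b))"
        by (rule assoc_mult_mat[OF c(1,2,3)])
      finally show "A a * (B b * D (inv b)) = ?F b - B a"
        using mult_carrier_mat[OF c(1) mult_carrier_mat[OF c(2,3)]] c(4) by (intro eq_matI) auto
    qed
    also have "\<dots> = mat_sum r s ?F (carrier G) - ord_G \<cdot>\<^sub>m B a"
    proof (rule eq_matI)
      fix i j assume "i < dim_row (mat_sum r s ?F (carrier G) - ord_G \<cdot>\<^sub>m B a)"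
        "j < dim_col (mat_sum r s ?F (carrier G) - ord_G \<cdot>\<^sub>m B a)"
      then have ij: "i < r" "j < s" using dims[OF a] by auto
      have "mat_sum r s (\<lambda>b. ?F b - B a) (carrier G) $$ (i, j)
        = (\<Sum>b\<in>carrier G. ?F b $$ (i, j) - B a $$ (i, j))"
        unfolding mat_sum_index[OF ij] using ij dims[OF a] by (intro sum.cong) auto
      then show "mat_sum r s (\<lambda>b. ?F b - B a) (carrier G) $$ (i, j)
        = (mat_sum r s ?F (carrier G) - ord_G \<cdot>\<^sub>m B a) $$ (i, j)"
        using ij dims[OF a] by (simp add: mat_sum_index sum_subtractf del: index_mult_mat)
    qed (use dims[OF a] in \<open>auto simp: mat_sum_def\<close>)
    also have "mat_sum r s ?F (carrier G) =
        mat_sum r s (\<lambda>b. B b * D (inv b) * D a) (carrier G)"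
      by (rule mat_sum_reindex[OF bij_betw_mult_left[OF a], symmetric])
    also have "\<dots> = ?S * D a"
      using dims a BD by (intro mat_sum_mult[symmetric]) auto
    finally have "A a * ?S = ?S * D a - ord_G \<cdot>\<^sub>m B a" .
    then have "(1 / ord_G) \<cdot>\<^sub>m (A a * ?S) = (1 / ord_G) \<cdot>\<^sub>m (?S * D a - ord_G \<cdot>\<^sub>m B a)" by simp
    also have "\<dots> = (1 / ord_G) \<cdot>\<^sub>m (?S * D a) - B a"
      using ord_G_nonzero dims[OF a] by (intro eq_matI) (auto simp: algebra_simps mat_sum_def simp del: index_mult_mat(1))
    finally show ?thesis
      unfolding X_def mult_smult_distrib[OF dims(1)[OF a] mat_sum_carrier]
        mult_smult_assoc_mat[OF mat_sum_carrier dims(3)[OF a]] .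
  qed
  let ?P = "four_block_mat (1\<^sub>m r) X (0\<^sub>m s r) (1\<^sub>m s)"
  let ?Q = "four_block_mat (1\<^sub>m r) (- X) (0\<^sub>m s r) (1\<^sub>m s)"
  have "- 0\<^sub>m s s = (0\<^sub>m s s :: complex mat)" by (intro eq_matI) auto
  then have PQ1: "?P * ?Q = 1\<^sub>m (r + s)"
    by (subst mult_four_block_mat[of _ r r _ s _ s _ _ r _ s])
      (use X in \<open>auto simp: minus_r_inv_mat uminus_l_inv_mat\<close>)
  note PQ = PQ1 mat_mult_left_right_inverse[OF _ _ PQ1]
  have "similar_mat_wit (M a) (four_block_mat (A a) (0\<^sub>m r s) (0\<^sub>m s r) (D a)) ?P ?Q"
    if a: "a \<in> carrier G" for a
  proof (rule similar_mat_witI[OF PQ(1) PQ(2)])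
    note d = dims[OF a]
    have XD: "X * D a \<in> carrier_mat r s" "A a * X \<in> carrier_mat r s" using X d by auto
    have "?P * four_block_mat (A a) (0\<^sub>m r s) (0\<^sub>m s r) (D a) = four_block_mat (A a) (X * D a) (0\<^sub>m s r) (D a)"
      by (subst mult_four_block_mat[of _ r r _ s _ s _ _ r _ s]) (use X d XD in auto)
    also have "\<dots> * ?Q = four_block_mat (A a) (A a * (- X) + X * D a) (0\<^sub>m s r) (D a)"
      by (subst mult_four_block_mat[of _ r r _ s _ s _ _ r _ s]) (use X d XD in auto)
    also have "A a * (- X) + X * D a = B a"
    proof -
      have "A a * (- X) = - (A a * X)" using d X by simp
      also have "\<dots> = - (X * D a - B a)" using AX[OF a] by simp
      finally have eq: "A a * (- X) = - (X * D a - B a)" .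
      have "- (Y - Z) + Y = Z" if "Y \<in> carrier_mat r s" "Z \<in> carrier_mat r s" for Y Z :: "complex mat"
        using that by (intro eq_matI) auto
      from this[OF XD(1) d(2)] show ?thesis unfolding eq .
    qed
    finally show "M a = ?P * four_block_mat (A a) (0\<^sub>m r s) (0\<^sub>m s r) (D a) * ?Q"
      unfolding blocks[OF a] by (rule sym)
  qed (use rep_onD(1)[OF M a] dims[OF a] X in auto)
  then show "rep_equiv G M (\<lambda>a. four_block_mat (A a) (0\<^sub>m r s) (0\<^sub>m s r) (D a))"
    unfolding rep_equiv_def by blast
qed

lemma rep_on_conj:
  assumes \<rho>: "rep_on G n \<rho>" and P: "P \<in> carrier_mat n n" and Q: "Q \<in> carrier_mat n n"
    and PQ: "P * Q = 1\<^sub>m n" and QP: "Q * P = 1\<^sub>m n"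
  shows "rep_on G n (\<lambda>a. Q * \<rho> a * P)" "rep_equiv G \<rho> (\<lambda>a. Q * \<rho> a * P)"
proof -
  have sim: "similar_mat_wit (Q * \<rho> a * P) (\<rho> a) Q P" if "a \<in> carrier G" for a
    by (rule similar_mat_witI[of _ _ n]) (use P Q PQ QP rep_onD(1)[OF \<rho> that] in auto)
  then show "rep_equiv G \<rho> (\<lambda>a. Q * \<rho> a * P)"
    unfolding rep_equiv_def using similar_mat_wit_sym by blast
  show "rep_on G n (\<lambda>a. Q * \<rho> a * P)"
    unfolding rep_on_def
  proof (intro conjI ballI)
    fix a b assume a: "a \<in> carrier G" and b: "b \<in> carrier G"
    note A = rep_onD(1)[OF \<rho> a] and B = rep_onD(1)[OF \<rho> b]
    have QA: "Q * \<rho> a \<in> carrier_mat n n" and QB: "Q * \<rho> b \<in> carrier_mat n n" using Q A B by auto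
    have "(Q * \<rho> a * P) * (Q * \<rho> b * P) = Q * \<rho> a * (P * (Q * \<rho> b * P))"
      by (rule assoc_mult_mat[OF QA P mult_carrier_mat[OF QB P]])
    also have "P * (Q * \<rho> b * P) = P * Q * \<rho> b * P"
      using assoc_mult_mat[OF P QB P] assoc_mult_mat[OF P Q B] by simp
    also have "\<dots> = \<rho> b * P" using PQ B by simp
    also have "Q * \<rho> a * (\<rho> b * P) = Q * \<rho> (a \<otimes> b) * P"
      unfolding rep_onD(2)[OF \<rho> a b]
      using assoc_mult_mat[OF QA B P] assoc_mult_mat[OF Q A B] by simp
    finally show "Q * \<rho> (a \<otimes> b) * P = (Q * \<rho> a * P) * (Q * \<rho> b * P)" ..
  qed (use P Q QP rep_onD[OF \<rho>] in auto)
qed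

lemma direct_sum_rep_equiv:
  assumes "rep_on G n \<rho>" "rep_on G m \<sigma>"
    and "rep_equiv G \<rho> (direct_sum_rep \<rho>s)" "rep_equiv G \<sigma> (direct_sum_rep \<sigma>s)"
  shows "rep_equiv G (\<lambda>a. four_block_mat (\<rho> a) (0\<^sub>m n m) (0\<^sub>m m n) (\<sigma> a)) (direct_sum_rep (\<rho>s @ \<sigma>s))"
proof -
  obtain P Q where 1: "\<And>a. a \<in> carrier G \<Longrightarrow> similar_mat_wit (\<rho> a) (direct_sum_rep \<rho>s a) P Q"
    using assms(3) by (auto simp: rep_equiv_def)
  obtain R S where 2: "\<And>a. a \<in> carrier G \<Longrightarrow> similar_mat_wit (\<sigma> a) (direct_sum_rep \<sigma>s a) R S"
    using assms(4) by (auto simp: rep_equiv_def)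
  have "similar_mat_wit (four_block_mat (\<rho> a) (0\<^sub>m n m) (0\<^sub>m m n) (\<sigma> a)) (direct_sum_rep (\<rho>s @ \<sigma>s) a)
     (four_block_mat P (0\<^sub>m n m) (0\<^sub>m m n) R) (four_block_mat Q (0\<^sub>m n m) (0\<^sub>m m n) S)"
    if a: "a \<in> carrier G" for a
  proof -
    note A = rep_onD(1)[OF assms(1) a] and B = rep_onD(1)[OF assms(2) a]
    note D1 = similar_mat_witD2[OF A 1[OF a]] and D2 = similar_mat_witD2[OF B 2[OF a]]
    have dim: "dim_row (direct_sum_rep \<rho>s a) = n" "dim_col (direct_sum_rep \<rho>s a) = n"
      "dim_row (direct_sum_rep \<sigma>s a) = m" "dim_col (direct_sum_rep \<sigma>s a) = m"
      using D1(5) D2(5) by auto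
    have "direct_sum_rep (\<rho>s @ \<sigma>s) a =
        four_block_mat (direct_sum_rep \<rho>s a) (0\<^sub>m n m) (0\<^sub>m m n) (direct_sum_rep \<sigma>s a)"
      using dim by (simp add: direct_sum_rep_def diag_block_mat_append Let_def)
    moreover have "similar_mat_wit (four_block_mat (\<rho> a) (0\<^sub>m n m) (0\<^sub>m m n) (\<sigma> a))
        (four_block_mat (direct_sum_rep \<rho>s a) (0\<^sub>m n m) (0\<^sub>m m n) (direct_sum_rep \<sigma>s a))
        (four_block_mat P (0\<^sub>m n m) (0\<^sub>m m n) R) (four_block_mat Q (0\<^sub>m n m) (0\<^sub>m m n) S)"
      by (rule similar_mat_wit_four_block[OF 1[OF a] 2[OF a] _ _ A B]) (use D1 D2 in auto)
    ultimately show ?thesis by simp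
  qed
  then show ?thesis unfolding rep_equiv_def by blast
qed

lemma Maschke:
  assumes "rep_on G n \<rho>"
  shows "\<exists>\<sigma>s. (\<forall>\<sigma>\<in>set \<sigma>s. irreducible_rep G \<sigma>) \<and> rep_equiv G \<rho> (direct_sum_rep \<sigma>s)"
  using assms
proof (induction n arbitrary: \<rho> rule: less_induct)
  case (less n)
  note \<rho> = less.prems
  show ?case
  proof (cases "n = 0 \<or> irreducible_rep G \<rho>")
    case True
    then show ?thesis
    proof
      \<comment> \<open>Irreducible representations have positive degree, so degree 0 is the empty
        direct sum.\<close>
      assume n: "n = 0"
      have "similar_mat_wit (\<rho> a) (direct_sum_rep [] a) (1\<^sub>m 0) (1\<^sub>m 0)" if "a \<in> carrier G" for a
        using rep_onD(1)[OF \<rho> that] n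
        by (intro similar_mat_witI[of _ _ 0]) (auto simp: direct_sum_rep_def intro!: eq_matI)
      then have "rep_equiv G \<rho> (direct_sum_rep [])" unfolding rep_equiv_def by blast
      then show ?thesis by (intro exI[of _ "[]"]) simp
    next
      assume "irreducible_rep G \<rho>"
      moreover have "direct_sum_rep [\<rho>] = \<rho>"
        by (intro ext) (simp add: direct_sum_rep_def del: diag_block_mat.simps)
      ultimately show ?thesis using rep_on_equiv_refl[OF \<rho>] by (intro exI[of _ "[\<rho>]"]) simp
    qed
  next
    case False
    then obtain W where W: "vec_subspace n W" "W \<noteq> {0\<^sub>v n}" "W \<noteq> carrier_vec n"
      and inv: "\<And>a w. a \<in> carrier G \<Longrightarrow> w \<in> W \<Longrightarrow> \<rho> a *\<^sub>v w \<in> W"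
      using rep_on_representation[OF \<rho>] unfolding irreducible_rep_def by (auto simp: vec_subspace_iff)
    obtain r s P Q where rs: "n = r + s" "r > 0" "s > 0"
      and PQ: "P \<in> carrier_mat n n" "Q \<in> carrier_mat n n" "P * Q = 1\<^sub>m n" "Q * P = 1\<^sub>m n"
      and zero: "\<And>a i j. a \<in> carrier G \<Longrightarrow> r \<le> i \<Longrightarrow> i < n \<Longrightarrow> j < r \<Longrightarrow> (Q * \<rho> a * P) $$ (i, j) = 0"
      using invariant_subspace_block[OF \<rho> W(1) inv W(2,3)] by metis
    define M where "M = (\<lambda>a. Q * \<rho> a * P)"
    have M: "rep_on G (r + s) M" "rep_equiv G \<rho> M"
      using rep_on_conj[OF \<rho> PQ] rs(1) by (simp_all add: M_def)
    define A where "A a = mat r r (\<lambda>(i, j). M a $$ (i, j))" for a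
    define B where "B a = mat r s (\<lambda>(i, j). M a $$ (i, j + r))" for a
    define D where "D a = mat s s (\<lambda>(i, j). M a $$ (i + r, j + r))" for a
    have dims: "A a \<in> carrier_mat r r" "B a \<in> carrier_mat r s" "D a \<in> carrier_mat s s" for a
      by (auto simp: A_def B_def D_def)
    have "M a = four_block_mat (A a) (B a) (0\<^sub>m s r) (D a)" if a: "a \<in> carrier G" for a
    proof (rule eq_matI)
      fix i j assume "i < dim_row (four_block_mat (A a) (B a) (0\<^sub>m s r) (D a))"
        "j < dim_col (four_block_mat (A a) (B a) (0\<^sub>m s r) (D a))"
      then show "M a $$ (i, j) = four_block_mat (A a) (B a) (0\<^sub>m s r) (D a) $$ (i, j)"
        using zero[OF a, of i j] rs(1) by (auto simp: A_def B_def D_def M_def simp del: index_mult_mat(1))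
    qed (use rep_onD(1)[OF M(1) a] dims[of a] in auto)
    note AD = block_triangular_complement[OF M(1) this dims]
    obtain \<sigma>s where \<sigma>s: "\<forall>\<sigma>\<in>set \<sigma>s. irreducible_rep G \<sigma>" "rep_equiv G A (direct_sum_rep \<sigma>s)"
      using less.IH[OF _ AD(1)] rs by auto
    obtain \<tau>s where \<tau>s: "\<forall>\<sigma>\<in>set \<tau>s. irreducible_rep G \<sigma>" "rep_equiv G D (direct_sum_rep \<tau>s)"
      using less.IH[OF _ AD(2)] rs by auto
    have "rep_equiv G \<rho> (direct_sum_rep (\<sigma>s @ \<tau>s))"
      using rep_equiv_trans[OF M(2) rep_equiv_trans[OF AD(3) direct_sum_rep_equiv[OF AD(1,2) \<sigma>s(2) \<tau>s(2)]]] .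
    then show ?thesis using \<sigma>s(1) \<tau>s(1) by (intro exI[of _ "\<sigma>s @ \<tau>s"]) auto
  qed
qed

section \<open>Counting constituents by characters\<close>

lemma char_prod_direct_sum:
  assumes \<sigma>s: "\<forall>\<sigma>\<in>set \<sigma>s. irreducible_rep G \<sigma>" and equiv: "rep_equiv G \<rho> (direct_sum_rep \<sigma>s)"
  shows "char_prod \<tau> \<rho> = (\<Sum>\<sigma>\<leftarrow>\<sigma>s. char_prod \<tau> \<sigma>)"
proof -
  have "mat_trace (\<rho> a) = (\<Sum>\<sigma>\<leftarrow>\<sigma>s. mat_trace (\<sigma> a))" if a: "a \<in> carrier G" for a
  proof -
    have "square_mat (\<sigma> a)" if "\<sigma> \<in> set \<sigma>s" for \<sigma>
      using \<sigma>s that rep_onD(1)[OF representation_rep_on a] by (fastforce simp: irreducible_rep_def)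
    then show ?thesis
      using rep_equiv_trace[OF equiv a]
      by (simp add: direct_sum_rep_def) (subst mat_trace_diag_block, auto simp: comp_def)
  qed
  then have "char_prod \<tau> \<rho> = (\<Sum>a\<in>carrier G. \<Sum>\<sigma>\<leftarrow>\<sigma>s. mat_trace (\<tau> (inv a)) * mat_trace (\<sigma> a))"
    by (simp add: char_prod_def sum_list_const_mult)
  also have "\<dots> = (\<Sum>\<sigma>\<leftarrow>\<sigma>s. char_prod \<tau> \<sigma>)"
    by (induction \<sigma>s) (auto simp: char_prod_def sum.distrib)
  finally show ?thesis .
qed

lemma char_prod_count:
  assumes \<tau>: "irreducible_rep G \<tau>" and \<sigma>s: "\<forall>\<sigma>\<in>set \<sigma>s. irreducible_rep G \<sigma>"
    and equiv: "rep_equiv G \<rho> (direct_sum_rep \<sigma>s)"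
  shows "char_prod \<tau> \<rho> = ord_G * of_nat (length (filter (rep_equiv G \<tau>) \<sigma>s))"
proof -
  have rep: "rep_on G (rep_degree G \<sigma>) \<sigma>" if "irreducible_rep G \<sigma>" for \<sigma>
    using that representation_rep_on by (auto simp: irreducible_rep_def)
  have "(\<Sum>\<sigma>\<leftarrow>\<sigma>s. char_prod \<tau> \<sigma>) = ord_G * of_nat (length (filter (rep_equiv G \<tau>) \<sigma>s))"
    using \<sigma>s
    by (induction \<sigma>s) (auto simp: char_prod_irreducible[OF rep _ rep \<tau>] \<tau> algebra_simps)
  then show ?thesis using char_prod_direct_sum[OF \<sigma>s equiv] by simp
qed

text \<open>The second assumption encodes irreducibility. Decompose \<tau> into a list of
  irreducibles and let c \<sigma> count the members equivalent to \<sigma>; the assumption says that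
  the c \<sigma> add up to 1 over the list, and each is at least 1, so the list has a single member.
  Counting members equivalent to \<tau> in a decomposition of \<rho> is then a case of
  \<open>char_prod_count\<close>.\<close>

theorem multiplicity_rep_char_prod:
  assumes \<tau>: "representation G \<tau>" "char_prod \<tau> \<tau> = ord_G" and \<rho>: "representation G \<rho>"
  shows "ord_G * of_nat (multiplicity_rep G \<tau> \<rho>) = char_prod \<tau> \<rho>"
proof -
  have rep: "rep_on G (rep_degree G \<sigma>) \<sigma>" if "irreducible_rep G \<sigma>" for \<sigma>
    using that representation_rep_on by (auto simp: irreducible_rep_def)
  obtain \<tau>s where \<tau>s: "\<forall>\<sigma>\<in>set \<tau>s. irreducible_rep G \<sigma>" "rep_equiv G \<tau> (direct_sum_rep \<tau>s)"
    using Maschke[OF representation_rep_on[OF \<tau>(1)]] by blast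
  have cong: "char_prod \<tau> \<phi> = (\<Sum>\<sigma>\<leftarrow>\<tau>s. char_prod \<sigma> \<phi>)" for \<phi>
  proof -
    \<comment> \<open>Inverting the summation variable exchanges the arguments, so additivity holds
      in the first argument too.\<close>
    have swap: "char_prod \<sigma> \<phi> = char_prod \<phi> \<sigma>" for \<sigma> \<phi>
      unfolding char_prod_def
      by (rule sum.reindex_bij_witness[of _ "\<lambda>a. inv a" "\<lambda>a. inv a"]) (auto simp: mult.commute)
    show ?thesis unfolding swap[of _ \<phi>] by (rule char_prod_direct_sum[OF \<tau>s])
  qed
  define c where "c \<sigma> = length (filter (rep_equiv G \<sigma>) \<tau>s)" for \<sigma>
  have pos: "c \<sigma> \<ge> 1" if "\<sigma> \<in> set \<tau>s" for \<sigma>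
  proof -
    have "\<sigma> \<in> set (filter (rep_equiv G \<sigma>) \<tau>s)"
      using that rep_on_equiv_refl[OF rep] \<tau>s(1) by auto
    then show ?thesis unfolding c_def by (metis One_nat_def Suc_leI length_pos_if_in_set)
  qed
  have "ord_G = (\<Sum>\<sigma>\<leftarrow>\<tau>s. ord_G * of_nat (c \<sigma>))"
  proof -
    have "(\<Sum>\<sigma>\<leftarrow>\<tau>s. char_prod \<sigma> \<tau>) = (\<Sum>\<sigma>\<leftarrow>\<tau>s. ord_G * of_nat (c \<sigma>))"
      using \<tau>s(1) char_prod_count[OF _ \<tau>s] by (intro arg_cong[of _ _ sum_list] map_cong) (auto simp: c_def)
    then show ?thesis using cong[of \<tau>] \<tau>(2) by simp
  qed
  also have "\<dots> = ord_G * of_nat (\<Sum>\<sigma>\<leftarrow>\<tau>s. c \<sigma>)"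
    by (induction \<tau>s) (auto simp: algebra_simps)
  finally have "of_nat (\<Sum>\<sigma>\<leftarrow>\<tau>s. c \<sigma>) = (1 :: complex)" using ord_G_nonzero by simp
  then have one: "(\<Sum>\<sigma>\<leftarrow>\<tau>s. c \<sigma>) = 1" by (simp only: of_nat_eq_1_iff)
  have "length \<tau>s \<le> (\<Sum>\<sigma>\<leftarrow>\<tau>s. c \<sigma>)"
    using sum_list_mono[of \<tau>s "\<lambda>_. 1" c] pos by (simp add: sum_list_triv)
  moreover have "\<tau>s \<noteq> []" using one by auto
  ultimately obtain \<tau>' where \<tau>': "\<tau>s = [\<tau>']" using one by (cases \<tau>s) (auto simp: le_Suc_eq)
  have irr: "irreducible_rep G \<tau>'" using \<tau>s(1) \<tau>' by simp
  have "direct_sum_rep [\<tau>'] = \<tau>'"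
    by (intro ext) (simp add: direct_sum_rep_def del: diag_block_mat.simps)
  then have "rep_equiv G \<tau> \<tau>'" using \<tau>s(2) \<tau>' by simp
  then have equiv_iff: "rep_equiv G \<tau> = rep_equiv G \<tau>'"
    using rep_equiv_trans rep_equiv_sym by (intro ext) blast
  obtain \<sigma>s where \<sigma>s: "\<forall>\<sigma>\<in>set \<sigma>s. irreducible_rep G \<sigma>" "rep_equiv G \<rho> (direct_sum_rep \<sigma>s)"
    using Maschke[OF representation_rep_on[OF \<rho>]] by blast
  have count: "char_prod \<tau> \<rho> = ord_G * of_nat (length (filter (rep_equiv G \<tau>) \<sigma>s))"
    if "\<forall>\<sigma>\<in>set \<sigma>s. irreducible_rep G \<sigma>" "rep_equiv G \<rho> (direct_sum_rep \<sigma>s)" for \<sigma>s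
    using char_prod_count[OF irr that] cong[of \<rho>] \<tau>' equiv_iff by simp
  have "multiplicity_rep G \<tau> \<rho> = length (filter (rep_equiv G \<tau>) \<sigma>s)"
    unfolding multiplicity_rep_def
  \<comment> \<open>Any two decompositions give the same count, since both equal
    \<open>char_prod\<close> divided by |G|; thus the definite description denotes.\<close>
  proof (rule the_equality)
    fix m assume "\<exists>\<sigma>s. (\<forall>\<sigma>\<in>set \<sigma>s. irreducible_rep G \<sigma>) \<and> rep_equiv G \<rho> (direct_sum_rep \<sigma>s) \<and>
      m = length (filter (rep_equiv G \<tau>) \<sigma>s)"
    then obtain \<tau>s where "char_prod \<tau> \<rho> = ord_G * of_nat m" using count by metis
    then show "m = length (filter (rep_equiv G \<tau>) \<sigma>s)"
      using count[OF \<sigma>s] ord_G_nonzero by simp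
  qed (use \<sigma>s in blast)
  then show ?thesis using count[OF \<sigma>s] by simp
qed

end

section \<open>Kronecker products\<close>

lemma sum_div_mod:
  fixes f :: "nat \<Rightarrow> nat \<Rightarrow> 'a::comm_monoid_add"
  shows "(\<Sum>i<m * n. f (i div n) (i mod n)) = (\<Sum>i<m. \<Sum>j<n. f i j)"
proof -
  have "(\<Sum>i<m * n. f (i div n) (i mod n)) = (\<Sum>(i, j)\<in>{..<m} \<times> {..<n}. f i j)"
  proof (rule sum.reindex_bij_witness[of _ "\<lambda>(i, j). i * n + j" "\<lambda>i. (i div n, i mod n)"])
    fix b assume "b \<in> {..<m} \<times> {..<n}"
    then obtain i j where b: "b = (i, j)" "i < m" "j < n" by auto
    have "i * n + j < Suc i * n" using b by simp
    also have "\<dots> \<le> m * n" using b by (intro mult_right_mono) auto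
    finally show "(case b of (i, j) \<Rightarrow> i * n + j) \<in> {..<m * n}" using b by simp
  next
    fix a assume "a \<in> {..<m * n}"
    then show "(a div n, a mod n) \<in> {..<m} \<times> {..<n}"
      by (cases "n = 0") (auto simp: less_mult_imp_div_less)
  qed auto
  then show ?thesis by (simp add: sum.cartesian_product)
qed

lemma kronecker_carrier:
  "A \<in> carrier_mat m n \<Longrightarrow> B \<in> carrier_mat k l \<Longrightarrow> kronecker A B \<in> carrier_mat (m * k) (n * l)"
  by (auto simp: kronecker_def)

lemma kronecker_mult:
  assumes "A \<in> carrier_mat m m" "B \<in> carrier_mat n n" "C \<in> carrier_mat m m" "D \<in> carrier_mat n n"
  shows "kronecker A B * kronecker C D = kronecker (A * C) (B * D)"
proof (rule eq_matI)
  fix i j assume "i < dim_row (kronecker (A * C) (B * D))" "j < dim_col (kronecker (A * C) (B * D))"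
  then have ij: "i < m * n" "j < m * n" using assms by (auto simp: kronecker_def)
  then have n: "n > 0" by (cases n) auto
  have d: "i div n < m" "i mod n < n" "j div n < m" "j mod n < n"
    using ij n by (auto simp: less_mult_imp_div_less)
  have "(kronecker A B * kronecker C D) $$ (i, j) =
     (\<Sum>l<m * n. kronecker A B $$ (i, l) * kronecker C D $$ (l, j))"
    by (rule mult_mat_index[OF kronecker_carrier[OF assms(1,2)] kronecker_carrier[OF assms(3,4)] ij])
  also have "\<dots> = (\<Sum>l<m * n. (A $$ (i div n, l div n) * B $$ (i mod n, l mod n)) *
      (C $$ (l div n, j div n) * D $$ (l mod n, j mod n)))"
    using ij assms by (intro sum.cong) (auto simp: kronecker_def)
  also have "\<dots> = (\<Sum>k<m. \<Sum>l<n. (A $$ (i div n, k) * B $$ (i mod n, l)) * (C $$ (k, j div n) * D $$ (l, j mod n)))"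
    by (rule sum_div_mod)
  also have "\<dots> = (\<Sum>k<m. A $$ (i div n, k) * C $$ (k, j div n)) * (\<Sum>l<n. B $$ (i mod n, l) * D $$ (l, j mod n))"
    by (simp add: sum_product algebra_simps)
  also have "\<dots> = (A * C) $$ (i div n, j div n) * (B * D) $$ (i mod n, j mod n)"
    unfolding mult_mat_index[OF assms(1,3) d(1,3)] mult_mat_index[OF assms(2,4) d(2,4)] ..
  also have "\<dots> = kronecker (A * C) (B * D) $$ (i, j)"
    using ij assms by (simp add: kronecker_def del: index_mult_mat(1))
  finally show "(kronecker A B * kronecker C D) $$ (i, j) = kronecker (A * C) (B * D) $$ (i, j)" .
qed (use assms in \<open>auto simp: kronecker_def\<close>)

lemma kronecker_one: "kronecker (1\<^sub>m m) (1\<^sub>m n) = 1\<^sub>m (m * n)"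
proof (rule eq_matI)
  fix i j assume "i < dim_row (1\<^sub>m (m * n) :: complex mat)" "j < dim_col (1\<^sub>m (m * n) :: complex mat)"
  then have ij: "i < m * n" "j < m * n" by auto
  then have n: "n > 0" by (cases n) auto
  have "i div n = j div n \<and> i mod n = j mod n \<longleftrightarrow> i = j" by (metis div_mult_mod_eq)
  then show "kronecker (1\<^sub>m m) (1\<^sub>m n) $$ (i, j) = 1\<^sub>m (m * n) $$ (i, j)"
    using ij n by (auto simp: kronecker_def less_mult_imp_div_less)
qed (auto simp: kronecker_def)

lemma mat_trace_kronecker:
  assumes "A \<in> carrier_mat m m" "B \<in> carrier_mat n n"
  shows "mat_trace (kronecker A B) = mat_trace A * mat_trace B"
proof -
  have "mat_trace (kronecker A B) = (\<Sum>i<m * n. A $$ (i div n, i div n) * B $$ (i mod n, i mod n))"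
    using assms by (auto simp: mat_trace_def kronecker_def intro!: sum.cong)
  also have "\<dots> = (\<Sum>i<m. \<Sum>j<n. A $$ (i, i) * B $$ (j, j))" by (rule sum_div_mod)
  finally show ?thesis using assms by (simp add: mat_trace_def sum_product)
qed

lemma (in group) tensor_rep_on:
  assumes "rep_on G m \<rho>" "rep_on G n \<sigma>"
  shows "rep_on G (m * n) (tensor_rep \<rho> \<sigma>)"
  using assms unfolding rep_on_def tensor_rep_def
  by (auto simp: kronecker_carrier kronecker_one kronecker_mult[of _ m _ n])

section \<open>Pairings and the exponential group\<close>

lemma nontrivial_additive_character_0: "nontrivial_additive_character \<psi> \<Longrightarrow> \<psi> 0 = 1"
  unfolding nontrivial_additive_character_def by (metis add.right_neutral mult_cancel_left1)

lemma nontrivial_additive_character_add: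
  "nontrivial_additive_character \<psi> \<Longrightarrow> \<psi> (x + y) = \<psi> x * \<psi> y"
  unfolding nontrivial_additive_character_def by blast

text \<open>A finite set with addition and scaling on which linear forms make sense; this covers
  both subspaces of matrices and subspaces of the dual, whose additions are different.\<close>

locale linear_set =
  fixes vadd :: "'v \<Rightarrow> 'v \<Rightarrow> 'v" and vscale :: "'k::field \<Rightarrow> 'v \<Rightarrow> 'v" and V :: "'v set"
  assumes finite_V: "finite V"
    and add_closed: "x \<in> V \<Longrightarrow> y \<in> V \<Longrightarrow> vadd x y \<in> V"
    and add_inj: "x \<in> V \<Longrightarrow> inj_on (vadd x) V"
    and scale_closed: "x \<in> V \<Longrightarrow> vscale c x \<in> V"
begin

definition linear_form :: "('v \<Rightarrow> 'k) \<Rightarrow> bool" where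
  "linear_form f \<longleftrightarrow> (\<forall>x\<in>V. \<forall>y\<in>V. f (vadd x y) = f x + f y) \<and> (\<forall>c. \<forall>x\<in>V. f (vscale c x) = c * f x)"

text \<open>Translating the summation variable by a vector y multiplies the sum by \<psi> (f y); if
  that value can be different from 1, the sum is zero.\<close>

lemma character_sum:
  assumes \<psi>: "nontrivial_additive_character \<psi>" and f: "linear_form f"
  shows "(\<Sum>x\<in>V. \<psi> (f x)) = (if \<forall>x\<in>V. f x = 0 then of_nat (card V) else 0)"
proof (cases "\<forall>x\<in>V. f x = 0")
  case True
  then show ?thesis using nontrivial_additive_character_0[OF \<psi>] by simp
next
  case False
  then obtain x where x: "x \<in> V" "f x \<noteq> 0" by blast
  obtain c where c: "\<psi> c \<noteq> 1" using \<psi> by (auto simp: nontrivial_additive_character_def)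
  \<comment> \<open>The value f x may lie in the kernel of \<psi>; rescaling x reaches a prescribed
    value c outside it.\<close>
  define y where "y = vscale (c / f x) x"
  have y: "y \<in> V" "f y = c"
    using x f scale_closed by (auto simp: y_def linear_form_def)
  have "vadd y ` V = V"
    using add_closed[OF y(1)] add_inj[OF y(1)] finite_V
    by (intro card_subset_eq) (auto simp: card_image)
  then have "bij_betw (vadd y) V V" using add_inj[OF y(1)] by (simp add: bij_betw_def)
  then have "(\<Sum>x\<in>V. \<psi> (f x)) = (\<Sum>x\<in>V. \<psi> (f (vadd y x)))"
    by (rule sum.reindex_bij_betw[symmetric])
  also have "\<dots> = (\<Sum>x\<in>V. \<psi> c * \<psi> (f x))"
    using y f nontrivial_additive_character_add[OF \<psi>] by (intro sum.cong) (auto simp: linear_form_def)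
  also have "\<dots> = \<psi> c * (\<Sum>x\<in>V. \<psi> (f x))" by (simp add: sum_distrib_left)
  finally have "(1 - \<psi> c) * (\<Sum>x\<in>V. \<psi> (f x)) = 0" by (simp add: algebra_simps)
  then show ?thesis using c False by auto
qed

end

text \<open>Stands in for the equality of row and column rank, written with cardinalities: the
  quotients of X and Y by the two kernels of the pairing have the same size.\<close>

lemma pairing_card:
  fixes \<psi> :: "'k::field \<Rightarrow> complex" and B :: "'v \<Rightarrow> 'w \<Rightarrow> 'k"
  assumes \<psi>: "nontrivial_additive_character \<psi>"
    and X: "linear_set vadd vscale X" and Y: "linear_set vadd' vscale' Y"
    and B: "\<And>x. x \<in> X \<Longrightarrow> linear_set.linear_form vadd' vscale' Y (B x)"
      "\<And>y. y \<in> Y \<Longrightarrow> linear_set.linear_form vadd vscale X (\<lambda>x. B x y)"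
  shows "card Y * card {x \<in> X. \<forall>y\<in>Y. B x y = 0} = card X * card {y \<in> Y. \<forall>x\<in>X. B x y = 0}"
proof -
  interpret X: linear_set vadd vscale X by (rule X)
  interpret Y: linear_set vadd' vscale' Y by (rule Y)
  have count: "(\<Sum>a\<in>A. if P a then of_nat n else 0) = (of_nat (n * card {a \<in> A. P a}) :: complex)"
    if "finite A" for A :: "'z set" and P n
    using that by (simp add: sum.If_cases Int_def mult.commute)
  have "(of_nat (card Y * card {x \<in> X. \<forall>y\<in>Y. B x y = 0}) :: complex) = (\<Sum>x\<in>X. \<Sum>y\<in>Y. \<psi> (B x y))"
    using Y.character_sum[OF \<psi> B(1)] count[OF X.finite_V] by simp
  also have "\<dots> = (\<Sum>y\<in>Y. \<Sum>x\<in>X. \<psi> (B x y))" by (rule sum.swap)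
  also have "\<dots> = of_nat (card X * card {y \<in> Y. \<forall>x\<in>X. B x y = 0})"
  proof -
    have "(\<Sum>y\<in>Y. \<Sum>x\<in>X. \<psi> (B x y)) = (\<Sum>y\<in>Y. if \<forall>x\<in>X. B x y = 0 then of_nat (card X) else 0)"
      using X.character_sum[OF \<psi> B(2)] by simp
    then show ?thesis using count[OF Y.finite_V] by simp
  qed
  finally show ?thesis by (simp only: of_nat_eq_iff)
qed

lemma bracket_linear:
  fixes x y z :: "'a::field mat"
  assumes "x \<in> carrier_mat n n" "y \<in> carrier_mat n n" "z \<in> carrier_mat n n"
  shows "bracket (x + y) z = bracket x z + bracket y z"
    "bracket z (x + y) = bracket z x + bracket z y"
    "bracket (c \<cdot>\<^sub>m x) z = c \<cdot>\<^sub>m bracket x z" "bracket z (c \<cdot>\<^sub>m x) = c \<cdot>\<^sub>m bracket z x"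
    "bracket x x = 0\<^sub>m n n" "bracket y x = (-1) \<cdot>\<^sub>m bracket x y"
proof -
  note prods = mult_carrier_mat[OF assms(1,3)] mult_carrier_mat[OF assms(2,3)]
    mult_carrier_mat[OF assms(3,1)] mult_carrier_mat[OF assms(3,2)]
    mult_carrier_mat[OF assms(1,2)] mult_carrier_mat[OF assms(2,1)]
  show "bracket (x + y) z = bracket x z + bracket y z"
    "bracket z (x + y) = bracket z x + bracket z y"
    unfolding bracket_def add_mult_distrib_mat[OF assms] mult_add_distrib_mat[OF assms(3,1,2)]
    using prods assms by (intro eq_matI; auto simp del: index_mult_mat(1))+
  show "bracket (c \<cdot>\<^sub>m x) z = c \<cdot>\<^sub>m bracket x z" "bracket z (c \<cdot>\<^sub>m x) = c \<cdot>\<^sub>m bracket z x"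
    unfolding bracket_def mult_smult_assoc_mat[OF assms(1,3)] mult_smult_distrib[OF assms(3,1)]
    using prods assms by (intro eq_matI; auto simp: right_diff_distrib simp del: index_mult_mat(1))+
  show "bracket x x = 0\<^sub>m n n" using assms by (auto simp: bracket_def)
  show "bracket y x = (-1) \<cdot>\<^sub>m bracket x y"
    unfolding bracket_def using prods assms by (intro eq_matI) (auto simp del: index_mult_mat(1))
qed

lemma finite_carrier_mat: "finite (carrier_mat n m :: 'a::finite mat set)"
proof -
  have "A \<in> mat n m ` ({..<n} \<times> {..<m} \<rightarrow>\<^sub>E UNIV)" if "A \<in> carrier_mat n m" for A :: "'a mat"
  proof (rule image_eqI)
    show "A = mat n m (restrict (\<lambda>ij. A $$ ij) ({..<n} \<times> {..<m}))"
      using that by (intro eq_matI) auto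
  qed auto
  then have "(carrier_mat n m :: 'a mat set) \<subseteq> mat n m ` ({..<n} \<times> {..<m} \<rightarrow>\<^sub>E UNIV)" by blast
  moreover have "finite (mat n m ` ({..<n} \<times> {..<m} \<rightarrow>\<^sub>E (UNIV :: 'a set)))"
    by (intro finite_imageI finite_PiE) auto
  ultimately show ?thesis by (rule finite_subset)
qed

lemma linear_set_mat:
  assumes W: "lin_subspace N (W :: 'a::{field,finite} mat set)"
  shows "linear_set (+) (\<cdot>\<^sub>m) W"
proof
  note D = lin_subspaceD[OF W]
  show "finite W" by (rule finite_subset[OF _ finite_carrier_mat]) (use D(1) in auto)
  show "inj_on ((+) x) W" if "x \<in> W" for x
  proof (rule inj_onI)
    fix y z assume yz: "y \<in> W" "z \<in> W" "x + y = x + z"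
    have "y = - x + (x + y)" "z = - x + (x + z)"
      using D(1)[OF that] D(1)[OF yz(1)] D(1)[OF yz(2)] by (auto intro!: eq_matI)
    then show "y = z" using yz by simp
  qed
qed (use lin_subspaceD[OF W] in auto)

section \<open>The group exp \<gg> and its adjoint action\<close>

locale kirillov =
  fixes N :: nat and \<gg> :: "'k::{field, finite} mat set" and \<psi> :: "'k \<Rightarrow> complex"
  assumes N_ge_1: "N \<ge> 1" and char_ge: "CHAR('k) \<ge> N"
    and lie: "lie_subalgebra N \<gg>" and \<psi>: "nontrivial_additive_character \<psi>"
begin

sublocale strict_upper N "TYPE('k)"
proof
  fix k assume k: "k < N"
  have "prime CHAR('k)" by (intro prime_CHAR_semidom finite_imp_CHAR_pos) simp
  then have "\<not> CHAR('k) dvd fact k" using k char_ge by (simp add: prime_dvd_fact_iff)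
  then show "of_nat (fact k) \<noteq> (0 :: 'k)" by (simp only: of_nat_eq_0_iff_char_dvd not_False_eq_True)
qed (use N_ge_1 in auto)

abbreviation "G \<equiv> exp_group N \<gg>"
abbreviation "ex \<equiv> mat_exp N"

lemma g_subspace: "lin_subspace N \<gg>" and g_ut: "x \<in> \<gg> \<Longrightarrow> x \<in> ut N"
  and g_bracket: "x \<in> \<gg> \<Longrightarrow> y \<in> \<gg> \<Longrightarrow> bracket x y \<in> \<gg>"
  using lie by (auto simp: lie_subalgebra_def)

lemma g_carrier: "x \<in> \<gg> \<Longrightarrow> x \<in> carrier_mat N N"
  using g_ut utD(1) by blast

lemmas g_closed = lin_subspaceD(2-6)[OF g_subspace]

sublocale gV: linear_set "(+)" "(\<cdot>\<^sub>m)" \<gg>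
  by (rule linear_set_mat[OF g_subspace])

lemma ex_carrier [simp]: "ex x \<in> carrier_mat N N"
  by (simp add: mat_exp_def)

lemma ex_0: "ex (0\<^sub>m N N :: 'k mat) = 1\<^sub>m N"
proof -
  have "lift_mat N (0\<^sub>m N N) = (0 :: 'k utm)"
    by (rule lift_linear(5)) auto
  then show ?thesis using g_ut[OF g_closed(1)]
    by (simp add: mat_exp_eq K.E_0 corner_1)
qed

lemma ex_inj: "inj_on ex \<gg>"
  by (rule inj_on_subset[OF mat_exp_inj]) (use g_ut in auto)

lemma carrier_G: "carrier G = ex ` \<gg>" and mult_G: "a \<otimes>\<^bsub>G\<^esub> b = a * b" and one_G: "\<one>\<^bsub>G\<^esub> = 1\<^sub>m N"
  by (auto simp: exp_group_def)

sublocale G: finite_group G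
proof -
  have mult_closed: "a * b \<in> carrier G" if "a \<in> carrier G" "b \<in> carrier G" for a b
  proof -
    from that obtain x y where xy: "x \<in> \<gg>" "y \<in> \<gg>" "a = ex x" "b = ex y" by (auto simp: carrier_G)
    obtain z where "z \<in> \<gg>" "ex x * ex y = ex z" by (rule mat_exp_mult_closed[OF lie xy(1,2)])
    then show ?thesis using xy by (auto simp: carrier_G)
  qed
  have "group G"
  proof (rule groupI)
    fix a assume "a \<in> carrier G"
    then obtain x where x: "x \<in> \<gg>" "a = ex x" by (auto simp: carrier_G)
    then have "ex (- x) \<in> carrier G" using g_closed(4) by (auto simp: carrier_G)
    moreover have "ex (- x) \<otimes>\<^bsub>G\<^esub> a = \<one>\<^bsub>G\<^esub>"
      using mat_exp_minus_mult[OF g_ut[OF x(1)]] x by (simp add: mult_G one_G)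
    ultimately show "\<exists>b\<in>carrier G. b \<otimes>\<^bsub>G\<^esub> a = \<one>\<^bsub>G\<^esub>" by blast
  next
    show "\<one>\<^bsub>G\<^esub> \<in> carrier G"
      unfolding carrier_G one_G using ex_0 g_closed(1) by (metis imageI)
  qed (use mult_closed in \<open>auto simp: mult_G carrier_G one_G assoc_mult_mat[of _ N N _ N _ N] left_mult_one_mat[of _ N N]\<close>)
  then show "finite_group G"
    by (simp add: finite_group_def finite_group_axioms_def carrier_G gV.finite_V)
qed

lemma card_G: "card (carrier G) = card \<gg>"
  by (simp add: carrier_G card_image ex_inj)

lemma inv_G: "x \<in> \<gg> \<Longrightarrow> inv\<^bsub>G\<^esub> (ex x) = ex (- x)"
  using mat_exp_minus_mult[OF g_ut] g_closed(4)
  by (intro G.inv_equality) (auto simp: mult_G one_G carrier_G)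

text \<open>Conjugation by the inverse reverses products, see \<open>Ad_mult\<close>; precomposing
  linear forms with it is therefore a left action.\<close>

definition Ad :: "'k mat \<Rightarrow> 'k mat \<Rightarrow> 'k mat" where
  "Ad a y = inv\<^bsub>G\<^esub> a * y * a"

lemma Ad_ex: "x \<in> \<gg> \<Longrightarrow> Ad (ex x) y = ex (- x) * y * ex x"
  by (simp add: Ad_def inv_G)

lemma G_mat: "a \<in> carrier G \<Longrightarrow> a \<in> carrier_mat N N"
  by (auto simp: carrier_G)

lemma G_inv_mat: "a \<in> carrier G \<Longrightarrow> inv\<^bsub>G\<^esub> a \<in> carrier_mat N N"
  by (rule G_mat) simp

lemma Ad_diff:
  assumes V: "lin_subspace N V" "V \<subseteq> \<gg>" and "x \<in> \<gg>" "y \<in> \<gg>"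
    and "bracket y x \<in> V" "\<And>v. v \<in> V \<Longrightarrow> bracket v x \<in> V"
  shows "Ad (ex x) y - y \<in> V"
  unfolding Ad_ex[OF assms(3)]
  using assms g_ut by (intro mat_exp_conj_diff) auto

lemma Ad_carrier: "a \<in> carrier G \<Longrightarrow> y \<in> carrier_mat N N \<Longrightarrow> Ad a y \<in> carrier_mat N N"
  unfolding Ad_def by (rule mult_carrier_mat[OF mult_carrier_mat[OF G_inv_mat] G_mat])

lemma Ad_mem:
  assumes V: "lin_subspace N V" "V \<subseteq> \<gg>" and "x \<in> \<gg>" "y \<in> V" and "\<And>v. v \<in> V \<Longrightarrow> bracket v x \<in> V"
  shows "Ad (ex x) y \<in> V"
proof -
  have "Ad (ex x) y - y \<in> V"
    using assms by (intro Ad_diff[OF V]) auto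
  then have "Ad (ex x) y - y + y \<in> V" using lin_subspaceD(3)[OF V(1)] assms(4) by blast
  moreover have "Ad (ex x) y - y + y = Ad (ex x) y"
    using Ad_carrier[of "ex x" y] assms(3) lin_subspaceD(1)[OF V(1) assms(4)]
    by (intro eq_matI) (auto simp: carrier_G)
  ultimately show ?thesis by simp
qed

lemma Ad_closed: "a \<in> carrier G \<Longrightarrow> y \<in> \<gg> \<Longrightarrow> Ad a y \<in> \<gg>"
  using Ad_mem[OF g_subspace order_refl] g_bracket by (auto simp: carrier_G)

lemma Ad_linear:
  assumes a: "a \<in> carrier G" and y: "y \<in> carrier_mat N N"
  shows "z \<in> carrier_mat N N \<Longrightarrow> Ad a (y + z) = Ad a y + Ad a z"
    "Ad a (c \<cdot>\<^sub>m y) = c \<cdot>\<^sub>m Ad a y"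
proof -
  note m = G_mat[OF a] G_inv_mat[OF a]
  show "Ad a (y + z) = Ad a y + Ad a z" if z: "z \<in> carrier_mat N N"
    unfolding Ad_def mult_add_distrib_mat[OF m(2) y z]
    by (rule add_mult_distrib_mat[OF mult_carrier_mat[OF m(2) y] mult_carrier_mat[OF m(2) z] m(1)])
  show "Ad a (c \<cdot>\<^sub>m y) = c \<cdot>\<^sub>m Ad a y"
    unfolding Ad_def mult_smult_distrib[OF m(2) y]
    by (rule mult_smult_assoc_mat[OF mult_carrier_mat[OF m(2) y] m(1)])
qed

lemma Ad_mult:
  assumes a: "a \<in> carrier G" and b: "b \<in> carrier G" and y: "y \<in> carrier_mat N N"
  shows "Ad (a \<otimes>\<^bsub>G\<^esub> b) y = Ad b (Ad a y)"
proof -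
  note m = G_mat[OF a] G_inv_mat[OF a] G_mat[OF b] G_inv_mat[OF b]
  have i: "inv\<^bsub>G\<^esub> (a * b) = inv\<^bsub>G\<^esub> b * inv\<^bsub>G\<^esub> a"
    using G.inv_mult_group[OF a b] by (simp add: mult_G)
  have iy: "inv\<^bsub>G\<^esub> a * y \<in> carrier_mat N N" using m(2) y by simp
  have "Ad (a \<otimes>\<^bsub>G\<^esub> b) y = inv\<^bsub>G\<^esub> b * (inv\<^bsub>G\<^esub> a * y) * (a * b)"
    unfolding Ad_def mult_G i assoc_mult_mat[OF m(4,2) y] by (rule refl)
  also have "\<dots> = inv\<^bsub>G\<^esub> b * (inv\<^bsub>G\<^esub> a * y) * a * b"
    by (rule assoc_mult_mat[OF mult_carrier_mat[OF m(4) iy] m(1,3), symmetric])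
  also have "\<dots> = Ad b (Ad a y)"
    unfolding Ad_def assoc_mult_mat[OF m(4) iy m(1)] by (rule refl)
  finally show ?thesis .
qed

lemma Ad_one: "y \<in> carrier_mat N N \<Longrightarrow> Ad \<one>\<^bsub>G\<^esub> y = y"
  unfolding Ad_def G.inv_one by (simp add: one_G)

lemma Ad_inv: "a \<in> carrier G \<Longrightarrow> y \<in> carrier_mat N N \<Longrightarrow> Ad (inv\<^bsub>G\<^esub> a) (Ad a y) = y"
  using Ad_mult[of a "inv\<^bsub>G\<^esub> a" y] Ad_one by simp

lemma conj_ex:
  assumes a: "a \<in> carrier G" and y: "y \<in> \<gg>"
  shows "inv\<^bsub>G\<^esub> a \<otimes>\<^bsub>G\<^esub> ex y \<otimes>\<^bsub>G\<^esub> a = ex (Ad a y)"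
proof -
  obtain x where x: "x \<in> \<gg>" "a = ex x" using a by (auto simp: carrier_G)
  show ?thesis
    using lift_mat_exp_conj(3)[OF g_ut[OF x(1)] g_ut[OF y]] x by (simp add: Ad_ex inv_G mult_G)
qed

end

section \<open>The dual space and coadjoint orbits\<close>

context kirillov
begin

lemma finite_dual: "finite (dual \<gg>)"
proof (rule finite_subset)
  show "dual \<gg> \<subseteq> \<gg> \<rightarrow>\<^sub>E UNIV" by (auto simp: dual_def PiE_def)
  show "finite (\<gg> \<rightarrow>\<^sub>E (UNIV :: 'k set))" by (intro finite_PiE gV.finite_V) simp
qed

lemma dualD:
  assumes "l \<in> dual \<gg>"
  shows "x \<in> \<gg> \<Longrightarrow> y \<in> \<gg> \<Longrightarrow> l (x + y) = l x + l y" "x \<in> \<gg> \<Longrightarrow> l (c \<cdot>\<^sub>m x) = c * l x"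
    "l \<in> extensional \<gg>" "l (0\<^sub>m N N) = 0" "x \<in> \<gg> \<Longrightarrow> l (- x) = - l x"
proof -
  show add: "x \<in> \<gg> \<Longrightarrow> y \<in> \<gg> \<Longrightarrow> l (x + y) = l x + l y" for x y using assms by (simp add: dual_def)
  show sc: "x \<in> \<gg> \<Longrightarrow> l (c \<cdot>\<^sub>m x) = c * l x" for c x using assms by (simp add: dual_def)
  show "l \<in> extensional \<gg>" using assms by (simp add: dual_def)
  have "0 \<cdot>\<^sub>m 0\<^sub>m N N = (0\<^sub>m N N :: 'k mat)" by auto
  then show "l (0\<^sub>m N N) = 0" using sc[OF g_closed(1), of 0] by simp
  have "- x = (-1) \<cdot>\<^sub>m x" by (intro eq_matI) auto
  then show "x \<in> \<gg> \<Longrightarrow> l (- x) = - l x" using sc[of x "-1"] by simp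
qed

lemma dual_eqI: "l \<in> dual \<gg> \<Longrightarrow> m \<in> dual \<gg> \<Longrightarrow> (\<And>x. x \<in> \<gg> \<Longrightarrow> l x = m x) \<Longrightarrow> l = m"
  using dualD(3) by (blast intro: extensionalityI)

lemma dualI:
  "(\<And>x y. x \<in> \<gg> \<Longrightarrow> y \<in> \<gg> \<Longrightarrow> f (x + y) = f x + f y) \<Longrightarrow>
    (\<And>c x. x \<in> \<gg> \<Longrightarrow> f (c \<cdot>\<^sub>m x) = c * f x) \<Longrightarrow> restrict f \<gg> \<in> dual \<gg>"
  using g_closed by (simp add: dual_def)

definition dual_scale :: "'k \<Rightarrow> ('k mat \<Rightarrow> 'k) \<Rightarrow> 'k mat \<Rightarrow> 'k" where
  "dual_scale c l = (\<lambda>x\<in>\<gg>. c * l x)"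

lemma dual_add_mem: "l \<in> dual \<gg> \<Longrightarrow> m \<in> dual \<gg> \<Longrightarrow> dual_add \<gg> l m \<in> dual \<gg>"
  unfolding dual_add_def by (rule dualI) (simp_all add: dualD algebra_simps)

lemma dual_scale_mem: "l \<in> dual \<gg> \<Longrightarrow> dual_scale c l \<in> dual \<gg>"
  unfolding dual_scale_def by (rule dualI) (simp_all add: dualD algebra_simps)

section \<open>Annihilators in the dual space\<close>

definition annihilator :: "'k mat set \<Rightarrow> ('k mat \<Rightarrow> 'k) set" where
  "annihilator W = {l \<in> dual \<gg>. \<forall>x\<in>W. l x = 0}"

lemma dual_add_inj: "l \<in> dual \<gg> \<Longrightarrow> inj_on (dual_add \<gg> l) (dual \<gg>)"
proof (rule inj_onI)
  fix m m' assume l: "l \<in> dual \<gg>" and m: "m \<in> dual \<gg>" "m' \<in> dual \<gg>" "dual_add \<gg> l m = dual_add \<gg> l m'"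
  have "m x = m' x" if "x \<in> \<gg>" for x using fun_cong[OF m(3), of x] that by (simp add: dual_add_def)
  then show "m = m'" using m by (intro dual_eqI)
qed

lemma linear_set_annihilator:
  assumes "W \<subseteq> \<gg>"
  shows "linear_set (dual_add \<gg>) dual_scale (annihilator W)"
proof
  show "finite (annihilator W)" using finite_dual by (simp add: annihilator_def)
  show "inj_on (dual_add \<gg> l) (annihilator W)" if "l \<in> annihilator W" for l
    by (rule inj_on_subset[OF dual_add_inj]) (use that in \<open>auto simp: annihilator_def\<close>)
qed (use assms dual_add_mem dual_scale_mem in \<open>auto simp: annihilator_def dual_add_def dual_scale_def\<close>)

lemma annihilator_empty: "annihilator {} = dual \<gg>"
  by (simp add: annihilator_def)

lemma linear_form_dual:
  assumes "lin_subspace N W" "W \<subseteq> \<gg>" "l \<in> dual \<gg>"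
  shows "linear_set.linear_form (+) (\<cdot>\<^sub>m) W l"
  unfolding linear_set.linear_form_def[OF linear_set_mat[OF assms(1)]]
  using assms(2) dualD(1,2)[OF assms(3)] by (simp add: subset_iff)

lemma linear_form_eval:
  assumes "W \<subseteq> \<gg>" "y \<in> \<gg>"
  shows "linear_set.linear_form (dual_add \<gg>) dual_scale (annihilator W) (\<lambda>l. l y)"
  unfolding linear_set.linear_form_def[OF linear_set_annihilator[OF assms(1)]]
  using assms(2) by (simp add: dual_add_def dual_scale_def)

lemma dual_separates:
  assumes y: "y \<in> \<gg>" and zero: "\<And>l. l \<in> dual \<gg> \<Longrightarrow> l y = 0"
  shows "y = 0\<^sub>m N N"
proof (rule eq_matI)
  fix i j assume "i < dim_row (0\<^sub>m N N :: 'k mat)" "j < dim_col (0\<^sub>m N N :: 'k mat)"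
  then have ij: "i < N" "j < N" by auto
  have "(\<lambda>x\<in>\<gg>. x $$ (i, j)) \<in> dual \<gg>"
    using ij g_carrier by (intro dualI) fastforce+
  then show "y $$ (i, j) = 0\<^sub>m N N $$ (i, j)" using zero y ij by force
qed (use g_carrier[OF y] in auto)

text \<open>One count serves three purposes. With U empty the annihilator is the whole dual, which
  gives the size of the dual for W = \<gg> and the size of annihilators for general W; with W =
  \<gg> and U a subspace it gives the size of the double annihilator.\<close>

lemma pairing_annihilator:
  assumes U: "U \<subseteq> \<gg>" and W: "lin_subspace N W" "W \<subseteq> \<gg>"
  shows "card W * card {l \<in> annihilator U. \<forall>y\<in>W. l y = 0} =
    card (annihilator U) * card {y \<in> W. \<forall>l\<in>annihilator U. l y = 0}"
proof (rule pairing_card[OF \<psi> linear_set_annihilator[OF U] linear_set_mat[OF W(1)], of "\<lambda>l. l"])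
  show "linear_set.linear_form (+) (\<cdot>\<^sub>m) W l" if "l \<in> annihilator U" for l
    using that by (intro linear_form_dual[OF W]) (simp add: annihilator_def)
  show "linear_set.linear_form (dual_add \<gg>) dual_scale (annihilator U) (\<lambda>l. l y)" if "y \<in> W" for y
    using that W(2) by (intro linear_form_eval[OF U]) auto
qed

lemma zero_annihilator: "{l \<in> annihilator U. \<forall>y\<in>\<gg>. l y = 0} = {\<lambda>x\<in>\<gg>. 0}" if "U \<subseteq> \<gg>"
proof -
  have z: "(\<lambda>x\<in>\<gg>. 0) \<in> dual \<gg>" by (rule dualI) auto
  then have mem: "(\<lambda>x\<in>\<gg>. 0) \<in> annihilator U" using that by (auto simp: annihilator_def)
  have eq: "l = (\<lambda>x\<in>\<gg>. 0)" if "l \<in> annihilator U" "\<forall>y\<in>\<gg>. l y = 0" for l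
    by (rule dual_eqI[OF _ z]) (use that in \<open>auto simp: annihilator_def\<close>)
  show ?thesis
  proof (intro equalityI subsetI)
    fix l assume "l \<in> {l \<in> annihilator U. \<forall>y\<in>\<gg>. l y = 0}"
    then show "l \<in> {\<lambda>x\<in>\<gg>. 0}" using eq by blast
  next
    fix l :: "'k mat \<Rightarrow> 'k" assume "l \<in> {\<lambda>x\<in>\<gg>. 0}"
    then show "l \<in> {l \<in> annihilator U. \<forall>y\<in>\<gg>. l y = 0}" using mem by simp
  qed
qed

lemma dual_zero_set:
  assumes W: "lin_subspace N W" "W \<subseteq> \<gg>"
  shows "{y \<in> W. \<forall>l\<in>dual \<gg>. l y = 0} = {0\<^sub>m N N}"
proof (intro equalityI subsetI)
  fix y assume "y \<in> {y \<in> W. \<forall>l\<in>dual \<gg>. l y = 0}"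
  then have "y = 0\<^sub>m N N" using W(2) by (intro dual_separates) auto
  then show "y \<in> {0\<^sub>m N N}" by simp
next
  fix y assume "y \<in> {0\<^sub>m N N :: 'k mat}"
  then have "y = 0\<^sub>m N N" by simp
  then show "y \<in> {y \<in> W. \<forall>l\<in>dual \<gg>. l y = 0}"
    using lin_subspaceD(2)[OF W(1)] dualD(4) by simp
qed

lemma card_dual: "card (dual \<gg>) = card \<gg>"
  using pairing_annihilator[OF _ g_subspace order_refl, of "{}"] zero_annihilator[of "{}"]
    dual_zero_set[OF g_subspace order_refl]
  by (simp add: annihilator_empty)

lemma card_annihilator:
  assumes W: "lin_subspace N W" "W \<subseteq> \<gg>"
  shows "card W * card (annihilator W) = card \<gg>"
  using pairing_annihilator[of "{}", OF _ W] dual_zero_set[OF W]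
  by (simp add: annihilator_empty card_dual) (simp add: annihilator_def)

text \<open>W is contained in its double annihilator, and both have |\<gg>| / |annihilator W|
  elements.\<close>

lemma annihilator_annihilator:
  assumes W: "lin_subspace N W" "W \<subseteq> \<gg>"
  shows "{y \<in> \<gg>. \<forall>l\<in>annihilator W. l y = 0} = W"
proof -
  let ?A = "{y \<in> \<gg>. \<forall>l\<in>annihilator W. l y = 0}"
  have "card \<gg> = card (annihilator W) * card ?A"
    using pairing_annihilator[OF W(2) g_subspace order_refl] zero_annihilator[OF W(2)] by simp
  then have "card W * card (annihilator W) = card ?A * card (annihilator W)"
    using card_annihilator[OF W] by (simp add: mult.commute)
  moreover have "card (annihilator W) > 0"
    using card_annihilator[OF W] g_closed(1) gV.finite_V by (metis card_gt_0_iff empty_iff mult_is_0 neq0_conv)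
  ultimately have "card W = card ?A" by simp
  moreover have "W \<subseteq> ?A" using W(2) by (auto simp: annihilator_def)
  ultimately show ?thesis using gV.finite_V by (intro card_subset_eq[symmetric]) auto
qed

lemma annihilator_character_sum:
  assumes W: "lin_subspace N W" "W \<subseteq> \<gg>" and y: "y \<in> \<gg>"
  shows "(\<Sum>l\<in>annihilator W. \<psi> (l y)) = (if y \<in> W then of_nat (card (annihilator W)) else 0)"
proof -
  have "y \<in> W \<longleftrightarrow> (\<forall>l\<in>annihilator W. l y = 0)" using annihilator_annihilator[OF W] y by blast
  then show ?thesis
    using linear_set.character_sum[OF linear_set_annihilator[OF W(2)] \<psi> linear_form_eval[OF W(2) y]]
    by simp
qed

section \<open>Coadjoint orbits and their stabilizers\<close>

abbreviation "coad \<equiv> coadjoint N \<gg>"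

lemma coad_apply: "x \<in> \<gg> \<Longrightarrow> coad a l x = l (Ad a x)"
  by (simp add: coadjoint_def Ad_def)

lemma coad_mem: "a \<in> carrier G \<Longrightarrow> l \<in> dual \<gg> \<Longrightarrow> coad a l \<in> dual \<gg>"
  unfolding coadjoint_def Ad_def[symmetric]
  using Ad_closed g_carrier by (intro dualI) (auto simp: dualD Ad_linear)

lemma coad_mult:
  assumes "a \<in> carrier G" "b \<in> carrier G" "l \<in> dual \<gg>"
  shows "coad (a \<otimes>\<^bsub>G\<^esub> b) l = coad a (coad b l)"
proof (rule dual_eqI)
  fix x assume x: "x \<in> \<gg>"
  show "coad (a \<otimes>\<^bsub>G\<^esub> b) l x = coad a (coad b l) x"
    using x assms Ad_closed[of a x] by (simp add: coad_apply Ad_mult g_carrier)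
qed (use assms coad_mem in auto)

lemma coad_one: "l \<in> dual \<gg> \<Longrightarrow> coad \<one>\<^bsub>G\<^esub> l = l"
  by (rule dual_eqI) (auto simp: coad_mem coad_apply Ad_one g_carrier)

definition orbit :: "('k mat \<Rightarrow> 'k) \<Rightarrow> ('k mat \<Rightarrow> 'k) set" where
  "orbit l = (\<lambda>a. coad a l) ` carrier G"

definition Stab :: "('k mat \<Rightarrow> 'k) \<Rightarrow> 'k mat set" where
  "Stab l = {a \<in> carrier G. coad a l = l}"

lemma orbit_subset: "l \<in> dual \<gg> \<Longrightarrow> orbit l \<subseteq> dual \<gg>"
  using coad_mem by (auto simp: orbit_def)

lemma finite_orbit: "finite (orbit l)"
  by (simp add: orbit_def G.finite_carrier)

lemma orbit_eq: "l \<in> dual \<gg> \<Longrightarrow> m \<in> orbit l \<Longrightarrow> orbit m = orbit l"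
proof -
  assume l: "l \<in> dual \<gg>" and "m \<in> orbit l"
  then obtain b where b: "b \<in> carrier G" "m = coad b l" by (auto simp: orbit_def)
  have 1: "coad a l = coad (a \<otimes>\<^bsub>G\<^esub> inv\<^bsub>G\<^esub> b) m" if "a \<in> carrier G" for a
    using that b l by (simp add: coad_mult[symmetric] G.m_assoc)
  have 2: "coad a m = coad (a \<otimes>\<^bsub>G\<^esub> b) l" if "a \<in> carrier G" for a
    using that b l by (simp add: coad_mult)
  show ?thesis
    unfolding orbit_def
  proof (intro equalityI image_subsetI)
    fix a assume a: "a \<in> carrier G"
    show "coad a m \<in> (\<lambda>a. coad a l) ` carrier G"
      unfolding 2[OF a] using a b(1) by (intro imageI) simp
    show "coad a l \<in> (\<lambda>a. coad a m) ` carrier G"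
      unfolding 1[OF a] using a b(1) by (intro imageI) simp
  qed
qed

lemma coadjoint_orbitsD:
  assumes "\<Omega> \<in> coadjoint_orbits N \<gg>"
  shows "l \<in> \<Omega> \<Longrightarrow> l \<in> dual \<gg>" "l \<in> \<Omega> \<Longrightarrow> \<Omega> = orbit l" "finite \<Omega>" "\<Omega> \<noteq> {}"
proof -
  obtain m where m: "m \<in> dual \<gg>" "\<Omega> = orbit m"
    using assms by (auto simp: coadjoint_orbits_def orbit_def)
  show "l \<in> \<Omega> \<Longrightarrow> l \<in> dual \<gg>" using orbit_subset[OF m(1)] m(2) by blast
  show "l \<in> \<Omega> \<Longrightarrow> \<Omega> = orbit l" using orbit_eq[OF m(1), of l] m(2) by simp
  show "finite \<Omega>" "\<Omega> \<noteq> {}" using m finite_orbit G.one_closed by (auto simp: orbit_def)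
qed

lemma card_coad_fiber:
  assumes l: "l \<in> dual \<gg>" and b: "b \<in> carrier G"
  shows "card {a \<in> carrier G. coad a l = coad b l} = card (Stab l)"
proof -
  have "bij_betw (\<lambda>a. b \<otimes>\<^bsub>G\<^esub> a) (Stab l) {a \<in> carrier G. coad a l = coad b l}"
  proof (rule bij_betw_byWitness[of _ "\<lambda>a. inv\<^bsub>G\<^esub> b \<otimes>\<^bsub>G\<^esub> a"])
    show "(\<lambda>a. inv\<^bsub>G\<^esub> b \<otimes>\<^bsub>G\<^esub> a) ` {a \<in> carrier G. coad a l = coad b l} \<subseteq> Stab l"
      using l b by (auto simp: Stab_def coad_mult) (simp add: coad_mult[symmetric] coad_one)
  qed (use l b in \<open>auto simp: Stab_def coad_mult G.m_assoc[symmetric]\<close>)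
  then show ?thesis by (rule bij_betw_same_card[symmetric])
qed

lemma sum_over_orbit:
  assumes l: "l \<in> dual \<gg>"
  shows "(\<Sum>a\<in>carrier G. f (coad a l)) = of_nat (card (Stab l)) * (\<Sum>m\<in>orbit l. f m :: complex)"
proof -
  have "(\<Sum>a\<in>carrier G. f (coad a l)) =
      (\<Sum>m\<in>orbit l. \<Sum>a | a \<in> carrier G \<and> coad a l = m. f (coad a l))"
    unfolding orbit_def by (rule sum.image_gen[OF G.finite_carrier])
  also have "\<dots> = (\<Sum>m\<in>orbit l. of_nat (card (Stab l)) * f m)"
  proof (intro sum.cong refl)
    fix m assume "m \<in> orbit l"
    then show "(\<Sum>a | a \<in> carrier G \<and> coad a l = m. f (coad a l)) = of_nat (card (Stab l)) * f m"
      using card_coad_fiber[OF l] by (auto simp: orbit_def)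
  qed
  finally show ?thesis by (simp add: sum_distrib_left)
qed

lemma card_orbit: "l \<in> dual \<gg> \<Longrightarrow> card (Stab l) * card (orbit l) = card \<gg>"
  using sum_over_orbit[of l "\<lambda>_. 1"] by (simp add: card_G flip: of_nat_mult)

section \<open>The radical of the form l([x, y])\<close>

definition radical :: "('k mat \<Rightarrow> 'k) \<Rightarrow> 'k mat set" where
  "radical l = {x \<in> \<gg>. \<forall>y\<in>\<gg>. l (bracket x y) = 0}"

lemma l_bracket_swap:
  assumes "l \<in> dual \<gg>" "x \<in> \<gg>" "y \<in> \<gg>"
  shows "l (bracket y x) = - l (bracket x y)"
  using bracket_linear(6)[of x N y x] assms g_carrier dualD(2)[OF assms(1) g_bracket[OF assms(2,3)], of "-1"]
  by simp

lemma kernel_subspace: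
  assumes l: "l \<in> dual \<gg>" and W: "lin_subspace N W" "W \<subseteq> \<gg>"
  shows "lin_subspace N {v \<in> W. l v = 0}"
  using lin_subspaceD[OF W(1)] W(2) dualD[OF l] unfolding lin_subspace_iff
  by (auto simp: subset_iff)

text \<open>Both directions compare Ad (ex x) y with y modulo the kernel of l. If x is in the
  radical, all brackets with x lie in that kernel, so conjugation does nothing modulo it. The
  converse is the descending induction behind \<open>mat_exp_conj_stabilizer\<close>, as the kernel
  of l has no stability under brackets in general.\<close>

lemma Stab_radical:
  assumes l: "l \<in> dual \<gg>"
  shows "Stab l = ex ` radical l"
proof -
  let ?V = "{v \<in> \<gg>. l v = 0}"
  have V: "lin_subspace N ?V" by (rule kernel_subspace[OF l g_subspace order_refl])
  have iff: "coad (ex x) l = l \<longleftrightarrow> x \<in> radical l" if x: "x \<in> \<gg>" for x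
  proof
    have a: "ex x \<in> carrier G" using x by (simp add: carrier_G)
    have diff: "l (Ad (ex x) y - y) = l (Ad (ex x) y) - l y" if "y \<in> \<gg>" for y
    proof -
      have "Ad (ex x) y - y = Ad (ex x) y + (- y)"
        using Ad_carrier[OF a g_carrier[OF that]] g_carrier[OF that] by (intro eq_matI) auto
      then show ?thesis
        using dualD(1)[OF l Ad_closed[OF a that] g_closed(4)[OF that]] dualD(5)[OF l that] by simp
    qed
    show "x \<in> radical l" if "coad (ex x) l = l"
      unfolding radical_def
    proof (intro CollectI conjI ballI)
      fix y assume y: "y \<in> \<gg>"
      have "bracket y x \<in> ?V"
      proof (rule mat_exp_conj_stabilizer[OF lie V _ x _ y])
        fix z assume z: "z \<in> \<gg>"
        have "l (Ad (ex x) z) = l z" using coad_apply[OF z, of "ex x" l] that by simp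
        then have "Ad (ex x) z - z \<in> ?V"
          using z diff[OF z] g_closed(5)[OF Ad_closed[OF a z] z] by simp
        then show "ex (- x) * z * ex x - z \<in> ?V" by (simp add: Ad_ex x)
      qed (use g_ut in auto)
      then show "l (bracket x y) = 0" using l_bracket_swap[OF l x y] by simp
    qed (rule x)
    show "coad (ex x) l = l" if rad: "x \<in> radical l"
    proof (rule dual_eqI)
      fix y assume y: "y \<in> \<gg>"
      have "l (bracket v x) = 0" if "v \<in> \<gg>" for v
        using rad that l_bracket_swap[OF l x that] by (simp add: radical_def)
      then have "Ad (ex x) y - y \<in> ?V"
        using x y g_bracket by (intro Ad_diff[OF V]) auto
      then show "coad (ex x) l y = l y" using diff[OF y] by (simp add: coad_apply[OF y])
    qed (use coad_mem a l in auto)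
  qed
  show ?thesis using iff by (auto simp: Stab_def carrier_G radical_def)
qed

lemma card_Stab: "l \<in> dual \<gg> \<Longrightarrow> card (Stab l) = card (radical l)"
  unfolding Stab_radical by (rule card_image) (auto intro: inj_on_subset[OF ex_inj] simp: radical_def)

end

section \<open>Polarizations and characters\<close>

context kirillov
begin

lemma form_linear:
  assumes l: "l \<in> dual \<gg>" and u: "u \<in> \<gg>" and v: "v \<in> \<gg>" and w: "w \<in> \<gg>"
  shows "l (bracket (u + v) w) = l (bracket u w) + l (bracket v w)"
    "l (bracket w (u + v)) = l (bracket w u) + l (bracket w v)"
    "l (bracket (c \<cdot>\<^sub>m u) w) = c * l (bracket u w)" "l (bracket w (c \<cdot>\<^sub>m u)) = c * l (bracket w u)"
    "l (bracket u u) = 0"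
  using assms
  by (simp_all add: bracket_linear[OF g_carrier[OF u] g_carrier[OF v] g_carrier[OF w]]
      dualD[OF l] g_bracket)

lemma polarizationD:
  assumes "polarization N \<gg> l \<pp>"
  shows "lin_subspace N \<pp>" "\<pp> \<subseteq> \<gg>" "x \<in> \<pp> \<Longrightarrow> y \<in> \<pp> \<Longrightarrow> bracket x y \<in> \<pp>"
    "x \<in> \<pp> \<Longrightarrow> y \<in> \<pp> \<Longrightarrow> l (bracket x y) = 0"
  using assms by (auto simp: polarization_def lie_subalgebra_def isotropic_def)

text \<open>Adding the line through x to \<pp> keeps the space isotropic. Maximality is among
  subspaces, so the enlarged space does not have to be a subalgebra.\<close>

lemma polarization_maximal:
  assumes l: "l \<in> dual \<gg>" and pol: "polarization N \<gg> l \<pp>"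
    and x: "x \<in> \<gg>" and iso: "\<And>y. y \<in> \<pp> \<Longrightarrow> l (bracket y x) = 0"
  shows "x \<in> \<pp>"
proof -
  note p = polarizationD[OF pol]
  note P = lin_subspaceD[OF p(1)]
  have pg: "y \<in> \<gg>" if "y \<in> \<pp>" for y using that p(2) by blast
  define W where "W = {y + c \<cdot>\<^sub>m x | y c. y \<in> \<pp>}"
  have W_I: "y + c \<cdot>\<^sub>m x \<in> W" if "y \<in> \<pp>" for y c using that by (auto simp: W_def)
  note xc = g_carrier[OF x]
  have W: "lin_subspace N W"
    unfolding lin_subspace_iff
  proof (intro conjI ballI allI subsetI)
    fix w assume "w \<in> W"
    then show "w \<in> carrier_mat N N" using P(1) xc by (auto simp: W_def)
  next
    have "0\<^sub>m N N + 0 \<cdot>\<^sub>m x = 0\<^sub>m N N" using xc by (intro eq_matI) auto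
    then show "0\<^sub>m N N \<in> W" using W_I[OF P(2), of 0] by simp
  next
    fix v w assume "v \<in> W" "w \<in> W"
    then obtain y c z d where yz: "y \<in> \<pp>" "z \<in> \<pp>" "v = y + c \<cdot>\<^sub>m x" "w = z + d \<cdot>\<^sub>m x"
      by (auto simp: W_def)
    have "v + w = (y + z) + (c + d) \<cdot>\<^sub>m x"
      using yz P(1)[OF yz(1)] P(1)[OF yz(2)] xc by (intro eq_matI) (auto simp: algebra_simps)
    then show "v + w \<in> W" using W_I[OF P(3)[OF yz(1,2)]] by simp
  next
    fix c w assume "w \<in> W"
    then obtain y d where y: "y \<in> \<pp>" "w = y + d \<cdot>\<^sub>m x" by (auto simp: W_def)
    have "c \<cdot>\<^sub>m w = c \<cdot>\<^sub>m y + (c * d) \<cdot>\<^sub>m x"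
      using y P(1)[OF y(1)] xc by (intro eq_matI) (auto simp: algebra_simps)
    then show "c \<cdot>\<^sub>m w \<in> W" using W_I[OF P(4)[OF y(1)]] by simp
  qed
  have xs: "c \<cdot>\<^sub>m x \<in> \<gg>" for c using g_closed(3)[OF x] .
  have "W \<subseteq> \<gg>" using g_closed(2) pg xs by (auto simp: W_def)
  moreover have "isotropic l W"
    unfolding isotropic_def
  proof (intro ballI)
    fix v w assume "v \<in> W" "w \<in> W"
    then obtain y c z d where yz: "y \<in> \<pp>" "z \<in> \<pp>" and vw: "v = y + c \<cdot>\<^sub>m x" "w = z + d \<cdot>\<^sub>m x"
      by (auto simp: W_def)
    note yg = pg[OF yz(1)] and zg = pg[OF yz(2)]
    have xz: "l (bracket x z) = 0" using l_bracket_swap[OF l zg x] iso[OF yz(2)] by simp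
    have xx: "l (bracket x x) = 0" by (rule form_linear(5)[OF l x x x])
    have "l (bracket v w) = l (bracket y w) + c * l (bracket x w)"
      unfolding vw(1) using form_linear(1)[OF l yg xs[of c]] form_linear(3)[OF l x x]
        g_closed(2)[OF zg xs[of d]] vw(2) by simp
    also have "l (bracket y w) = l (bracket y z) + d * l (bracket y x)"
      unfolding vw(2) using form_linear(2)[OF l zg xs[of d] yg] form_linear(4)[OF l x x yg] by simp
    also have "l (bracket x w) = l (bracket x z) + d * l (bracket x x)"
      unfolding vw(2) using form_linear(2)[OF l zg xs[of d] x] form_linear(4)[OF l x x x] by simp
    finally show "l (bracket v w) = 0" using p(4)[OF yz] iso[OF yz(1)] xz xx by simp
  qed
  moreover have "\<pp> \<subseteq> W"
  proof
    fix y assume y: "y \<in> \<pp>"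
    have "y + 0 \<cdot>\<^sub>m x = y" using P(1)[OF y] xc by (intro eq_matI) auto
    then show "y \<in> W" using W_I[OF y, of 0] by simp
  qed
  ultimately have "W = \<pp>" using pol W by (auto simp: polarization_def)
  moreover have "0\<^sub>m N N + 1 \<cdot>\<^sub>m x = x" using xc by (intro eq_matI) auto
  then have "x \<in> W" using W_I[OF P(2), of 1] by simp
  ultimately show ?thesis by simp
qed

text \<open>By maximality \<pp> is its own orthogonal complement in \<gg>, and it contains the
  radical. Pairing \<pp> with \<gg> thus has the radical as one kernel and \<pp> as the other; in
  dimensions, 2 dim \<pp> = dim \<gg> + dim radical.\<close>

lemma card_polarization:
  assumes l: "l \<in> dual \<gg>" and pol: "polarization N \<gg> l \<pp>"
  shows "card \<pp> * card \<pp> = card \<gg> * card (radical l)"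
proof -
  note p = polarizationD[OF pol]
  have pg: "y \<in> \<gg>" if "y \<in> \<pp>" for y using that p(2) by blast
  have "card \<gg> * card {x \<in> \<pp>. \<forall>y\<in>\<gg>. l (bracket x y) = 0} =
      card \<pp> * card {y \<in> \<gg>. \<forall>x\<in>\<pp>. l (bracket x y) = 0}"
  proof (rule pairing_card[OF \<psi> linear_set_mat[OF p(1)] linear_set_mat[OF g_subspace], of "\<lambda>x y. l (bracket x y)"])
    show "gV.linear_form (\<lambda>y. l (bracket x y))" if "x \<in> \<pp>" for x
      unfolding gV.linear_form_def using form_linear(2,4)[OF l] pg[OF that] by blast
    show "linear_set.linear_form (+) (\<cdot>\<^sub>m) \<pp> (\<lambda>x. l (bracket x y))" if "y \<in> \<gg>" for y
      unfolding linear_set.linear_form_def[OF linear_set_mat[OF p(1)]]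
      using form_linear(1,3)[OF l] pg that by blast
  qed
  moreover have "{y \<in> \<gg>. \<forall>x\<in>\<pp>. l (bracket x y) = 0} = \<pp>"
    using polarization_maximal[OF l pol] p(4) pg by blast
  moreover have "{x \<in> \<pp>. \<forall>y\<in>\<gg>. l (bracket x y) = 0} = radical l"
  proof -
    have "x \<in> \<pp>" if "x \<in> radical l" for x
    proof (rule polarization_maximal[OF l pol])
      show x: "x \<in> \<gg>" using that by (simp add: radical_def)
      show "l (bracket y x) = 0" if "y \<in> \<pp>" for y
        using l_bracket_swap[OF l x pg[OF that]] \<open>x \<in> radical l\<close> pg[OF that] by (simp add: radical_def)
    qed
    then show ?thesis using pg unfolding radical_def by blast
  qed
  ultimately show ?thesis by simp
qed

text \<open>Brackets of elements of \<pp> lie in the kernel of l on \<pp>, so conjugation by exp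
  \<pp> moves y only within that kernel.\<close>

lemma polarization_Ad:
  assumes l: "l \<in> dual \<gg>" and pol: "polarization N \<gg> l \<pp>" and x: "x \<in> \<pp>" and y: "y \<in> \<pp>"
  shows "Ad (ex x) y \<in> \<pp>" "l (Ad (ex x) y) = l y"
proof -
  note p = polarizationD[OF pol]
  have xg: "x \<in> \<gg>" and yg: "y \<in> \<gg>" using x y p(2) by auto
  show mem: "Ad (ex x) y \<in> \<pp>" using p(3) x by (intro Ad_mem[OF p(1,2) xg y]) auto
  have "Ad (ex x) y - y \<in> {v \<in> \<pp>. l v = 0}"
    using p x y by (intro Ad_diff[OF kernel_subspace[OF l p(1,2)] _ xg yg]) auto
  then have "l (Ad (ex x) y - y) = 0" by simp
  moreover have "Ad (ex x) y = (Ad (ex x) y - y) + y"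
    using g_carrier[OF yg] lin_subspaceD(1)[OF p(1) mem] by (intro eq_matI) auto
  moreover have "l ((Ad (ex x) y - y) + y) = l (Ad (ex x) y - y) + l y"
    using dualD(1)[OF l _ yg] lin_subspaceD(6)[OF p(1) mem y] p(2) by blast
  ultimately show "l (Ad (ex x) y) = l y" by simp
qed

section \<open>The orbit of exp \<pp> as an affine space\<close>

definition affine_extension :: "('k mat \<Rightarrow> 'k) \<Rightarrow> 'k mat set \<Rightarrow> ('k mat \<Rightarrow> 'k) set" where
  "affine_extension l \<pp> = {m \<in> dual \<gg>. \<forall>x\<in>\<pp>. m x = l x}"

lemma affine_extension_bij:
  assumes l: "l \<in> dual \<gg>" and p: "\<pp> \<subseteq> \<gg>"
  shows "bij_betw (dual_add \<gg> l) (annihilator \<pp>) (affine_extension l \<pp>)"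
  unfolding bij_betw_def
proof
  show "inj_on (dual_add \<gg> l) (annihilator \<pp>)"
    by (rule inj_on_subset[OF dual_add_inj[OF l]]) (auto simp: annihilator_def)
  show "dual_add \<gg> l ` annihilator \<pp> = affine_extension l \<pp>"
  proof (intro equalityI subsetI)
    fix m assume "m \<in> dual_add \<gg> l ` annihilator \<pp>"
    then show "m \<in> affine_extension l \<pp>"
      using dual_add_mem[OF l] p by (auto simp: annihilator_def affine_extension_def dual_add_def)
  next
    fix m assume m: "m \<in> affine_extension l \<pp>"
    then have md: "m \<in> dual \<gg>" by (simp add: affine_extension_def)
    let ?n = "dual_add \<gg> m (dual_scale (- 1) l)"
    have n: "?n \<in> dual \<gg>" by (rule dual_add_mem[OF md dual_scale_mem[OF l]])
    then have "?n \<in> annihilator \<pp>"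
      using m p by (auto simp: annihilator_def affine_extension_def dual_add_def dual_scale_def)
    moreover have "m = dual_add \<gg> l ?n"
      by (rule dual_eqI[OF md dual_add_mem[OF l n]]) (simp add: dual_add_def dual_scale_def)
    ultimately show "m \<in> dual_add \<gg> l ` annihilator \<pp>" by blast
  qed
qed

text \<open>The inclusion of the \<open>P\<close>-orbit of \<open>l\<close> in the affine space \<open>l + \<pp>\<^sup>\<bottom>\<close> is an equality, because
  the former has at least \<open>|\<pp>| / |radical l|\<close> elements and this is the size of the latter.\<close>

lemma polarization_orbit:
  assumes l: "l \<in> dual \<gg>" and pol: "polarization N \<gg> l \<pp>"
  shows "affine_extension l \<pp> \<subseteq> orbit l" "card (orbit l) = card (annihilator \<pp>) * card (annihilator \<pp>)"
proof -
  note p = polarizationD[OF pol]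
  have pg: "y \<in> \<gg>" if "y \<in> \<pp>" for y using that p(2) by blast
  have finp: "finite \<pp>" using p(2) gV.finite_V finite_subset by blast
  have posp: "card \<pp> > 0" using finp lin_subspaceD(2)[OF p(1)] by (auto simp: card_gt_0_iff)
  let ?O = "(\<lambda>x. coad (ex x) l) ` \<pp>"
  have OL: "?O \<subseteq> affine_extension l \<pp>"
  proof (intro image_subsetI)
    fix x assume x: "x \<in> \<pp>"
    then have "coad (ex x) l \<in> dual \<gg>" using coad_mem l pg by (auto simp: carrier_G)
    then show "coad (ex x) l \<in> affine_extension l \<pp>"
      using polarization_Ad(2)[OF l pol x] pg by (simp add: affine_extension_def coad_apply)
  qed
  \<comment> \<open>Counting \<pp> by the fibres of the orbit map: each fibre embeds into a coset of
    the stabilizer, whose size is that of the radical. This bounds the orbit of exp \<pp> from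
    below.\<close>
  have "card \<pp> = (\<Sum>m\<in>?O. card {x \<in> \<pp>. coad (ex x) l = m})"
    using sum.image_gen[OF finp, of "\<lambda>_. 1 :: nat" "\<lambda>x. coad (ex x) l"] by simp
  also have "\<dots> \<le> (\<Sum>m\<in>?O. card (radical l))"
  proof (rule sum_mono)
    fix m assume "m \<in> ?O"
    then obtain y where y: "y \<in> \<pp>" "m = coad (ex y) l" by blast
    have "card {x \<in> \<pp>. coad (ex x) l = m} = card (ex ` {x \<in> \<pp>. coad (ex x) l = m})"
      by (rule card_image[symmetric]) (rule inj_on_subset[OF ex_inj], use pg in auto)
    also have "\<dots> \<le> card {a \<in> carrier G. coad a l = m}"
      using G.finite_carrier pg by (intro card_mono) (auto simp: carrier_G)
    also have "\<dots> = card (radical l)"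
      using card_coad_fiber[OF l, of "ex y"] card_Stab[OF l] y pg by (auto simp: carrier_G)
    finally show "card {x \<in> \<pp>. coad (ex x) l = m} \<le> card (radical l)" .
  qed
  finally have le: "card \<pp> \<le> card ?O * card (radical l)" by simp
  \<comment> \<open>From |\<pp>|^2 = |\<gg>| |radical| and |\<gg>| = |\<pp>| |annihilator| it
    follows that the lower bound is exactly the size of the affine space.\<close>
  have "card \<pp> * card \<pp> = card \<pp> * (card (annihilator \<pp>) * card (radical l))"
    using card_polarization[OF l pol] card_annihilator[OF p(1,2)] by (simp add: mult.assoc)
  then have cp: "card \<pp> = card (annihilator \<pp>) * card (radical l)" using posp by simp
  then have posr: "card (radical l) > 0" using posp by (metis mult_is_0 neq0_conv)
  have cL: "card (affine_extension l \<pp>) = card (annihilator \<pp>)"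
    using bij_betw_same_card[OF affine_extension_bij[OF l p(2)]] by simp
  have "card (affine_extension l \<pp>) \<le> card ?O" using le cp cL posr by simp
  moreover have finL: "finite (affine_extension l \<pp>)"
    using finite_dual by (simp add: affine_extension_def)
  ultimately have "?O = affine_extension l \<pp>"
    using OL card_mono[OF finL OL] by (intro card_subset_eq) auto
  moreover have "?O \<subseteq> orbit l"
    unfolding orbit_def carrier_G using pg by (intro image_subsetI) (auto intro: imageI)
  ultimately show "affine_extension l \<pp> \<subseteq> orbit l" by simp
  \<comment> \<open>The full orbit has |\<gg>| / |radical| elements; both |\<gg>| / |\<pp>| and
    |\<pp>| / |radical| equal the size of the annihilator.\<close>
  have "card (radical l) * card (orbit l) = card (radical l) * (card (annihilator \<pp>) * card (annihilator \<pp>))"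
    using card_orbit[OF l] card_Stab[OF l] card_annihilator[OF p(1,2)] cp by (simp add: algebra_simps)
  then show "card (orbit l) = card (annihilator \<pp>) * card (annihilator \<pp>)" using posr by simp
qed

section \<open>Characters of the orbit representations\<close>

lemma xi_ex: "polarization N \<gg> l \<pp> \<Longrightarrow> y \<in> \<pp> \<Longrightarrow> xi N \<psi> l \<pp> (ex y) = \<psi> (l y)"
  unfolding xi_def using polarizationD(2) inj_on_subset[OF ex_inj] by (subst the_inv_into_f_f) auto

text \<open>The summand is invariant under conjugation by \<open>exp \<pp>\<close>, so the sum over the transversal can be
  averaged over the cosets.\<close>

lemma induced_trace:
  assumes l: "l \<in> dual \<gg>" and pol: "polarization N \<gg> l \<pp>"
    and ts: "left_transversal G (ex ` \<pp>) ts" and x: "x \<in> \<gg>"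
  shows "of_nat (card \<pp>) * mat_trace (induced_rep G (ex ` \<pp>) (xi N \<psi> l \<pp>) ts (ex x)) =
     (\<Sum>b\<in>carrier G. if Ad b x \<in> \<pp> then \<psi> (l (Ad b x)) else 0)"
proof -
  note p = polarizationD[OF pol]
  have pg: "y \<in> \<gg>" if "y \<in> \<pp>" for y using that p(2) by blast
  define F where "F b = (if Ad b x \<in> \<pp> then \<psi> (l (Ad b x)) else 0)" for b
  let ?H = "ex ` \<pp>" and ?f = "\<lambda>(i, c). ts ! i \<otimes>\<^bsub>G\<^esub> c"
  have t: "ts ! i \<in> carrier G" if "i < length ts" for i
    using that ts by (auto simp: left_transversal_def)
  have HG: "?H \<subseteq> carrier G" using pg by (auto simp: carrier_G)
  have entry: "(let h = inv\<^bsub>G\<^esub> b \<otimes>\<^bsub>G\<^esub> ex x \<otimes>\<^bsub>G\<^esub> b in if h \<in> ?H then xi N \<psi> l \<pp> h else 0) = F b"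
    if b: "b \<in> carrier G" for b
  proof -
    have "ex (Ad b x) \<in> ?H \<longleftrightarrow> Ad b x \<in> \<pp>"
      using inj_on_image_mem_iff[OF ex_inj Ad_closed[OF b x] p(2)] .
    then show ?thesis using xi_ex[OF pol] by (simp add: conj_ex[OF b x] F_def)
  qed
  have inv: "F (b \<otimes>\<^bsub>G\<^esub> c) = F b" if b: "b \<in> carrier G" and c: "c \<in> ?H" for b c
  proof -
    obtain z where z: "z \<in> \<pp>" "c = ex z" using c by blast
    have cG: "c \<in> carrier G" using c HG by blast
    have mult: "Ad (b \<otimes>\<^bsub>G\<^esub> c) x = Ad c (Ad b x)" by (rule Ad_mult[OF b cG g_carrier[OF x]])
    have ci: "inv\<^bsub>G\<^esub> c = ex (- z)" unfolding z(2) by (rule inv_G[OF pg[OF z(1)]])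
    have mem: "Ad c (Ad b x) \<in> \<pp> \<longleftrightarrow> Ad b x \<in> \<pp>"
    proof
      assume "Ad c (Ad b x) \<in> \<pp>"
      then have "Ad (inv\<^bsub>G\<^esub> c) (Ad c (Ad b x)) \<in> \<pp>"
        unfolding ci by (rule polarization_Ad(1)[OF l pol lin_subspaceD(5)[OF p(1) z(1)]])
      then show "Ad b x \<in> \<pp>" using Ad_inv[OF cG g_carrier[OF Ad_closed[OF b x]]] by simp
    next
      assume "Ad b x \<in> \<pp>"
      then show "Ad c (Ad b x) \<in> \<pp>" unfolding z(2) by (rule polarization_Ad(1)[OF l pol z(1)])
    qed
    then show ?thesis
      unfolding F_def mult using polarization_Ad(2)[OF l pol z(1), of "Ad b x"] by (simp add: z(2))
  qed
  have bij: "bij_betw ?f ({..<length ts} \<times> ?H) (carrier G)"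
    unfolding bij_betw_def
  proof
    show "?f ` ({..<length ts} \<times> ?H) = carrier G"
    proof (intro equalityI subsetI)
      fix a assume "a \<in> ?f ` ({..<length ts} \<times> ?H)"
      then show "a \<in> carrier G" using t HG by auto
    next
      fix a assume "a \<in> carrier G"
      then obtain i where "i < length ts" "a \<in> ts ! i <#\<^bsub>G\<^esub> ?H"
        using ts unfolding left_transversal_def by blast
      then show "a \<in> ?f ` ({..<length ts} \<times> ?H)"
        by (auto simp: l_coset_def)
    qed
    show "inj_on ?f ({..<length ts} \<times> ?H)"
    proof (rule inj_onI)
      fix u v
      assume "u \<in> {..<length ts} \<times> ?H" "v \<in> {..<length ts} \<times> ?H"
        and uv: "?f u = ?f v"
      then obtain i c j d where i: "i \<in> {..<length ts}" and c: "c \<in> \<pp>" and j: "j \<in> {..<length ts}"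
        and d: "d \<in> \<pp>" and u: "u = (i, ex c)" and v: "v = (j, ex d)"
        by blast
      have eq: "ts ! i \<otimes>\<^bsub>G\<^esub> ex c = ts ! j \<otimes>\<^bsub>G\<^esub> ex d" using uv by (simp add: u v)
      have mem: "ts ! i \<otimes>\<^bsub>G\<^esub> ex c \<in> ts ! i <#\<^bsub>G\<^esub> ?H"
        using c by (auto simp: l_coset_def)
      have mem': "ts ! i \<otimes>\<^bsub>G\<^esub> ex c \<in> ts ! j <#\<^bsub>G\<^esub> ?H"
        unfolding eq using d by (auto simp: l_coset_def)
      have cd: "ex c \<in> carrier G" "ex d \<in> carrier G" using HG c d by auto
      then have "ts ! i \<otimes>\<^bsub>G\<^esub> ex c \<in> carrier G" using t i by auto
      then have "i = j" using ts mem mem' i j unfolding left_transversal_def lessThan_iff by metis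
      then show "u = v" using eq cd t i G.Units_l_cancel G.Units_eq by (auto simp: u v)
    qed
  qed
  have "(\<Sum>b\<in>carrier G. F b) = (\<Sum>(i, c)\<in>{..<length ts} \<times> ?H. F (ts ! i \<otimes>\<^bsub>G\<^esub> c))"
    using sum.reindex_bij_betw[OF bij, of F] by (simp add: case_prod_unfold)
  also have "\<dots> = (\<Sum>i<length ts. \<Sum>c\<in>?H. F (ts ! i \<otimes>\<^bsub>G\<^esub> c))"
    by (simp add: sum.cartesian_product)
  also have "\<dots> = (\<Sum>i<length ts. of_nat (card \<pp>) * F (ts ! i))"
    using inv t card_image[OF inj_on_subset[OF ex_inj p(2)]] by (intro sum.cong refl) simp
  also have "\<dots> = of_nat (card \<pp>) * (\<Sum>i<length ts. F (ts ! i))"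
    by (simp add: sum_distrib_left)
  also have "(\<Sum>i<length ts. F (ts ! i)) = mat_trace (induced_rep G (ex ` \<pp>) (xi N \<psi> l \<pp>) ts (ex x))"
    unfolding mat_trace_def using entry t by (simp add: induced_rep_def)
  finally show ?thesis unfolding F_def ..
qed

lemma Kirillov_character_formula:
  assumes \<Omega>: "\<Omega> \<in> coadjoint_orbits N \<gg>" and T: "T \<in> orbit_rep_class N \<gg> \<psi> \<Omega>" and x: "x \<in> \<gg>"
  shows "of_real (sqrt (card \<Omega>)) * mat_trace (T (ex x)) = (\<Sum>m\<in>\<Omega>. \<psi> (m x))"
proof -
  obtain l \<pp> ts where l: "l \<in> \<Omega>" and pol: "polarization N \<gg> l \<pp>"
    and ts: "left_transversal G (ex ` \<pp>) ts"
    and equiv: "rep_equiv G T (induced_rep G (ex ` \<pp>) (xi N \<psi> l \<pp>) ts)"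
    using T unfolding orbit_rep_class_def by blast
  note O = coadjoint_orbitsD[OF \<Omega>]
  note ld = O(1)[OF l] and Ol = O(2)[OF l]
  note p = polarizationD[OF pol]
  let ?A = "annihilator \<pp>" and ?L = "affine_extension l \<pp>" and ?S = "\<Sum>k\<in>\<Omega>. \<psi> (k x)"
  define t where "t = mat_trace (T (ex x))"
  have trace: "t = mat_trace (induced_rep G (ex ` \<pp>) (xi N \<psi> l \<pp>) ts (ex x))"
    unfolding t_def using rep_equiv_trace[OF equiv] x by (simp add: carrier_G)
  have indicator: "of_nat (card ?A) * (if y \<in> \<pp> then \<psi> (l y) else 0) = (\<Sum>m\<in>?L. \<psi> (m y))"
    if y: "y \<in> \<gg>" for y
  proof -
    have "(\<Sum>m\<in>?L. \<psi> (m y)) = (\<Sum>m\<in>?A. \<psi> (dual_add \<gg> l m y))"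
      by (rule sum.reindex_bij_betw[OF affine_extension_bij[OF ld p(2)], symmetric])
    also have "\<dots> = \<psi> (l y) * (\<Sum>m\<in>?A. \<psi> (m y))"
      using y by (simp add: dual_add_def nontrivial_additive_character_add[OF \<psi>] sum_distrib_left)
    finally show ?thesis using annihilator_character_sum[OF p(1,2) y] by simp
  qed
  \<comment> \<open>Every m in the affine space lies in \<Omega> by
    \<open>polarization_orbit\<close>, so its average over the group is the same orbit average for
    all m.\<close>
  have orbit_sum: "of_nat (card \<Omega>) * (\<Sum>b\<in>carrier G. \<psi> (m (Ad b x))) = of_nat (card \<gg>) * ?S"
    if m: "m \<in> ?L" for m
  proof -
    have m\<Omega>: "m \<in> \<Omega>" using m polarization_orbit(1)[OF ld pol] Ol by blast
    note md = O(1)[OF m\<Omega>] and Om = O(2)[OF m\<Omega>]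
    have "(\<Sum>b\<in>carrier G. \<psi> (m (Ad b x))) = (\<Sum>b\<in>carrier G. \<psi> (coad b m x))"
      using x by (simp add: coad_apply)
    also have "\<dots> = of_nat (card (Stab m)) * ?S"
      unfolding Om by (rule sum_over_orbit[OF md])
    finally have "of_nat (card \<Omega>) * (\<Sum>b\<in>carrier G. \<psi> (m (Ad b x))) =
        of_nat (card (Stab m) * card (orbit m)) * ?S"
      using Om by simp
    then show ?thesis unfolding card_orbit[OF md] .
  qed
  have cg: "card \<gg> = card \<pp> * card ?A" using card_annihilator[OF p(1,2)] by simp
  have "of_nat (card ?A) * (of_nat (card \<pp>) * t) =
      (\<Sum>b\<in>carrier G. of_nat (card ?A) * (if Ad b x \<in> \<pp> then \<psi> (l (Ad b x)) else 0))"
    unfolding trace induced_trace[OF ld pol ts x] by (rule sum_distrib_left)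
  also have "\<dots> = (\<Sum>b\<in>carrier G. \<Sum>m\<in>?L. \<psi> (m (Ad b x)))"
    using indicator Ad_closed x by (intro sum.cong) auto
  also have "\<dots> = (\<Sum>m\<in>?L. \<Sum>b\<in>carrier G. \<psi> (m (Ad b x)))"
    by (rule sum.swap)
  finally have "of_nat (card \<Omega>) * (of_nat (card \<gg>) * t) =
      (\<Sum>m\<in>?L. of_nat (card \<Omega>) * (\<Sum>b\<in>carrier G. \<psi> (m (Ad b x))))"
    by (simp add: cg sum_distrib_left mult_ac)
  also have "\<dots> = (\<Sum>m\<in>?L. of_nat (card \<gg>) * ?S)"
    using orbit_sum by (intro sum.cong) auto
  also have "\<dots> = of_nat (card \<gg>) * (of_nat (card ?A) * ?S)"
    using bij_betw_same_card[OF affine_extension_bij[OF ld p(2)]] by simp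
  finally have main: "of_nat (card \<gg>) * (of_nat (card \<Omega>) * t) =
      of_nat (card \<gg>) * (of_nat (card ?A) * ?S)"
    by (simp only: mult.left_commute)
  have pos: "card \<gg> > 0" using g_closed(1) gV.finite_V by (auto simp: card_gt_0_iff)
  \<comment> \<open>Source of the square root: the annihilator has sqrt |\<Omega>| elements, which
    is also the degree of the representation.\<close>
  have c\<Omega>: "card \<Omega> = card ?A * card ?A" using polarization_orbit(2)[OF ld pol] Ol by simp
  have "card ?A > 0" using cg pos by (metis mult_is_0 neq0_conv)
  then have "of_nat (card ?A) * t = ?S"
    using main pos by (simp add: c\<Omega>)
  moreover have "sqrt (card \<Omega>) = card ?A" by (simp add: c\<Omega>)
  ultimately show ?thesis by (simp add: t_def)
qed

section \<open>Scalar products of orbit characters\<close>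

lemma sum_over_group: "(\<Sum>a\<in>carrier G. f a) = (\<Sum>x\<in>\<gg>. f (ex x))"
  unfolding carrier_G by (simp add: sum.reindex[OF ex_inj])

lemma character_orthogonality:
  assumes k: "k \<in> dual \<gg>" and m: "m \<in> dual \<gg>"
  shows "(\<Sum>x\<in>\<gg>. \<psi> (k (- x)) * \<psi> (m x)) = (if k = m then of_nat (card \<gg>) else 0)"
proof -
  have "(\<Sum>x\<in>\<gg>. \<psi> (k (- x)) * \<psi> (m x)) = (\<Sum>x\<in>\<gg>. \<psi> (m x - k x))"
  proof (intro sum.cong refl)
    fix x assume "x \<in> \<gg>"
    then show "\<psi> (k (- x)) * \<psi> (m x) = \<psi> (m x - k x)"
      using nontrivial_additive_character_add[OF \<psi>, of "- k x" "m x"] by (simp add: dualD(5)[OF k])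
  qed
  also have "\<dots> = (if \<forall>x\<in>\<gg>. m x - k x = 0 then of_nat (card \<gg>) else 0)"
    by (rule gV.character_sum[OF \<psi>]) (simp add: gV.linear_form_def dualD[OF k] dualD[OF m] algebra_simps)
  also have "(\<forall>x\<in>\<gg>. m x - k x = 0) \<longleftrightarrow> k = m" using dual_eqI[OF k m] by auto
  finally show ?thesis .
qed

text \<open>Irreducibility of T^\<Omega> in the form demanded by
  \<open>multiplicity_rep_char_prod\<close>: among the pairs from \<Omega>, only the |\<Omega>|
  diagonal ones survive orthogonality, and they cancel the square of sqrt |\<Omega>|.\<close>

lemma orbit_rep_char_prod_self:
  assumes \<Omega>: "\<Omega> \<in> coadjoint_orbits N \<gg>" and T: "T \<in> orbit_rep_class N \<gg> \<psi> \<Omega>"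
  shows "G.char_prod T T = of_nat (card (carrier G))"
proof -
  note O = coadjoint_orbitsD[OF \<Omega>]
  let ?r = "of_real (sqrt (card \<Omega>)) :: complex"
  have r2: "?r * ?r = of_nat (card \<Omega>)"
    by (simp flip: of_real_mult)
  have "?r * ?r * G.char_prod T T =
     (\<Sum>x\<in>\<gg>. (?r * mat_trace (T (ex (- x)))) * (?r * mat_trace (T (ex x))))"
    by (simp add: G.char_prod_def sum_over_group inv_G sum_distrib_left mult_ac)
  also have "\<dots> = (\<Sum>x\<in>\<gg>. (\<Sum>k\<in>\<Omega>. \<psi> (k (- x))) * (\<Sum>m\<in>\<Omega>. \<psi> (m x)))"
    using Kirillov_character_formula[OF \<Omega> T] g_closed(4) by (intro sum.cong) simp_all
  also have "\<dots> = (\<Sum>k\<in>\<Omega>. \<Sum>m\<in>\<Omega>. \<Sum>x\<in>\<gg>. \<psi> (k (- x)) * \<psi> (m x))"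
    unfolding sum_product by (subst sum.swap) (simp add: sum.swap[of _ \<gg>])
  also have "\<dots> = (\<Sum>k\<in>\<Omega>. \<Sum>m\<in>\<Omega>. if k = m then of_nat (card \<gg>) else 0)"
    using O(1) by (intro sum.cong refl character_orthogonality)
  also have "\<dots> = of_nat (card \<Omega>) * of_nat (card \<gg>)" using O(3) by simp
  finally have "of_nat (card \<Omega>) * G.char_prod T T = of_nat (card \<Omega>) * of_nat (card \<gg>)"
    unfolding r2 .
  moreover have "card \<Omega> > 0" using O(3,4) by (simp add: card_gt_0_iff)
  ultimately show ?thesis by (simp add: card_G)
qed

lemma orbit_rep_char_prod_tensor:
  assumes \<Omega>: "\<Omega> \<in> coadjoint_orbits N \<gg>" and T: "T \<in> orbit_rep_class N \<gg> \<psi> \<Omega>"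
    and \<Omega>1: "\<Omega>1 \<in> coadjoint_orbits N \<gg>" and T1: "T1 \<in> orbit_rep_class N \<gg> \<psi> \<Omega>1"
    and \<Omega>2: "\<Omega>2 \<in> coadjoint_orbits N \<gg>" and T2: "T2 \<in> orbit_rep_class N \<gg> \<psi> \<Omega>2"
  shows "of_real (sqrt (real (card \<Omega>) * real (card \<Omega>1) * real (card \<Omega>2))) * G.char_prod T (tensor_rep T1 T2) =
    of_nat (card (carrier G)) * of_nat (card {(l1, l2). l1 \<in> \<Omega>1 \<and> l2 \<in> \<Omega>2 \<and> dual_add \<gg> l1 l2 \<in> \<Omega>})"
proof -
  note O = coadjoint_orbitsD[OF \<Omega>] and O1 = coadjoint_orbitsD[OF \<Omega>1] and O2 = coadjoint_orbitsD[OF \<Omega>2]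
  let ?r = "of_real (sqrt (card \<Omega>)) :: complex" and ?r1 = "of_real (sqrt (card \<Omega>1)) :: complex"
    and ?r2 = "of_real (sqrt (card \<Omega>2)) :: complex"
  have R1: "rep_on G (rep_degree G T1) T1" and R2: "rep_on G (rep_degree G T2) T2"
    using T1 T2 G.representation_rep_on by (auto simp: orbit_rep_class_def)
  have tensor: "mat_trace (tensor_rep T1 T2 (ex x)) = mat_trace (T1 (ex x)) * mat_trace (T2 (ex x))" if "x \<in> \<gg>" for x
    unfolding tensor_rep_def using that
    by (intro mat_trace_kronecker[OF G.rep_onD(1)[OF R1] G.rep_onD(1)[OF R2]]) (auto simp: carrier_G)
  have "?r * ?r1 * ?r2 * G.char_prod T (tensor_rep T1 T2) =
     (\<Sum>x\<in>\<gg>. (?r * mat_trace (T (ex (- x)))) * ((?r1 * mat_trace (T1 (ex x))) * (?r2 * mat_trace (T2 (ex x)))))"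
    by (simp add: G.char_prod_def sum_over_group inv_G tensor sum_distrib_left mult_ac)
  also have "\<dots> = (\<Sum>x\<in>\<gg>. (\<Sum>k\<in>\<Omega>. \<psi> (k (- x))) * (\<Sum>(l1, l2)\<in>\<Omega>1 \<times> \<Omega>2. \<psi> (dual_add \<gg> l1 l2 x)))"
  proof (intro sum.cong refl)
    fix x assume x: "x \<in> \<gg>"
    have "(\<Sum>l\<in>\<Omega>1. \<psi> (l x)) * (\<Sum>l\<in>\<Omega>2. \<psi> (l x)) = (\<Sum>(l1, l2)\<in>\<Omega>1 \<times> \<Omega>2. \<psi> (dual_add \<gg> l1 l2 x))"
      using x by (simp add: sum_product sum.cartesian_product dual_add_def nontrivial_additive_character_add[OF \<psi>])
    then show "(?r * mat_trace (T (ex (- x)))) * ((?r1 * mat_trace (T1 (ex x))) * (?r2 * mat_trace (T2 (ex x)))) =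
      (\<Sum>k\<in>\<Omega>. \<psi> (k (- x))) * (\<Sum>(l1, l2)\<in>\<Omega>1 \<times> \<Omega>2. \<psi> (dual_add \<gg> l1 l2 x))"
      using Kirillov_character_formula[OF \<Omega> T g_closed(4)[OF x]] Kirillov_character_formula[OF \<Omega>1 T1 x]
        Kirillov_character_formula[OF \<Omega>2 T2 x] by simp
  qed
  also have "\<dots> = (\<Sum>q\<in>\<Omega>1 \<times> \<Omega>2. \<Sum>k\<in>\<Omega>. \<Sum>x\<in>\<gg>. \<psi> (k (- x)) * \<psi> (dual_add \<gg> (fst q) (snd q) x))"
    unfolding sum_product case_prod_unfold
    by (subst sum.swap, subst sum.swap, simp add: sum.swap[of _ \<gg>])
  \<comment> \<open>For a given pair at most one k contributes, namely the sum of the pair if it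
    belongs to \<Omega>; so the triples reduce to the pairs counted by M.\<close>
  also have "\<dots> = (\<Sum>q\<in>\<Omega>1 \<times> \<Omega>2. \<Sum>k\<in>\<Omega>. if k = dual_add \<gg> (fst q) (snd q) then of_nat (card \<gg>) else 0)"
    using O(1) O1(1) O2(1) by (intro sum.cong refl character_orthogonality dual_add_mem) auto
  also have "\<dots> = (\<Sum>q\<in>\<Omega>1 \<times> \<Omega>2. if dual_add \<gg> (fst q) (snd q) \<in> \<Omega> then of_nat (card \<gg>) else 0)"
    using O(3) by simp
  also have "\<dots> = of_nat (card \<gg>) * of_nat (card {q \<in> \<Omega>1 \<times> \<Omega>2. dual_add \<gg> (fst q) (snd q) \<in> \<Omega>})"
    using O1(3) O2(3) by (simp add: sum.If_cases Int_def mult.commute)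
  also have "{q \<in> \<Omega>1 \<times> \<Omega>2. dual_add \<gg> (fst q) (snd q) \<in> \<Omega>} =
      {(l1, l2). l1 \<in> \<Omega>1 \<and> l2 \<in> \<Omega>2 \<and> dual_add \<gg> l1 l2 \<in> \<Omega>}"
    by auto
  finally show ?thesis by (simp add: real_sqrt_mult card_G)
qed

end

theorem corollary12:
  fixes N :: nat and \<gg> :: "'k::{field, finite} mat set" and \<psi> :: "'k \<Rightarrow> complex"
    and \<Omega> \<Omega>1 \<Omega>2 :: "('k mat \<Rightarrow> 'k) set"
    and T T1 T2 :: "'k mat \<Rightarrow> complex mat"
  assumes "N \<ge> 1" and "CHAR('k) \<ge> N"
    and "lie_subalgebra N \<gg>"
    and "nontrivial_additive_character \<psi>"
    and "\<Omega> \<in> coadjoint_orbits N \<gg>"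
    and "\<Omega>1 \<in> coadjoint_orbits N \<gg>"
    and "\<Omega>2 \<in> coadjoint_orbits N \<gg>"
    and "T \<in> orbit_rep_class N \<gg> \<psi> \<Omega>"
    and "T1 \<in> orbit_rep_class N \<gg> \<psi> \<Omega>1"
    and "T2 \<in> orbit_rep_class N \<gg> \<psi> \<Omega>2"
  shows "real (multiplicity_rep (exp_group N \<gg>) T (tensor_rep T1 T2)) =
     real (card {(l1, l2). l1 \<in> \<Omega>1 \<and> l2 \<in> \<Omega>2 \<and> dual_add \<gg> l1 l2 \<in> \<Omega>}) /
     sqrt (real (card \<Omega>) * real (card \<Omega>1) * real (card \<Omega>2))"
proof -
  interpret kirillov N \<gg> \<psi>
    using assms by unfold_locales
  let ?r = "sqrt (real (card \<Omega>) * real (card \<Omega>1) * real (card \<Omega>2))"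
  let ?M = "{(l1, l2). l1 \<in> \<Omega>1 \<and> l2 \<in> \<Omega>2 \<and> dual_add \<gg> l1 l2 \<in> \<Omega>}"
  let ?m = "multiplicity_rep G T (tensor_rep T1 T2)"
  have rep: "representation G T" "representation G T1" "representation G T2"
    using assms(8-10) by (auto simp: orbit_rep_class_def)
  have "representation G (tensor_rep T1 T2)"
    by (rule G.rep_on_representation(1)[OF G.tensor_rep_on]) (rule G.representation_rep_on rep(2,3))+
  \<comment> \<open>Only T has to be irreducible for this count; the tensor product is an arbitrary
    representation decomposed by Maschke's theorem.\<close>
  then have "G.ord_G * of_nat ?m = G.char_prod T (tensor_rep T1 T2)"
    using G.multiplicity_rep_char_prod[OF rep(1) orbit_rep_char_prod_self] assms by blast
  then have "of_real ?r * (G.ord_G * of_nat ?m) = G.ord_G * of_nat (card ?M)"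
    using orbit_rep_char_prod_tensor[OF assms(5,8,6,9,7,10)] by simp
  then have "G.ord_G * of_real (?r * real ?m) = G.ord_G * of_real (real (card ?M))"
    by (simp add: mult.left_commute)
  then have "of_real (?r * real ?m) = (of_real (real (card ?M)) :: complex)"
    using G.ord_G_nonzero by simp
  then have "?r * real ?m = real (card ?M)"
    by (simp only: of_real_eq_iff)
  moreover have "?r \<noteq> 0"
    using coadjoint_orbitsD(3,4)[OF assms(5)] coadjoint_orbitsD(3,4)[OF assms(6)]
      coadjoint_orbitsD(3,4)[OF assms(7)] by simp
  ultimately show ?thesis by (simp add: field_simps)
qed

end
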